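(* Let $V$ be a representation of a Lie algebroid $A\Rightarrow M$, with flat $A$-connection $\nabla^A$, and let $\nabla$ be a linear connection on $V\to M$. The exterior covariant derivative of Weil cochains $\mathrm d^\nabla\colon W^{\bullet,q}(A;V)\to W^{\bullet,q+1}(A;V)$ is a cochain map (i.e. $\mathrm d^\nabla\delta=\delta\,\mathrm d^\nabla$ on $W^{p,q}(A;V)$ for all $p,q\ge0$) if and only if $\nabla$ is $A$-invariant, that is, $$\nabla^A_\alpha=\nabla_{\rho(\alpha)}\quad\text{and}\quad \iota_{\rho(\alpha)}R^\nabla=0$$ for all $\alpha\in A$. In particular, if $\nabla$ is $A$-invariant, then the operator $\mathrm d^\nabla$ on $W^{1,q}(A;V)$, given by $(\mathrm d^\nabla c)_0(\alpha)=\mathrm d^\nabla c_0(\alpha)$, $(\mathrm d^\nabla c)_1(\beta)=c_0(\beta)-\mathrm d^\nabla c_1(\beta)$, maps IM forms to IM forms.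
   Context: $\rho$ is the anchor of $A$; a representation of $A$ is a vector bundle $V$ with a flat $A$-connection $\nabla^A$; $R^\nabla\in\Omega^2(M;\mathrm{End}V)$ is the curvature of $\nabla$. For $p,q\ge0$, $W^{p,q}(A;V)$ is the set of sequences (Weil cochains) $c=(c_0,\dots,c_p)$ of $\mathbb R$-multilinear alternating maps $c_k\colon\Gamma(A)^{p-k}\to\Omega^{q-k}(M;S^k(A^* )\otimes V)$ (forms of negative degree are zero), written $c_k(\alpha_1,\dots,\alpha_{p-k}\,|\,\beta_1,\dots,\beta_k)\in\Omega^{q-k}(M;V)$ (symmetric and $C^\infty(M)$-multilinear in the $\beta$'s), satisfying the Leibniz identity $$c_k(f\alpha_1,\alpha_2,\dots,\alpha_{p-k}|\cdot)=f c_k(\alpha_1,\dots,\alpha_{p-k}|\cdot)+\mathrm df\wedge c_{k+1}(\alpha_2,\dots,\alpha_{p-k}|\alpha_1,\cdot).$$ Convention: $c_{-1}=c_{p+1}=0$. For $\gamma\in\Omega^m(M;S^n(A^* )\otimes V)$, $\mathcal L^A_\alpha\gamma$ is defined by $(\mathcal L^A_\alpha\gamma)(\beta_1,\dots,\beta_n)(X_1,\dots,X_m)=\nabla^A_\alpha(\gamma(\underline\beta)(\underline X))-\sum_i\gamma(\dots,[\alpha,\beta_i],\dots)(\underline X)-\sum_j\gamma(\underline\beta)(\dots,[\rho(\alpha),X_j],\dots)$. The simplicial differential $\delta\colon W^{p,q}(A;V)\to W^{p+1,q}(A;V)$ is $$(-1)^k(\delta c)_k(\alpha_0,\dots,\alpha_{p-k}|\underline\beta)=\sum_{i}(-1)^i\mathcal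 L^A_{\alpha_i}\big(c_k(\alpha_0,\dots,\widehat{\alpha_i},\dots,\alpha_{p-k}|\cdot)\big)(\underline\beta)$$ $$+\sum_{i<j}(-1)^{i+j}c_k([\alpha_i,\alpha_j],\alpha_0,\dots,\widehat{\alpha_i},\dots,\widehat{\alpha_j},\dots,\alpha_{p-k}|\underline\beta)-\sum_{j=1}^k\iota_{\rho(\beta_j)}c_{k-1}(\underline\alpha|\beta_1,\dots,\widehat{\beta_j},\dots,\beta_k).$$ Elements of $\ker\delta\cap W^{1,q}(A;V)$ are called IM forms. The exterior covariant derivative $\mathrm d^\nabla\colon W^{p,q}(A;V)\to W^{p,q+1}(A;V)$ is $$(-1)^k(\mathrm d^\nabla c)_k(\underline\alpha|\underline\beta)=\mathrm d^\nabla\big(c_k(\underline\alpha|\underline\beta)\big)-\sum_{i=1}^k c_{k-1}(\beta_i,\underline\alpha|\beta_1,\dots,\widehat{\beta_i},\dots,\beta_k),$$ where on the right $\mathrm d^\nabla$ is the usual exterior covariant derivative of $V$-valued forms on $M$. *)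

theory Defs
  imports "HOL-Analysis.Analysis" "HOL-Library.Function_Algebras"
begin

text \<open>
  Sections, vector fields, forms and cochains are functions; via \<open>Function_Algebras\<close>
  the operations \<open>+\<close>, \<open>-\<close>, \<open>*\<close>, \<open>0\<close> on them are the pointwise ones.
\<close>

section \<open>Smooth manifolds\<close>

text \<open>
  Model spaces and fibres are finite-dimensional normed spaces. Unlike \<open>euclidean_space\<close>,
  this class does not exclude the zero space, so manifolds of dimension 0 and bundles of
  rank 0 are covered.
\<close>

class fin_dim_normed_vector = real_normed_vector +
  assumes finite_spanning_set: "\<exists>B. finite B \<and> (\<forall>x. \<exists>r. x = (\<Sum>b\<in>B. r b *\<^sub>R b))"

instance euclidean_space \<subseteq> fin_dim_normed_vector
  by standard (metis finite_Basis euclidean_representation)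

text \<open>
  On an open subset of a finite-dimensional space, \<open>Ck_on k\<close> is the class \<open>C^k\<close>: the
  derivative is \<open>C^(k-1)\<close> as a map into linear maps iff all its evaluations at fixed
  vectors are.
\<close>

primrec Ck_on :: "nat \<Rightarrow> 'e::real_normed_vector set \<Rightarrow> ('e \<Rightarrow> 'f::real_normed_vector) \<Rightarrow> bool" where
  "Ck_on 0 S f \<longleftrightarrow> continuous_on S f"
| "Ck_on (Suc k) S f \<longleftrightarrow>
     (\<forall>x\<in>S. f differentiable (at x)) \<and> (\<forall>v. Ck_on k S (\<lambda>x. frechet_derivative f (at x) v))"

definition smooth_on :: "'e::real_normed_vector set \<Rightarrow> ('e \<Rightarrow> 'f::real_normed_vector) \<Rightarrow> bool" where
  "smooth_on S f \<longleftrightarrow> (\<forall>k. Ck_on k S f)"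

text \<open>The underlying set of the manifold is the whole type \<open>'m\<close>; a chart is a pair of its
  domain and its coordinate map.\<close>

type_synonym ('m, 'e) atlas = "('m set \<times> ('m \<Rightarrow> 'e)) set"

definition smooth_manifold ::
  "('m::{t2_space,second_countable_topology}, 'e::fin_dim_normed_vector) atlas \<Rightarrow> bool" where
  "smooth_manifold M \<longleftrightarrow>
     (\<Union>(U, \<phi>)\<in>M. U) = UNIV \<and>
     (\<forall>(U, \<phi>)\<in>M. open U \<and> open (\<phi> ` U) \<and> (\<exists>\<psi>. homeomorphism U (\<phi> ` U) \<phi> \<psi>)) \<and>
     (\<forall>(U, \<phi>)\<in>M. \<forall>(U', \<phi>')\<in>M. smooth_on (\<phi> ` (U \<inter> U')) (\<phi>' \<circ> inv_into U \<phi>))"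

definition msmooth_on ::
  "('m, 'e::real_normed_vector) atlas \<Rightarrow> 'm set \<Rightarrow> ('m \<Rightarrow> 'f::real_normed_vector) \<Rightarrow> bool" where
  "msmooth_on M W f \<longleftrightarrow> (\<forall>(U, \<phi>)\<in>M. smooth_on (\<phi> ` (U \<inter> W)) (f \<circ> inv_into U \<phi>))"

definition smooth_funs :: "('m, 'e::real_normed_vector) atlas \<Rightarrow> ('m \<Rightarrow> real) set" where
  "smooth_funs M = {f. msmooth_on M UNIV f}"

text \<open>
  Tangent vectors at \<open>x\<close> are derivations of the smooth functions at \<open>x\<close>. The value 0 outside
  the smooth functions makes equality of functions equality of derivations.
\<close>

definition tangent_space :: "('m, 'e::real_normed_vector) atlas \<Rightarrow> 'm \<Rightarrow> (('m \<Rightarrow> real) \<Rightarrow> real) set" where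
  "tangent_space M x = {v.
     (\<forall>f\<in>smooth_funs M. \<forall>g\<in>smooth_funs M.
        v (f + g) = v f + v g \<and> v (f * g) = f x * v g + g x * v f) \<and>
     (\<forall>r. \<forall>f\<in>smooth_funs M. v (\<lambda>y. r * f y) = r * v f) \<and>
     (\<forall>f. f \<notin> smooth_funs M \<longrightarrow> v f = 0)}"

type_synonym 'm vfield = "'m \<Rightarrow> ('m \<Rightarrow> real) \<Rightarrow> real"

definition vfields :: "('m, 'e::real_normed_vector) atlas \<Rightarrow> 'm vfield set" where
  "vfields M = {X. (\<forall>x. X x \<in> tangent_space M x) \<and>
     (\<forall>f\<in>smooth_funs M. (\<lambda>x. X x f) \<in> smooth_funs M)}"

definition vf_smul :: "('m \<Rightarrow> real) \<Rightarrow> 'm vfield \<Rightarrow> 'm vfield" where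
  "vf_smul f X = (\<lambda>x g. f x * X x g)"

definition vf_bracket :: "'m vfield \<Rightarrow> 'm vfield \<Rightarrow> 'm vfield" where
  "vf_bracket X Y = (\<lambda>x f. X x (\<lambda>y. Y y f) - Y x (\<lambda>y. X y f))"


section \<open>Vector bundles and connections\<close>

text \<open>
  The fibre over \<open>x\<close> is \<open>{x} \<times> 'v\<close>: since all fibres have the same finite dimension,
  one may identify each of them, as a vector space and separately for each \<open>x\<close>, with \<open>'v\<close>. No
  continuity in \<open>x\<close> is attached to this identification, so it does not make the bundle
  trivial. Topology and smooth structure come only from the local trivializations
  \<open>(U, \<tau>)\<close>, where \<open>\<tau> x\<close> is a linear isomorphism from the fibre over \<open>x \<in> U\<close> to \<open>'v\<close> and the
  transition functions are smooth.
\<close>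

type_synonym ('m, 'v) vbundle = "('m set \<times> ('m \<Rightarrow> 'v \<Rightarrow> 'v)) set"

definition vector_bundle ::
  "('m::topological_space, 'e::real_normed_vector) atlas \<Rightarrow> ('m, 'v::fin_dim_normed_vector) vbundle \<Rightarrow> bool" where
  "vector_bundle M E \<longleftrightarrow>
     (\<Union>(U, \<tau>)\<in>E. U) = UNIV \<and>
     (\<forall>(U, \<tau>)\<in>E. open U \<and> (\<forall>x\<in>U. linear (\<tau> x) \<and> bij (\<tau> x))) \<and>
     (\<forall>(U, \<tau>)\<in>E. \<forall>(U', \<tau>')\<in>E. \<forall>v. msmooth_on M (U \<inter> U') (\<lambda>x. \<tau>' x (inv (\<tau> x) v)))"

definition sections ::
  "('m, 'e::real_normed_vector) atlas \<Rightarrow> ('m, 'v::real_normed_vector) vbundle \<Rightarrow> ('m \<Rightarrow> 'v) set" where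
  "sections M E = {s. \<forall>(U, \<tau>)\<in>E. msmooth_on M U (\<lambda>x. \<tau> x (s x))}"

definition smul :: "('m \<Rightarrow> real) \<Rightarrow> ('m \<Rightarrow> 'v::real_vector) \<Rightarrow> 'm \<Rightarrow> 'v" where
  "smul f s = (\<lambda>x. f x *\<^sub>R s x)"

definition linear_connection ::
  "('m, 'e::real_normed_vector) atlas \<Rightarrow> ('m, 'v::real_normed_vector) vbundle \<Rightarrow>
   ('m vfield \<Rightarrow> ('m \<Rightarrow> 'v) \<Rightarrow> 'm \<Rightarrow> 'v) \<Rightarrow> bool" where
  "linear_connection M V D \<longleftrightarrow>
     (\<forall>X\<in>vfields M. \<forall>s\<in>sections M V. D X s \<in> sections M V) \<and>
     (\<forall>X\<in>vfields M. \<forall>Y\<in>vfields M. \<forall>s\<in>sections M V. D (X + Y) s = D X s + D Y s) \<and>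
     (\<forall>f\<in>smooth_funs M. \<forall>X\<in>vfields M. \<forall>s\<in>sections M V. D (vf_smul f X) s = smul f (D X s)) \<and>
     (\<forall>X\<in>vfields M. \<forall>s\<in>sections M V. \<forall>t\<in>sections M V. D X (s + t) = D X s + D X t) \<and>
     (\<forall>f\<in>smooth_funs M. \<forall>X\<in>vfields M. \<forall>s\<in>sections M V.
        D X (smul f s) = smul f (D X s) + smul (\<lambda>x. X x f) s)"

definition curvature ::
  "('m vfield \<Rightarrow> ('m \<Rightarrow> 'v::real_vector) \<Rightarrow> 'm \<Rightarrow> 'v) \<Rightarrow>
   'm vfield \<Rightarrow> 'm vfield \<Rightarrow> ('m \<Rightarrow> 'v) \<Rightarrow> 'm \<Rightarrow> 'v" where
  "curvature D X Y s = D X (D Y s) - D Y (D X s) - D (vf_bracket X Y) s"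


section \<open>Lie algebroids and representations\<close>

record ('m, 'a) lie_algebroid =
  vbdl :: "('m, 'a) vbundle"
  anchor :: "'m \<Rightarrow> 'a \<Rightarrow> ('m \<Rightarrow> real) \<Rightarrow> real"
  bracket :: "('m \<Rightarrow> 'a) \<Rightarrow> ('m \<Rightarrow> 'a) \<Rightarrow> 'm \<Rightarrow> 'a"

abbreviation asections ::
  "('m, 'e::real_normed_vector) atlas \<Rightarrow> ('m, 'a::real_normed_vector) lie_algebroid \<Rightarrow> ('m \<Rightarrow> 'a) set" where
  "asections M A \<equiv> sections M (vbdl A)"

definition rho :: "('m, 'a) lie_algebroid \<Rightarrow> ('m \<Rightarrow> 'a) \<Rightarrow> 'm vfield" where
  "rho A \<alpha> = (\<lambda>x. anchor A x (\<alpha> x))"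

text \<open>The last conjunct (the anchor preserves brackets) is a consequence of the others, but is
  customarily listed in the definition.\<close>

definition is_lie_algebroid ::
  "('m::topological_space, 'e::real_normed_vector) atlas \<Rightarrow> ('m, 'a::fin_dim_normed_vector) lie_algebroid \<Rightarrow> bool" where
  "is_lie_algebroid M A \<longleftrightarrow>
     vector_bundle M (vbdl A) \<and>
     (\<forall>x a. anchor A x a \<in> tangent_space M x) \<and>
     (\<forall>x a b. anchor A x (a + b) = anchor A x a + anchor A x b) \<and>
     (\<forall>x r a. anchor A x (r *\<^sub>R a) = (\<lambda>f. r * anchor A x a f)) \<and>
     (\<forall>\<alpha>\<in>asections M A. rho A \<alpha> \<in> vfields M) \<and>
     (\<forall>\<alpha>\<in>asections M A. \<forall>\<beta>\<in>asections M A. bracket A \<alpha> \<beta> \<in> asections M A) \<and>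
     (\<forall>\<alpha>\<in>asections M A. \<forall>\<beta>\<in>asections M A. \<forall>\<gamma>\<in>asections M A.
        bracket A \<alpha> (\<beta> + \<gamma>) = bracket A \<alpha> \<beta> + bracket A \<alpha> \<gamma>) \<and>
     (\<forall>\<alpha>\<in>asections M A. \<forall>\<beta>\<in>asections M A. bracket A \<alpha> \<beta> = - bracket A \<beta> \<alpha>) \<and>
     (\<forall>\<alpha>\<in>asections M A. \<forall>\<beta>\<in>asections M A. \<forall>\<gamma>\<in>asections M A.
        bracket A \<alpha> (bracket A \<beta> \<gamma>) + bracket A \<beta> (bracket A \<gamma> \<alpha>) + bracket A \<gamma> (bracket A \<alpha> \<beta>) = 0) \<and>
     (\<forall>f\<in>smooth_funs M. \<forall>\<alpha>\<in>asections M A. \<forall>\<beta>\<in>asections M A.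
        bracket A \<alpha> (smul f \<beta>) = smul f (bracket A \<alpha> \<beta>) + smul (\<lambda>x. rho A \<alpha> x f) \<beta>) \<and>
     (\<forall>\<alpha>\<in>asections M A. \<forall>\<beta>\<in>asections M A. rho A (bracket A \<alpha> \<beta>) = vf_bracket (rho A \<alpha>) (rho A \<beta>))"

definition flat_A_connection ::
  "('m, 'e::real_normed_vector) atlas \<Rightarrow> ('m, 'a::real_normed_vector) lie_algebroid \<Rightarrow>
   ('m, 'v::real_normed_vector) vbundle \<Rightarrow> (('m \<Rightarrow> 'a) \<Rightarrow> ('m \<Rightarrow> 'v) \<Rightarrow> 'm \<Rightarrow> 'v) \<Rightarrow> bool" where
  "flat_A_connection M A V DA \<longleftrightarrow>
     (\<forall>\<alpha>\<in>asections M A. \<forall>s\<in>sections M V. DA \<alpha> s \<in> sections M V) \<and>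
     (\<forall>\<alpha>\<in>asections M A. \<forall>\<beta>\<in>asections M A. \<forall>s\<in>sections M V. DA (\<alpha> + \<beta>) s = DA \<alpha> s + DA \<beta> s) \<and>
     (\<forall>f\<in>smooth_funs M. \<forall>\<alpha>\<in>asections M A. \<forall>s\<in>sections M V. DA (smul f \<alpha>) s = smul f (DA \<alpha> s)) \<and>
     (\<forall>\<alpha>\<in>asections M A. \<forall>s\<in>sections M V. \<forall>t\<in>sections M V. DA \<alpha> (s + t) = DA \<alpha> s + DA \<alpha> t) \<and>
     (\<forall>f\<in>smooth_funs M. \<forall>\<alpha>\<in>asections M A. \<forall>s\<in>sections M V.
        DA \<alpha> (smul f s) = smul f (DA \<alpha> s) + smul (\<lambda>x. rho A \<alpha> x f) s) \<and>
     (\<forall>\<alpha>\<in>asections M A. \<forall>\<beta>\<in>asections M A. \<forall>s\<in>sections M V.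
        DA (bracket A \<alpha> \<beta>) s = DA \<alpha> (DA \<beta> s) - DA \<beta> (DA \<alpha> s))"

definition representation ::
  "('m::topological_space, 'e::real_normed_vector) atlas \<Rightarrow> ('m, 'a::real_normed_vector) lie_algebroid \<Rightarrow>
   ('m, 'v::fin_dim_normed_vector) vbundle \<Rightarrow> (('m \<Rightarrow> 'a) \<Rightarrow> ('m \<Rightarrow> 'v) \<Rightarrow> 'm \<Rightarrow> 'v) \<Rightarrow> bool" where
  "representation M A V DA \<longleftrightarrow> vector_bundle M V \<and> flat_A_connection M A V DA"

definition A_invariant ::
  "('m, 'e::real_normed_vector) atlas \<Rightarrow> ('m, 'a::real_normed_vector) lie_algebroid \<Rightarrow>
   ('m, 'v::real_normed_vector) vbundle \<Rightarrow> (('m \<Rightarrow> 'a) \<Rightarrow> ('m \<Rightarrow> 'v) \<Rightarrow> 'm \<Rightarrow> 'v) \<Rightarrow>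
   ('m vfield \<Rightarrow> ('m \<Rightarrow> 'v) \<Rightarrow> 'm \<Rightarrow> 'v) \<Rightarrow> bool" where
  "A_invariant M A V DA D \<longleftrightarrow>
     (\<forall>\<alpha>\<in>asections M A.
        (\<forall>s\<in>sections M V. DA \<alpha> s = D (rho A \<alpha>) s) \<and>
        (\<forall>X\<in>vfields M. \<forall>s\<in>sections M V. curvature D (rho A \<alpha>) X s = 0))"


section \<open>Forms\<close>

definition tuples :: "nat \<Rightarrow> 'x set \<Rightarrow> 'x list set" where
  "tuples n S = {xs. length xs = n \<and> set xs \<subseteq> S}"

definition omit :: "nat \<Rightarrow> 'x list \<Rightarrow> 'x list" where
  "omit i xs = take i xs @ drop (Suc i) xs"

text \<open>Multilinearity over a set \<open>K\<close> of functions as scalars, acting on the arguments by \<open>sc\<close>.\<close>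

definition multilinear ::
  "('m \<Rightarrow> real) set \<Rightarrow> (('m \<Rightarrow> real) \<Rightarrow> 'x \<Rightarrow> 'x) \<Rightarrow> 'x::plus set \<Rightarrow> nat \<Rightarrow>
   ('x list \<Rightarrow> 'm \<Rightarrow> 'v::real_vector) \<Rightarrow> bool" where
  "multilinear K sc S n F \<longleftrightarrow>
     (\<forall>xs\<in>tuples n S. \<forall>i<n. \<forall>y\<in>S. \<forall>z\<in>S. F (xs[i := y + z]) = F (xs[i := y]) + F (xs[i := z])) \<and>
     (\<forall>xs\<in>tuples n S. \<forall>i<n. \<forall>y\<in>S. \<forall>f\<in>K. F (xs[i := sc f y]) = smul f (F (xs[i := y])))"

definition alternating :: "'x set \<Rightarrow> nat \<Rightarrow> ('x list \<Rightarrow> 'm \<Rightarrow> 'v::real_vector) \<Rightarrow> bool" where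
  "alternating S n F \<longleftrightarrow> (\<forall>xs\<in>tuples n S. \<forall>i<n. \<forall>j<n. i \<noteq> j \<longrightarrow> xs ! i = xs ! j \<longrightarrow> F xs = 0)"

definition symmetric :: "'x set \<Rightarrow> nat \<Rightarrow> ('x list \<Rightarrow> 'm \<Rightarrow> 'v::real_vector) \<Rightarrow> bool" where
  "symmetric S n F \<longleftrightarrow> (\<forall>xs\<in>tuples n S. \<forall>ys\<in>tuples n S. mset xs = mset ys \<longrightarrow> F xs = F ys)"

type_synonym ('m, 'v) vform = "'m vfield list \<Rightarrow> 'm \<Rightarrow> 'v"
type_synonym ('m, 'a, 'v) svform = "('m \<Rightarrow> 'a) list \<Rightarrow> ('m, 'v) vform"

text \<open>
  \<open>sforms M A V m n\<close> is the space of \<open>m\<close>-forms with values in \<open>S^n(A*) \<otimes> V\<close>, as maps of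
  sections multilinear over the smooth functions. The value 0 on all other arguments makes
  equality of functions equality of forms.
\<close>

definition sforms ::
  "('m, 'e::real_normed_vector) atlas \<Rightarrow> ('m, 'a::real_normed_vector) lie_algebroid \<Rightarrow>
   ('m, 'v::real_normed_vector) vbundle \<Rightarrow> nat \<Rightarrow> nat \<Rightarrow> ('m, 'a, 'v) svform set" where
  "sforms M A V m n = {\<gamma>.
     (\<forall>\<beta>s\<in>tuples n (asections M A). \<forall>Xs\<in>tuples m (vfields M). \<gamma> \<beta>s Xs \<in> sections M V) \<and>
     (\<forall>Xs\<in>tuples m (vfields M).
        multilinear (smooth_funs M) smul (asections M A) n (\<lambda>\<beta>s. \<gamma> \<beta>s Xs) \<and>
        symmetric (asections M A) n (\<lambda>\<beta>s. \<gamma> \<beta>s Xs)) \<and>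
     (\<forall>\<beta>s\<in>tuples n (asections M A).
        multilinear (smooth_funs M) vf_smul (vfields M) m (\<gamma> \<beta>s) \<and>
        alternating (vfields M) m (\<gamma> \<beta>s)) \<and>
     (\<forall>\<beta>s Xs. \<not> (\<beta>s \<in> tuples n (asections M A) \<and> Xs \<in> tuples m (vfields M)) \<longrightarrow> \<gamma> \<beta>s Xs = 0)}"

text \<open>The wedge product of \<open>df\<close> with a form, and the exterior covariant derivative (Koszul
  formula), both in the normalization without factorials. The degree of the form enters only
  through the length of the argument list; an empty sum gives 0 on the empty list.\<close>

definition wedge_d :: "('m \<Rightarrow> real) \<Rightarrow> ('m, 'v::real_vector) vform \<Rightarrow> ('m, 'v) vform" where
  "wedge_d f \<omega> Xs = (\<lambda>x. \<Sum>i<length Xs. ((-1) ^ i * (Xs ! i) x f) *\<^sub>R \<omega> (omit i Xs) x)"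

definition ext_d ::
  "('m vfield \<Rightarrow> ('m \<Rightarrow> 'v::real_vector) \<Rightarrow> 'm \<Rightarrow> 'v) \<Rightarrow> ('m, 'v) vform \<Rightarrow> ('m, 'v) vform" where
  "ext_d D \<omega> Xs = (\<lambda>x.
     (\<Sum>i<length Xs. (-1) ^ i *\<^sub>R D (Xs ! i) (\<omega> (omit i Xs)) x) +
     (\<Sum>j<length Xs. \<Sum>i<j.
        (-1) ^ (i + j) *\<^sub>R \<omega> (vf_bracket (Xs ! i) (Xs ! j) # omit i (omit j Xs)) x))"

definition lie_A ::
  "('m, 'a) lie_algebroid \<Rightarrow> (('m \<Rightarrow> 'a) \<Rightarrow> ('m \<Rightarrow> 'v) \<Rightarrow> 'm \<Rightarrow> 'v) \<Rightarrow> ('m \<Rightarrow> 'a) \<Rightarrow>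
   ('m, 'a, 'v::real_vector) svform \<Rightarrow> ('m, 'a, 'v) svform" where
  "lie_A A DA \<alpha> \<gamma> \<beta>s Xs = (\<lambda>x.
     DA \<alpha> (\<gamma> \<beta>s Xs) x
     - (\<Sum>i<length \<beta>s. \<gamma> (\<beta>s[i := bracket A \<alpha> (\<beta>s ! i)]) Xs x)
     - (\<Sum>j<length Xs. \<gamma> \<beta>s (Xs[j := vf_bracket (rho A \<alpha>) (Xs ! j)]) x))"


section \<open>Weil cochains\<close>

text \<open>\<open>c k \<alpha>s \<beta>s Xs\<close> is the value of \<open>c_k(\<alpha>s | \<beta>s)\<close> on the vector fields \<open>Xs\<close>. All
  components are 0 outside \<open>weil_dom\<close>; in particular \<open>c_k = 0\<close> for \<open>k > p\<close>, and forms of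
  negative degree (\<open>k > q\<close>) vanish.\<close>

type_synonym ('m, 'a, 'v) wcochain = "nat \<Rightarrow> ('m \<Rightarrow> 'a) list \<Rightarrow> ('m, 'a, 'v) svform"

definition weil_dom ::
  "('m, 'e::real_normed_vector) atlas \<Rightarrow> ('m, 'a::real_normed_vector) lie_algebroid \<Rightarrow>
   nat \<Rightarrow> nat \<Rightarrow> nat \<Rightarrow> ('m \<Rightarrow> 'a) list \<Rightarrow> ('m \<Rightarrow> 'a) list \<Rightarrow> 'm vfield list \<Rightarrow> bool" where
  "weil_dom M A p q k \<alpha>s \<beta>s Xs \<longleftrightarrow> k \<le> p \<and> k \<le> q \<and>
     \<alpha>s \<in> tuples (p - k) (asections M A) \<and> \<beta>s \<in> tuples k (asections M A) \<and>
     Xs \<in> tuples (q - k) (vfields M)"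

definition weil ::
  "('m, 'e::real_normed_vector) atlas \<Rightarrow> ('m, 'a::real_normed_vector) lie_algebroid \<Rightarrow>
   ('m, 'v::real_normed_vector) vbundle \<Rightarrow> nat \<Rightarrow> nat \<Rightarrow> ('m, 'a, 'v) wcochain set" where
  "weil M A V p q = {c.
     (\<forall>k \<alpha>s. k \<le> p \<longrightarrow> k \<le> q \<longrightarrow> \<alpha>s \<in> tuples (p - k) (asections M A) \<longrightarrow>
        c k \<alpha>s \<in> sforms M A V (q - k) k) \<and>
     (\<forall>k \<beta>s Xs. multilinear (range (\<lambda>r x. r)) smul (asections M A) (p - k) (\<lambda>\<alpha>s. c k \<alpha>s \<beta>s Xs) \<and>
        alternating (asections M A) (p - k) (\<lambda>\<alpha>s. c k \<alpha>s \<beta>s Xs)) \<and>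
     (\<forall>k \<alpha> \<alpha>s \<beta>s Xs. \<forall>f\<in>smooth_funs M. weil_dom M A p q k (\<alpha> # \<alpha>s) \<beta>s Xs \<longrightarrow>
        c k (smul f \<alpha> # \<alpha>s) \<beta>s Xs =
        smul f (c k (\<alpha> # \<alpha>s) \<beta>s Xs) + wedge_d f (c (Suc k) \<alpha>s (\<alpha> # \<beta>s)) Xs) \<and>
     (\<forall>k \<alpha>s \<beta>s Xs. \<not> weil_dom M A p q k \<alpha>s \<beta>s Xs \<longrightarrow> c k \<alpha>s \<beta>s Xs = 0)}"

text \<open>The simplicial differential from bidegree \<open>(p, q)\<close> to \<open>(p + 1, q)\<close>.\<close>

definition delta ::
  "('m, 'e::real_normed_vector) atlas \<Rightarrow> ('m, 'a::real_normed_vector) lie_algebroid \<Rightarrow>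
   (('m \<Rightarrow> 'a) \<Rightarrow> ('m \<Rightarrow> 'v) \<Rightarrow> 'm \<Rightarrow> 'v::real_normed_vector) \<Rightarrow> nat \<Rightarrow> nat \<Rightarrow>
   ('m, 'a, 'v) wcochain \<Rightarrow> ('m, 'a, 'v) wcochain" where
  "delta M A DA p q c k \<alpha>s \<beta>s Xs =
     (if weil_dom M A (p + 1) q k \<alpha>s \<beta>s Xs then (\<lambda>x. (-1) ^ k *\<^sub>R (
        (\<Sum>i<length \<alpha>s. (-1) ^ i *\<^sub>R lie_A A DA (\<alpha>s ! i) (c k (omit i \<alpha>s)) \<beta>s Xs x)
        + (\<Sum>j<length \<alpha>s. \<Sum>i<j.
             (-1) ^ (i + j) *\<^sub>R c k (bracket A (\<alpha>s ! i) (\<alpha>s ! j) # omit i (omit j \<alpha>s)) \<beta>s Xs x)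
        - (\<Sum>j<k. c (k - 1) \<alpha>s (omit j \<beta>s) (rho A (\<beta>s ! j) # Xs) x)))
      else 0)"

text \<open>The exterior covariant derivative from bidegree \<open>(p, q)\<close> to \<open>(p, q + 1)\<close>.\<close>

definition cov_d ::
  "('m, 'e::real_normed_vector) atlas \<Rightarrow> ('m, 'a::real_normed_vector) lie_algebroid \<Rightarrow>
   ('m vfield \<Rightarrow> ('m \<Rightarrow> 'v) \<Rightarrow> 'm \<Rightarrow> 'v::real_normed_vector) \<Rightarrow> nat \<Rightarrow> nat \<Rightarrow>
   ('m, 'a, 'v) wcochain \<Rightarrow> ('m, 'a, 'v) wcochain" where
  "cov_d M A D p q c k \<alpha>s \<beta>s Xs =
     (if weil_dom M A p (q + 1) k \<alpha>s \<beta>s Xs then (\<lambda>x. (-1) ^ k *\<^sub>R (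
        ext_d D (c k \<alpha>s \<beta>s) Xs x
        - (\<Sum>i<k. c (k - 1) (\<beta>s ! i # \<alpha>s) (omit i \<beta>s) Xs x)))
      else 0)"

definition IM_forms ::
  "('m, 'e::real_normed_vector) atlas \<Rightarrow> ('m, 'a::real_normed_vector) lie_algebroid \<Rightarrow>
   ('m, 'v::real_normed_vector) vbundle \<Rightarrow> (('m \<Rightarrow> 'a) \<Rightarrow> ('m \<Rightarrow> 'v) \<Rightarrow> 'm \<Rightarrow> 'v) \<Rightarrow> nat \<Rightarrow>
   ('m, 'a, 'v) wcochain set" where
  "IM_forms M A V DA q = {c \<in> weil M A V 1 q. delta M A DA 1 q c = 0}"

end

theory Submission
  imports Defs
begin

text \<open>
  Everything reduces to Cartan calculus with \<open>V\<close>-valued forms. If \<open>\<nabla>\<close> is \<open>A\<close>-invariant, then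
  \<open>\<nabla>\<^sup>A\<^sub>\<alpha> = \<nabla>\<^bsub>\<rho>(\<alpha>)\<^esub>\<close>, so \<open>L\<^sup>A\<^sub>\<alpha>\<close> acts on the form part as \<open>L\<^bsub>\<rho>(\<alpha>)\<^esub>\<close>, which satisfies
  \<open>L = d \<iota> + \<iota> d\<close> and commutes with \<open>d\<close> because \<open>\<iota>\<^bsub>\<rho>(\<alpha>)\<^esub> R = 0\<close>. Comparing \<open>d \<delta> c\<close> and \<open>\<delta> d c\<close>,
  the terms in \<open>c\<^sub>k\<close> agree since \<open>d\<close> commutes with the Chevalley-Eilenberg part of \<open>\<delta>\<close>, the terms in
  \<open>c\<^bsub>k-1\<^esub>\<close> agree by Cartan's formula, and the terms in \<open>c\<^bsub>k-2\<^esub>\<close> by exchanging two summations over the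
  symmetric arguments. For the converse it suffices to evaluate \<open>d \<delta> s = \<delta> d s\<close> on sections \<open>s\<close>,
  i.e. on cochains of bidegree \<open>(0, 0)\<close>: the component \<open>k = 1\<close> gives \<open>\<nabla>\<^sup>A\<^sub>\<alpha> s = \<nabla>\<^bsub>\<rho>(\<alpha>)\<^esub> s\<close> and the
  component \<open>k = 0\<close> gives \<open>\<iota>\<^bsub>\<rho>(\<alpha>)\<^esub> R = 0\<close>.
\<close>

section \<open>Sums over the entries of a list\<close>

text \<open>The obstacle is bookkeeping: \<open>delta\<close>, \<open>cov_d\<close> and
  \<open>ext_d\<close> are signed sums over positions with omitted entries, and composing two of
  them nests such sums. Each sum is rewritten as a recursion on the argument list that puts the
  skipped head back into the remaining list; identities then follow by list induction with the
  summand generalized, without splitting index ranges. Likewise \<open>form\<close> and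
  \<open>rec_d\<close> peel off one vector field at a time, so contraction becomes consing and the
  calculus of L_X, i_X and d becomes induction on the degree. Charts serve only to show that smooth
  functions and sections are closed under the operations used. Two side conditions shape the
  statements. Connections and d are additive only on genuine sections and forms, whence the carrier
  in \<open>hom_on\<close>; and cochains are controlled only on tuples of the right length, whence
  the congruence rules. Algebroid and base meet in \<open>ce_diff_pick_sum\<close>, a Cartan formula
  summed over the symmetric arguments: L^A also acts on these arguments, but those contributions
  cancel in the sum because the bracket is antisymmetric.\<close>

primrec pick_sum :: "('x \<Rightarrow> 'x list \<Rightarrow> 'b::ab_group_add) \<Rightarrow> 'x list \<Rightarrow> 'b" where
  "pick_sum f [] = 0"
| "pick_sum f (x # xs) = f x xs + pick_sum (\<lambda>y ys. f y (x # ys)) xs"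

primrec alt_pick_sum :: "('x \<Rightarrow> 'x list \<Rightarrow> 'b::ab_group_add) \<Rightarrow> 'x list \<Rightarrow> 'b" where
  "alt_pick_sum f [] = 0"
| "alt_pick_sum f (x # xs) = f x xs - alt_pick_sum (\<lambda>y ys. f y (x # ys)) xs"

text \<open>A pair of positions i < j carries the sign (-1)^(i+j). Prepending a head shifts both
  indices of an old pair, which keeps its sign, and pairs the head with the entry now at position j
  + 1, which produces the minus sign.\<close>

primrec alt_pair_sum :: "('x \<Rightarrow> 'x \<Rightarrow> 'x list \<Rightarrow> 'b::ab_group_add) \<Rightarrow> 'x list \<Rightarrow> 'b" where
  "alt_pair_sum f [] = 0"
| "alt_pair_sum f (x # xs) = alt_pair_sum (\<lambda>y z zs. f y z (x # zs)) xs - alt_pick_sum (f x) xs"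

text \<open>The derivation on lists induced by \<open>T\<close>. With \<open>T\<close> a bracket it
  gives the correction terms of both Lie derivatives, in the vector fields and in the sections of
  the algebroid.\<close>

primrec deriv_sum :: "('x \<Rightarrow> 'x) \<Rightarrow> ('x list \<Rightarrow> 'b::ab_group_add) \<Rightarrow> 'x list \<Rightarrow> 'b" where
  "deriv_sum T F [] = 0"
| "deriv_sum T F (x # xs) = F (T x # xs) + deriv_sum T (\<lambda>ys. F (x # ys)) xs"

lemma omit_Cons [simp]: "omit 0 (x # xs) = xs" "omit (Suc i) (x # xs) = x # omit i xs"
  by (auto simp: omit_def)

lemma sum_omit: "(\<Sum>i<length xs. f (xs ! i) (omit i xs)) = pick_sum f xs"
proof (induction xs arbitrary: f)
  case (Cons x xs)
  then show ?case
    by (simp add: sum.lessThan_Suc_shift del: sum.lessThan_Suc)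
qed simp

lemma sum_list_update: "(\<Sum>i<length xs. F (xs[i := T (xs ! i)])) = deriv_sum T F xs"
proof (induction xs arbitrary: F)
  case (Cons x xs)
  then show ?case
    by (simp add: sum.lessThan_Suc_shift del: sum.lessThan_Suc)
qed simp

text \<open>Signs are real scalars in the definitions of the differentials but subtractions in
  \<open>alt_pick_sum\<close>. Evaluation at \<open>p\<close> matches the pointwise shape of those
  definitions.\<close>

lemma alt_sum_omit:
  fixes f :: "'x \<Rightarrow> 'x list \<Rightarrow> 'm \<Rightarrow> 'v::real_vector"
  shows "(\<Sum>i<length xs. (-1) ^ i *\<^sub>R f (xs ! i) (omit i xs) p) = alt_pick_sum f xs p"
proof (induction xs arbitrary: f)
  case (Cons x xs)
  then show ?case
    by (simp add: sum.lessThan_Suc_shift sum_negf del: sum.lessThan_Suc)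
qed simp

lemma alt_sum_omit_pair:
  fixes f :: "'x \<Rightarrow> 'x \<Rightarrow> 'x list \<Rightarrow> 'm \<Rightarrow> 'v::real_vector"
  shows "(\<Sum>j<length xs. \<Sum>i<j. (-1) ^ (i + j) *\<^sub>R f (xs ! i) (xs ! j) (omit i (omit j xs)) p)
    = alt_pair_sum f xs p"
proof (induction xs arbitrary: f)
  case (Cons x xs)
  show ?case
    using Cons[of "\<lambda>y z zs. f y z (x # zs)"] alt_sum_omit[of "f x" xs p]
    by (simp add: sum.lessThan_Suc_shift sum_subtractf del: sum.lessThan_Suc)
qed simp

lemma tuples_simps [simp]:
  "[] \<in> tuples n S \<longleftrightarrow> n = 0"
  "x # xs \<in> tuples 0 S \<longleftrightarrow> False"
  "x # xs \<in> tuples (Suc n) S \<longleftrightarrow> x \<in> S \<and> xs \<in> tuples n S"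
  by (auto simp: tuples_def)

lemma tuples_0_iff [simp]: "xs \<in> tuples 0 S \<longleftrightarrow> xs = []"
  by (auto simp: tuples_def)

lemma tuples_SucE:
  assumes "xs \<in> tuples (Suc n) S"
  obtains y ys where "xs = y # ys" "y \<in> S" "ys \<in> tuples n S"
  using assms by (cases xs) auto

lemma tuples_ConsE:
  assumes "x # xs \<in> tuples n S"
  obtains m where "n = Suc m" "x \<in> S" "xs \<in> tuples m S"
  using assms by (cases n) auto

lemma tuples_1_iff: "xs \<in> tuples (Suc 0) S \<longleftrightarrow> (\<exists>x\<in>S. xs = [x])"
  by (auto elim: tuples_SucE)

lemma multilinear_1:
  assumes "multilinear K sc S (Suc 0) F" "y \<in> S"
  shows "z \<in> S \<Longrightarrow> F [y + z] = F [y] + F [z]" "f \<in> K \<Longrightarrow> F [sc f y] = smul f (F [y])"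
proof -
  have y: "[y] \<in> tuples (Suc 0) S" using assms(2) by simp
  show "F [y + z] = F [y] + F [z]" if "z \<in> S"
  proof -
    have "F ([y][0 := y + z]) = F ([y][0 := y]) + F ([y][0 := z])"
      using assms y that unfolding multilinear_def by blast
    then show ?thesis by simp
  qed
  show "F [sc f y] = smul f (F [y])" if "f \<in> K"
  proof -
    have "F ([y][0 := sc f y]) = smul f (F ([y][0 := y]))"
      using assms y that unfolding multilinear_def by blast
    then show ?thesis by simp
  qed
qed

text \<open>Closure under differences already gives negatives and sums. The carrier is what makes
  the notion applicable: a connection is additive only on sections, and \<open>rec_d\<close> only on
  forms of one fixed degree.\<close>

definition hom_on :: "'b::ab_group_add set \<Rightarrow> ('b \<Rightarrow> 'c::ab_group_add) \<Rightarrow> bool" where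
  "hom_on K h \<longleftrightarrow> 0 \<in> K \<and> (\<forall>a\<in>K. \<forall>b\<in>K. a - b \<in> K \<and> h (a - b) = h a - h b)"

lemma hom_on_0: "hom_on K h \<Longrightarrow> 0 \<in> K" "hom_on K h \<Longrightarrow> h 0 = 0"
  unfolding hom_on_def by (auto, metis diff_self)

lemma hom_on_diff:
  assumes "hom_on K h" "a \<in> K" "b \<in> K"
  shows "a - b \<in> K" "h (a - b) = h a - h b"
  using assms unfolding hom_on_def by auto

lemma hom_on_minus:
  assumes "hom_on K h" "a \<in> K"
  shows "- a \<in> K" "h (- a) = - h a"
  using hom_on_diff[OF assms(1) hom_on_0(1)[OF assms(1)] assms(2)] hom_on_0[OF assms(1)] by auto

lemma hom_on_add:
  assumes "hom_on K h" "a \<in> K" "b \<in> K"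
  shows "a + b \<in> K" "h (a + b) = h a + h b"
  using hom_on_diff[OF assms(1,2) hom_on_minus(1)[OF assms(1,3)]] hom_on_minus[OF assms(1,3)]
  by auto

text \<open>The hypothesis on \<open>f\<close> concerns only lists one entry shorter than
  \<open>xs\<close>, since membership in \<open>K\<close> is known only for tuples of the correct
  length. Naming that length \<open>m\<close> avoids truncated subtraction.\<close>

lemma hom_on_pick_sum:
  assumes "hom_on K h" "xs \<in> tuples n S"
    and "\<And>x ys m. n = Suc m \<Longrightarrow> x \<in> S \<Longrightarrow> ys \<in> tuples m S \<Longrightarrow> f x ys \<in> K"
  shows "pick_sum f xs \<in> K" "h (pick_sum f xs) = pick_sum (\<lambda>x ys. h (f x ys)) xs"
proof -
  have "pick_sum f xs \<in> K \<and> h (pick_sum f xs) = pick_sum (\<lambda>x ys. h (f x ys)) xs"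
    using assms(2,3)
  proof (induction xs arbitrary: f n)
    case Nil
    then show ?case using hom_on_0[OF assms(1)] by simp
  next
    case (Cons x xs)
    then obtain m where n: "n = Suc m" "x \<in> S" "xs \<in> tuples m S" by (auto elim: tuples_ConsE)
    have "pick_sum (\<lambda>y ys. f y (x # ys)) xs \<in> K \<and> h (pick_sum (\<lambda>y ys. f y (x # ys)) xs)
      = pick_sum (\<lambda>y ys. h (f y (x # ys))) xs"
      by (rule Cons.IH[OF n(3)]) (use n Cons.prems(2) in auto)
    then show ?case
      using hom_on_add[OF assms(1)] n Cons.prems(2)[OF n] by simp
  qed
  then show "pick_sum f xs \<in> K" "h (pick_sum f xs) = pick_sum (\<lambda>x ys. h (f x ys)) xs" by auto
qed

lemma hom_on_alt_pick_sum:
  assumes "hom_on K h" "xs \<in> tuples n S"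
    and "\<And>x ys m. n = Suc m \<Longrightarrow> x \<in> S \<Longrightarrow> ys \<in> tuples m S \<Longrightarrow> f x ys \<in> K"
  shows "alt_pick_sum f xs \<in> K" "h (alt_pick_sum f xs) = alt_pick_sum (\<lambda>x ys. h (f x ys)) xs"
proof -
  have "alt_pick_sum f xs \<in> K \<and> h (alt_pick_sum f xs) = alt_pick_sum (\<lambda>x ys. h (f x ys)) xs"
    using assms(2,3)
  proof (induction xs arbitrary: f n)
    case Nil
    then show ?case using hom_on_0[OF assms(1)] by simp
  next
    case (Cons x xs)
    then obtain m where n: "n = Suc m" "x \<in> S" "xs \<in> tuples m S" by (auto elim: tuples_ConsE)
    have "alt_pick_sum (\<lambda>y ys. f y (x # ys)) xs \<in> K \<and> h (alt_pick_sum (\<lambda>y ys. f y (x # ys)) xs)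
      = alt_pick_sum (\<lambda>y ys. h (f y (x # ys))) xs"
      by (rule Cons.IH[OF n(3)]) (use n Cons.prems(2) in auto)
    then show ?case
      using hom_on_diff[OF assms(1)] n Cons.prems(2)[OF n] by simp
  qed
  then show "alt_pick_sum f xs \<in> K" "h (alt_pick_sum f xs) = alt_pick_sum (\<lambda>x ys. h (f x ys)) xs"
    by auto
qed

lemma hom_on_alt_pair_sum:
  assumes "hom_on K h" "xs \<in> tuples n S"
    and "\<And>x y zs m. n = Suc (Suc m) \<Longrightarrow> x \<in> S \<Longrightarrow> y \<in> S \<Longrightarrow> zs \<in> tuples m S \<Longrightarrow> f x y zs \<in> K"
  shows "alt_pair_sum f xs \<in> K" "h (alt_pair_sum f xs) = alt_pair_sum (\<lambda>x y zs. h (f x y zs)) xs"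
proof -
  have "alt_pair_sum f xs \<in> K \<and> h (alt_pair_sum f xs) = alt_pair_sum (\<lambda>x y zs. h (f x y zs)) xs"
    using assms(2,3)
  proof (induction xs arbitrary: f n)
    case Nil
    then show ?case using hom_on_0[OF assms(1)] by simp
  next
    case (Cons x xs)
    then obtain m where n: "n = Suc m" "x \<in> S" "xs \<in> tuples m S" by (auto elim: tuples_ConsE)
    have *: "alt_pair_sum (\<lambda>y z zs. f y z (x # zs)) xs \<in> K \<and>
      h (alt_pair_sum (\<lambda>y z zs. f y z (x # zs)) xs)
      = alt_pair_sum (\<lambda>y z zs. h (f y z (x # zs))) xs"
      by (rule Cons.IH[OF n(3)]) (use n Cons.prems(2) in auto)
    have "alt_pick_sum (f x) xs \<in> K" "h (alt_pick_sum (f x) xs) = alt_pick_sum (\<lambda>y ys. h (f x y ys)) xs"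
      by (rule hom_on_alt_pick_sum[OF assms(1) n(3)]; use n Cons.prems(2) in auto)+
    then show ?case
      using hom_on_diff[OF assms(1)] n * by simp
  qed
  then show "alt_pair_sum f xs \<in> K" "h (alt_pair_sum f xs) = alt_pair_sum (\<lambda>x y zs. h (f x y zs)) xs"
    by auto
qed

lemma hom_on_deriv_sum:
  assumes "hom_on K h" "xs \<in> tuples n S" "\<And>x. x \<in> S \<Longrightarrow> T x \<in> S"
    and "\<And>ys. ys \<in> tuples n S \<Longrightarrow> F ys \<in> K"
  shows "deriv_sum T F xs \<in> K" "h (deriv_sum T F xs) = deriv_sum T (\<lambda>ys. h (F ys)) xs"
proof -
  have "deriv_sum T F xs \<in> K \<and> h (deriv_sum T F xs) = deriv_sum T (\<lambda>ys. h (F ys)) xs"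
    using assms(2,4)
  proof (induction xs arbitrary: F n)
    case Nil
    then show ?case using hom_on_0[OF assms(1)] by simp
  next
    case (Cons x xs)
    then obtain m where n: "n = Suc m" "x \<in> S" "xs \<in> tuples m S" by (auto elim: tuples_ConsE)
    have "deriv_sum T (\<lambda>ys. F (x # ys)) xs \<in> K \<and> h (deriv_sum T (\<lambda>ys. F (x # ys)) xs)
      = deriv_sum T (\<lambda>ys. h (F (x # ys))) xs"
      by (rule Cons.IH[OF n(3)]) (use n Cons.prems(2) in auto)
    then show ?case
      using hom_on_add[OF assms(1)] n Cons.prems(2)[of "T x # xs"] assms(3) by simp
  qed
  then show "deriv_sum T F xs \<in> K" "h (deriv_sum T F xs) = deriv_sum T (\<lambda>ys. h (F ys)) xs"
    by auto
qed

section \<open>Congruence rules and pointwise evaluation of the list sums\<close>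

lemma pick_sum_cong:
  assumes "xs \<in> tuples n S"
    and "\<And>x ys m. n = Suc m \<Longrightarrow> x \<in> S \<Longrightarrow> ys \<in> tuples m S \<Longrightarrow> f x ys = g x ys"
  shows "pick_sum f xs = pick_sum g xs"
  using assms
proof (induction xs arbitrary: f g n)
  case (Cons x xs)
  then obtain m where n: "n = Suc m" "x \<in> S" "xs \<in> tuples m S" by (auto elim: tuples_ConsE)
  have "pick_sum (\<lambda>y ys. f y (x # ys)) xs = pick_sum (\<lambda>y ys. g y (x # ys)) xs"
    by (rule Cons.IH[OF n(3)]) (use n Cons.prems(2) in auto)
  then show ?case using Cons.prems(2)[OF n] by simp
qed simp

lemma alt_pick_sum_cong:
  assumes "xs \<in> tuples n S"
    and "\<And>x ys m. n = Suc m \<Longrightarrow> x \<in> S \<Longrightarrow> ys \<in> tuples m S \<Longrightarrow> f x ys = g x ys"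
  shows "alt_pick_sum f xs = alt_pick_sum g xs"
  using assms
proof (induction xs arbitrary: f g n)
  case (Cons x xs)
  then obtain m where n: "n = Suc m" "x \<in> S" "xs \<in> tuples m S" by (auto elim: tuples_ConsE)
  have "alt_pick_sum (\<lambda>y ys. f y (x # ys)) xs = alt_pick_sum (\<lambda>y ys. g y (x # ys)) xs"
    by (rule Cons.IH[OF n(3)]) (use n Cons.prems(2) in auto)
  then show ?case using Cons.prems(2)[OF n] by simp
qed simp

lemma alt_pair_sum_cong:
  assumes "xs \<in> tuples n S"
    and "\<And>x y zs m. n = Suc (Suc m) \<Longrightarrow> x \<in> S \<Longrightarrow> y \<in> S \<Longrightarrow> zs \<in> tuples m S \<Longrightarrow> f x y zs = g x y zs"
  shows "alt_pair_sum f xs = alt_pair_sum g xs"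
  using assms
proof (induction xs arbitrary: f g n)
  case (Cons x xs)
  then obtain m where n: "n = Suc m" "x \<in> S" "xs \<in> tuples m S" by (auto elim: tuples_ConsE)
  have "alt_pair_sum (\<lambda>y z zs. f y z (x # zs)) xs = alt_pair_sum (\<lambda>y z zs. g y z (x # zs)) xs"
    by (rule Cons.IH[OF n(3)]) (use n Cons.prems(2) in auto)
  moreover have "alt_pick_sum (f x) xs = alt_pick_sum (g x) xs"
    by (rule alt_pick_sum_cong[OF n(3)]) (use n Cons.prems(2) in auto)
  ultimately show ?case by simp
qed simp

lemma deriv_sum_cong:
  assumes "xs \<in> tuples n S" "\<And>x. x \<in> S \<Longrightarrow> T x \<in> S"
    and "\<And>x. x \<in> S \<Longrightarrow> T x = T' x"
    and "\<And>ys. ys \<in> tuples n S \<Longrightarrow> F ys = G ys"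
  shows "deriv_sum T F xs = deriv_sum T' G xs"
  using assms(1,4)
proof (induction xs arbitrary: F G n)
  case (Cons x xs)
  then obtain m where n: "n = Suc m" "x \<in> S" "xs \<in> tuples m S" by (auto elim: tuples_ConsE)
  have "deriv_sum T (\<lambda>ys. F (x # ys)) xs = deriv_sum T' (\<lambda>ys. G (x # ys)) xs"
    by (rule Cons.IH[OF n(3)]) (use n Cons.prems(2) in auto)
  then show ?case
    using Cons.prems(2)[of "T x # xs"] n assms(2)[OF n(2)] assms(3)[OF n(2)] by simp
qed simp

text \<open>Evaluation at a point is additive, so the transfer rules for \<open>hom_on\<close> also
  show that the list sums are computed pointwise.\<close>

lemma hom_on_apply: "hom_on UNIV (\<lambda>f. f x)"
  by (simp add: hom_on_def)

lemma tuples_UNIV: "xs \<in> tuples (length xs) UNIV"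
  by (simp add: tuples_def)

lemma pick_sum_apply: "pick_sum f xs x = pick_sum (\<lambda>y ys. f y ys x) xs"
  by (rule hom_on_pick_sum(2)[OF hom_on_apply tuples_UNIV]) auto

lemma alt_pick_sum_apply: "alt_pick_sum f xs x = alt_pick_sum (\<lambda>y ys. f y ys x) xs"
  by (rule hom_on_alt_pick_sum(2)[OF hom_on_apply tuples_UNIV]) auto

lemma alt_pair_sum_apply: "alt_pair_sum f xs x = alt_pair_sum (\<lambda>y z zs. f y z zs x) xs"
  by (rule hom_on_alt_pair_sum(2)[OF hom_on_apply tuples_UNIV]) auto

lemma deriv_sum_apply: "deriv_sum T F xs x = deriv_sum T (\<lambda>ys. F ys x) xs"
  by (rule hom_on_deriv_sum(2)[OF hom_on_apply tuples_UNIV]) auto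

section \<open>Linearity and interchange of the list sums\<close>

lemma pick_sum_0 [simp]: "pick_sum (\<lambda>x ys. 0) xs = 0"
  by (induction xs) auto

lemma alt_pick_sum_0 [simp]: "alt_pick_sum (\<lambda>x ys. 0) xs = 0"
  by (induction xs) auto

lemma alt_pair_sum_0 [simp]: "alt_pair_sum (\<lambda>x y ys. 0) xs = 0"
  by (induction xs) auto

lemma deriv_sum_0 [simp]: "deriv_sum T (\<lambda>ys. 0) xs = 0"
  by (induction xs) auto

lemma pick_sum_diff: "pick_sum (\<lambda>x ys. f x ys - g x ys) xs = pick_sum f xs - pick_sum g xs"
  by (induction xs arbitrary: f g) auto

lemma pick_sum_add: "pick_sum (\<lambda>x ys. f x ys + g x ys) xs = pick_sum f xs + pick_sum g xs"
  by (induction xs arbitrary: f g) auto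

lemma pick_sum_minus: "pick_sum (\<lambda>x ys. - f x ys) xs = - pick_sum f xs"
  using pick_sum_diff[of "\<lambda>_ _. 0" f] by simp

lemma alt_pick_sum_diff:
  "alt_pick_sum (\<lambda>x ys. f x ys - g x ys) xs = alt_pick_sum f xs - alt_pick_sum g xs"
  by (induction xs arbitrary: f g) auto

lemma alt_pick_sum_add:
  "alt_pick_sum (\<lambda>x ys. f x ys + g x ys) xs = alt_pick_sum f xs + alt_pick_sum g xs"
  by (induction xs arbitrary: f g) auto

lemma alt_pick_sum_minus: "alt_pick_sum (\<lambda>x ys. - f x ys) xs = - alt_pick_sum f xs"
  using alt_pick_sum_diff[of "\<lambda>_ _. 0" f] by simp

lemma alt_pair_sum_diff:
  "alt_pair_sum (\<lambda>x y ys. f x y ys - g x y ys) xs = alt_pair_sum f xs - alt_pair_sum g xs"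
  by (induction xs arbitrary: f g) (auto simp: alt_pick_sum_diff)

lemma alt_pair_sum_minus: "alt_pair_sum (\<lambda>x y ys. - f x y ys) xs = - alt_pair_sum f xs"
  using alt_pair_sum_diff[of "\<lambda>_ _ _. 0" f] by simp

lemma deriv_sum_diff: "deriv_sum T (\<lambda>ys. F ys - G ys) xs = deriv_sum T F xs - deriv_sum T G xs"
  by (induction xs arbitrary: F G) auto

lemma deriv_sum_add: "deriv_sum T (\<lambda>ys. F ys + G ys) xs = deriv_sum T F xs + deriv_sum T G xs"
  by (induction xs arbitrary: F G) auto

lemma pick_sum_alt_pick_sum:
  "pick_sum (\<lambda>x ys. alt_pick_sum (f x ys) zs) xs
    = alt_pick_sum (\<lambda>z zs'. pick_sum (\<lambda>x ys. f x ys z zs') xs) zs"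
  by (induction zs arbitrary: f) (auto simp: pick_sum_diff)

lemma pick_sum_alt_pair_sum:
  "pick_sum (\<lambda>x ys. alt_pair_sum (f x ys) zs) xs
    = alt_pair_sum (\<lambda>z w zs'. pick_sum (\<lambda>x ys. f x ys z w zs') xs) zs"
  by (induction zs arbitrary: f) (auto simp: pick_sum_diff pick_sum_alt_pick_sum)

lemma deriv_sum_pick_sum_param:
  "deriv_sum T (\<lambda>ys. pick_sum (\<lambda>z zs'. g z zs' ys) zs) xs
    = pick_sum (\<lambda>z zs'. deriv_sum T (g z zs') xs) zs"
  by (induction zs arbitrary: g) (auto simp: deriv_sum_add)

text \<open>The derivation hits either the picked entry or one of the entries that remain.\<close>

lemma deriv_sum_pick_sum:
  "deriv_sum T (pick_sum g) xs
    = pick_sum (\<lambda>y ys. g (T y) ys) xs + pick_sum (\<lambda>y ys. deriv_sum T (g y) ys) xs"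
proof (induction xs arbitrary: g)
  case (Cons x xs)
  have "deriv_sum T (\<lambda>ys. pick_sum g (x # ys)) xs = deriv_sum T (g x) xs
    + pick_sum (\<lambda>y ys. g (T y) (x # ys)) xs
    + pick_sum (\<lambda>y ys. deriv_sum T (\<lambda>zs. g y (x # zs)) ys) xs"
    using Cons[of "\<lambda>y ys. g y (x # ys)"] by (simp add: deriv_sum_add)
  then show ?case
    by (simp add: pick_sum_add algebra_simps)
qed simp

text \<open>Both sides run over ordered pairs of distinct positions, and the list that remains does
  not depend on which of the two entries is removed first.\<close>

lemma pick_sum_swap:
  "pick_sum (\<lambda>x ys. pick_sum (f x) ys) xs = pick_sum (\<lambda>y ys. pick_sum (\<lambda>x. f x y) ys) xs"
proof (induction xs arbitrary: f)
  case (Cons x xs)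
  show ?case
    using Cons[of "\<lambda>y z zs. f y z (x # zs)"] by (simp add: pick_sum_add algebra_simps)
qed simp

section \<open>Smooth functions, sections and vector fields\<close>

lemma Ck_on_cong:
  assumes "open S" "\<And>x. x \<in> S \<Longrightarrow> f x = g x" "Ck_on k S f"
  shows "Ck_on k S g"
  using assms(2,3)
proof (induction k arbitrary: f g)
  case 0
  then show ?case by (simp cong: continuous_on_cong)
next
  case (Suc k)
  \<comment> \<open>Derivatives are local and \<open>S\<close> is open, so \<open>g\<close> inherits
    the derivative of \<open>f\<close> at each point of \<open>S\<close>.\<close>
  have *: "(g has_derivative frechet_derivative f (at x)) (at x)" if "x \<in> S" for x
  proof -
    have "(f has_derivative frechet_derivative f (at x)) (at x)"
      using Suc.prems(2) that frechet_derivative_works by auto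
    then show ?thesis
      by (rule has_derivative_transform_within_open[OF _ assms(1) that]) (use Suc.prems(1) in auto)
  qed
  have "Ck_on k S (\<lambda>x. frechet_derivative g (at x) v)" for v
    by (rule Suc.IH[where f = "\<lambda>x. frechet_derivative f (at x) v"])
      (use frechet_derivative_at[OF *] Suc.prems(2) in auto)
  then show ?case
    using * by (auto simp: differentiable_def)
qed

lemma Ck_on_subset: "Ck_on k S f \<Longrightarrow> T \<subseteq> S \<Longrightarrow> Ck_on k T f"
  by (induction k arbitrary: f) (auto intro: continuous_on_subset)

lemma Ck_on_SucD: "Ck_on (Suc k) S f \<Longrightarrow> Ck_on k S f"
proof (induction k arbitrary: f)
  case 0
  then show ?case
    by (auto intro!: continuous_at_imp_continuous_on differentiable_imp_continuous_within)
next
  case (Suc k)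
  then show ?case using Ck_on.simps(2) by blast
qed

lemma Ck_on_const: "open S \<Longrightarrow> Ck_on k S (\<lambda>x. c)"
proof (induction k arbitrary: c)
  case (Suc k)
  have "frechet_derivative (\<lambda>x. c) (at x) = (\<lambda>v. 0)" for x :: 'a
    using frechet_derivative_at[OF has_derivative_const] by metis
  then show ?case using Suc by simp
qed simp

lemma Ck_on_add:
  assumes "open S" "Ck_on k S f" "Ck_on k S g"
  shows "Ck_on k S (\<lambda>x. f x + g x)"
  using assms(2,3)
proof (induction k arbitrary: f g)
  case 0
  then show ?case by (auto intro: continuous_intros)
next
  case (Suc k)
  have *: "((\<lambda>x. f x + g x) has_derivative
      (\<lambda>v. frechet_derivative f (at x) v + frechet_derivative g (at x) v)) (at x)" if "x \<in> S" for x
    using Suc.prems that frechet_derivative_works by (auto intro!: has_derivative_add)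
  have "Ck_on k S (\<lambda>x. frechet_derivative (\<lambda>x. f x + g x) (at x) v)" for v
    by (rule Ck_on_cong[OF assms(1) _ Suc.IH]) (use frechet_derivative_at[OF *] Suc.prems in \<open>auto dest: fun_cong\<close>)
  then show ?case
    using * by (auto simp: differentiable_def)
qed

lemma Ck_on_scaleR:
  assumes "open S" "Ck_on k S f" "Ck_on k S g"
  shows "Ck_on k S (\<lambda>x. f x *\<^sub>R g x)"
  using assms(2,3)
proof (induction k arbitrary: f g)
  case 0
  then show ?case by (auto intro: continuous_intros)
next
  case (Suc k)
  have *: "((\<lambda>x. f x *\<^sub>R g x) has_derivative
      (\<lambda>v. f x *\<^sub>R frechet_derivative g (at x) v + frechet_derivative f (at x) v *\<^sub>R g x)) (at x)"
    if "x \<in> S" for x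
    using Suc.prems that by (auto intro!: has_derivative_scaleR simp: frechet_derivative_works[symmetric])
  \<comment> \<open>The product rule leaves one factor undifferentiated, so \<open>f\<close> and
    \<open>g\<close> themselves are needed in class \<open>k\<close> for the induction
    hypothesis.\<close>
  have 1: "Ck_on k S f" "Ck_on k S g" using Suc.prems Ck_on_SucD by blast+
  have "Ck_on k S (\<lambda>x. f x *\<^sub>R frechet_derivative g (at x) v + frechet_derivative f (at x) v *\<^sub>R g x)" for v
    by (rule Ck_on_add[OF assms(1)]; rule Suc.IH) (use 1 Suc.prems in auto)
  then have "Ck_on k S (\<lambda>x. frechet_derivative (\<lambda>x. f x *\<^sub>R g x) (at x) v)" for v
    by (rule Ck_on_cong[OF assms(1), rotated]) (use frechet_derivative_at[OF *] in \<open>auto dest: fun_cong\<close>)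
  then show ?case
    using * by (auto simp: differentiable_def)
qed

section \<open>Smooth functions and sections over a manifold\<close>

context
  fixes M :: "('m::{t2_space,second_countable_topology}, 'e::fin_dim_normed_vector) atlas"
  assumes man: "smooth_manifold M"
begin

text \<open>Charts are homeomorphisms onto open sets. This supplies the open domains on which the
  C^k lemmas apply.\<close>

lemma open_chart_image:
  assumes "(U, \<phi>) \<in> M" "open W"
  shows "open (\<phi> ` (U \<inter> W))"
proof -
  obtain \<psi> where "homeomorphism U (\<phi> ` U) \<phi> \<psi>" and o: "open (\<phi> ` U)"
    using man assms(1) unfolding smooth_manifold_def by fast
  then have "openin (top_of_set (\<phi> ` U)) (\<phi> ` (U \<inter> W))"
    by (intro homeomorphism_imp_open_map) (auto simp: openin_open_Int assms(2))
  then show ?thesis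
    using o openin_open_trans by blast
qed

lemma inv_chart:
  assumes "(U, \<phi>) \<in> M" "y \<in> \<phi> ` (U \<inter> W)"
  shows "inv_into U \<phi> y \<in> U \<inter> W"
proof -
  obtain \<psi> where "homeomorphism U (\<phi> ` U) \<phi> \<psi>"
    using man assms(1) unfolding smooth_manifold_def by fast
  then have "inj_on \<phi> U"
    by (metis homeomorphism_def inj_on_inverseI)
  then show ?thesis using assms(2) by auto
qed

lemma msmooth_on_cong:
  assumes "msmooth_on M W f" "open W" "\<And>x. x \<in> W \<Longrightarrow> f x = g x"
  shows "msmooth_on M W g"
  unfolding msmooth_on_def smooth_on_def
proof clarify
  fix U \<phi> k
  assume U: "(U, \<phi>) \<in> M"
  then have "Ck_on k (\<phi> ` (U \<inter> W)) (f \<circ> inv_into U \<phi>)"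
    using assms(1) by (auto simp: msmooth_on_def smooth_on_def)
  then show "Ck_on k (\<phi> ` (U \<inter> W)) (g \<circ> inv_into U \<phi>)"
    by (rule Ck_on_cong[OF open_chart_image[OF U assms(2)], rotated])
      (use inv_chart[OF U] assms(3) in auto)
qed

lemma msmooth_on_subset: "msmooth_on M W f \<Longrightarrow> W' \<subseteq> W \<Longrightarrow> msmooth_on M W' f"
  unfolding msmooth_on_def smooth_on_def
  by (fastforce elim!: Ck_on_subset)

lemma msmooth_on_const: "open W \<Longrightarrow> msmooth_on M W (\<lambda>x. c)"
  unfolding msmooth_on_def smooth_on_def o_def
  using open_chart_image by (fast intro: Ck_on_const)

lemma msmooth_on_add:
  assumes "open W" "msmooth_on M W f" "msmooth_on M W g"
  shows "msmooth_on M W (\<lambda>x. f x + g x)"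
  using assms open_chart_image unfolding msmooth_on_def smooth_on_def o_def
  by (fast intro: Ck_on_add)

lemma msmooth_on_scaleR:
  assumes "open W" "msmooth_on M W f" "msmooth_on M W g"
  shows "msmooth_on M W (\<lambda>x. f x *\<^sub>R g x)"
  using assms open_chart_image unfolding msmooth_on_def smooth_on_def o_def
  by (fast intro: Ck_on_scaleR)

lemma smooth_funs_const: "(\<lambda>x. c) \<in> smooth_funs M"
  by (simp add: smooth_funs_def msmooth_on_const)

lemma smooth_funs_add: "f \<in> smooth_funs M \<Longrightarrow> g \<in> smooth_funs M \<Longrightarrow> f + g \<in> smooth_funs M"
  unfolding smooth_funs_def plus_fun_def by (auto intro: msmooth_on_add)

lemma smooth_funs_mult: "f \<in> smooth_funs M \<Longrightarrow> g \<in> smooth_funs M \<Longrightarrow> f * g \<in> smooth_funs M"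
  unfolding smooth_funs_def times_fun_def using msmooth_on_scaleR[of UNIV f g] by auto

lemma smooth_funs_cmult: "f \<in> smooth_funs M \<Longrightarrow> (\<lambda>x. r * f x) \<in> smooth_funs M"
  using smooth_funs_mult[OF smooth_funs_const] by (simp add: times_fun_def)

lemma smooth_funs_diff: "f \<in> smooth_funs M \<Longrightarrow> g \<in> smooth_funs M \<Longrightarrow> f - g \<in> smooth_funs M"
  using smooth_funs_add[OF _ smooth_funs_cmult[of g "-1"], of f]
  by (simp add: plus_fun_def fun_diff_def)

context
  fixes E :: "('m, 'v::fin_dim_normed_vector) vbundle"
  assumes bun: "vector_bundle M E"
begin

lemma bundle_chart: "(U, \<tau>) \<in> E \<Longrightarrow> open U" "(U, \<tau>) \<in> E \<Longrightarrow> x \<in> U \<Longrightarrow> linear (\<tau> x)"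
  using bun unfolding vector_bundle_def by fast+

lemma sections_add: "s \<in> sections M E \<Longrightarrow> t \<in> sections M E \<Longrightarrow> s + t \<in> sections M E"
  unfolding sections_def
proof clarify
  fix U \<tau>
  assume "\<forall>(U, \<tau>)\<in>E. msmooth_on M U (\<lambda>x. \<tau> x (s x))" "\<forall>(U, \<tau>)\<in>E. msmooth_on M U (\<lambda>x. \<tau> x (t x))"
    and U: "(U, \<tau>) \<in> E"
  then have "msmooth_on M U (\<lambda>x. \<tau> x (s x) + \<tau> x (t x))"
    using bundle_chart(1) by (intro msmooth_on_add) auto
  then show "msmooth_on M U (\<lambda>x. \<tau> x ((s + t) x))"
    by (rule msmooth_on_cong) (use bundle_chart[OF U] linear_add in \<open>fastforce+\<close>)
qed

lemma sections_smul: "f \<in> smooth_funs M \<Longrightarrow> s \<in> sections M E \<Longrightarrow> smul f s \<in> sections M E"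
  unfolding sections_def
proof clarify
  fix U \<tau>
  assume f: "f \<in> smooth_funs M" and "\<forall>(U, \<tau>)\<in>E. msmooth_on M U (\<lambda>x. \<tau> x (s x))"
    and U: "(U, \<tau>) \<in> E"
  then have "msmooth_on M U (\<lambda>x. f x *\<^sub>R \<tau> x (s x))"
    using bundle_chart(1) f msmooth_on_subset[of UNIV f U] unfolding smooth_funs_def
    by (intro msmooth_on_scaleR) auto
  then show "msmooth_on M U (\<lambda>x. \<tau> x (smul f s x))"
    by (rule msmooth_on_cong) (use bundle_chart[OF U] linear_cmul in \<open>fastforce simp: smul_def\<close>)+
qed

lemma sections_0: "0 \<in> sections M E"
  unfolding sections_def
proof clarify
  fix U \<tau>
  assume U: "(U, \<tau>) \<in> E"
  have "msmooth_on M U (\<lambda>x. 0)"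
    using bundle_chart(1)[OF U] by (rule msmooth_on_const)
  then show "msmooth_on M U (\<lambda>x. \<tau> x (0 x))"
    by (rule msmooth_on_cong) (use bundle_chart[OF U] linear_0 in \<open>fastforce+\<close>)
qed

end

section \<open>Derivations, vector fields and their bracket\<close>

lemma tangent_smooth:
  assumes "v \<in> tangent_space M x" "f \<in> smooth_funs M"
  shows "g \<in> smooth_funs M \<Longrightarrow> v (f + g) = v f + v g"
    "g \<in> smooth_funs M \<Longrightarrow> v (f * g) = f x * v g + g x * v f"
    "v (\<lambda>y. r * f y) = r * v f"
    "g \<in> smooth_funs M \<Longrightarrow> v (f - g) = v f - v g"
    "v (\<lambda>y. c) = 0"
proof -
  have *: "v (f + g) = v f + v g" "v (f * g) = f x * v g + g x * v f" "v (\<lambda>y. r * f y) = r * v f"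
    if "f \<in> smooth_funs M" "g \<in> smooth_funs M" for f g r
    using assms(1) that unfolding tangent_space_def by blast+
  then show "g \<in> smooth_funs M \<Longrightarrow> v (f + g) = v f + v g"
    "g \<in> smooth_funs M \<Longrightarrow> v (f * g) = f x * v g + g x * v f"
    "v (\<lambda>y. r * f y) = r * v f"
    using assms(2) by auto
  show "v (f - g) = v f - v g" if "g \<in> smooth_funs M"
    using *(1)[OF assms(2) smooth_funs_cmult[OF that, of "-1"]] *(3)[OF that that, of "-1"]
    by (simp add: plus_fun_def fun_diff_def)
  \<comment> \<open>The product rule at 1 = 1 * 1 gives v(1) = 2 v(1).\<close>
  have "v (\<lambda>y. 1) = 0"
    using *(2)[OF smooth_funs_const[of 1] smooth_funs_const[of 1]] by (simp add: times_fun_def)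
  then show "v (\<lambda>y. c) = 0"
    using *(3)[OF smooth_funs_const[of 1] smooth_funs_const[of 1], of c] by simp
qed

lemma vfields_smooth:
  assumes "X \<in> vfields M" "f \<in> smooth_funs M"
  shows "(\<lambda>x. X x f) \<in> smooth_funs M"
    "g \<in> smooth_funs M \<Longrightarrow> X x (f + g) = X x f + X x g"
    "g \<in> smooth_funs M \<Longrightarrow> X x (f * g) = f x * X x g + g x * X x f"
    "X x (\<lambda>y. r * f y) = r * X x f"
    "g \<in> smooth_funs M \<Longrightarrow> X x (f - g) = X x f - X x g"
  using assms tangent_smooth[OF _ assms(2)] unfolding vfields_def by blast+

lemma vfields_const [simp]: "X \<in> vfields M \<Longrightarrow> X x (\<lambda>y. c) = 0"
  using tangent_smooth(5)[OF _ smooth_funs_const] unfolding vfields_def by fast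

text \<open>The bracket identities below are equalities of functions on all real functions, smooth
  or not; this settles the non-smooth case.\<close>

lemma vfields_nonsmooth: "X \<in> vfields M \<Longrightarrow> f \<notin> smooth_funs M \<Longrightarrow> X x f = 0"
  unfolding vfields_def tangent_space_def by auto

lemma vfieldsI:
  assumes "\<And>x f g. f \<in> smooth_funs M \<Longrightarrow> g \<in> smooth_funs M \<Longrightarrow> X x (f + g) = X x f + X x g"
    and "\<And>x f g. f \<in> smooth_funs M \<Longrightarrow> g \<in> smooth_funs M \<Longrightarrow> X x (f * g) = f x * X x g + g x * X x f"
    and "\<And>x r f. f \<in> smooth_funs M \<Longrightarrow> X x (\<lambda>y. r * f y) = r * X x f"
    and "\<And>x f. f \<notin> smooth_funs M \<Longrightarrow> X x f = 0"
    and "\<And>f. f \<in> smooth_funs M \<Longrightarrow> (\<lambda>x. X x f) \<in> smooth_funs M"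
  shows "X \<in> vfields M"
  by (simp add: vfields_def tangent_space_def assms)

lemma vfields_add:
  assumes X: "X \<in> vfields M" and Y: "Y \<in> vfields M"
  shows "X + Y \<in> vfields M"
proof (rule vfieldsI)
  fix f assume f: "f \<in> smooth_funs M"
  have "(\<lambda>x. X x f) + (\<lambda>x. Y x f) \<in> smooth_funs M"
    by (rule smooth_funs_add[OF vfields_smooth(1)[OF X f] vfields_smooth(1)[OF Y f]])
  then show "(\<lambda>x. (X + Y) x f) \<in> smooth_funs M" by (simp add: plus_fun_def)
qed (simp_all add: vfields_smooth(2-4)[OF X] vfields_smooth(2-4)[OF Y] vfields_nonsmooth X Y algebra_simps)

lemma vfields_smul:
  assumes X: "X \<in> vfields M" and f: "f \<in> smooth_funs M"
  shows "vf_smul f X \<in> vfields M"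
proof (rule vfieldsI)
  fix g assume g: "g \<in> smooth_funs M"
  have "f * (\<lambda>x. X x g) \<in> smooth_funs M"
    by (rule smooth_funs_mult[OF f vfields_smooth(1)[OF X g]])
  then show "(\<lambda>x. vf_smul f X x g) \<in> smooth_funs M" by (simp add: times_fun_def vf_smul_def)
qed (simp_all add: vfields_smooth(2-4)[OF X] vfields_nonsmooth X vf_smul_def algebra_simps)

lemma vf_bracket_apply:
  assumes "X \<in> vfields M" "Y \<in> vfields M" "f \<in> smooth_funs M"
  shows "(\<lambda>x. vf_bracket X Y x f) = (\<lambda>x. X x (\<lambda>y. Y y f)) - (\<lambda>x. Y x (\<lambda>y. X y f))"
  by (auto simp: vf_bracket_def)

lemma vfields_bracket:
  assumes X: "X \<in> vfields M" and Y: "Y \<in> vfields M"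
  shows "vf_bracket X Y \<in> vfields M"
proof (rule vfieldsI)
  fix x f g assume f: "f \<in> smooth_funs M" and g: "g \<in> smooth_funs M"
  have 1: "(\<lambda>y. Z y (f + g)) = (\<lambda>y. Z y f) + (\<lambda>y. Z y g)" if "Z \<in> vfields M" for Z
    by (rule ext) (simp add: vfields_smooth(2)[OF that f g])
  have "X x (\<lambda>y. Y y (f + g)) = X x (\<lambda>y. Y y f) + X x (\<lambda>y. Y y g)"
    "Y x (\<lambda>y. X y (f + g)) = Y x (\<lambda>y. X y f) + Y x (\<lambda>y. X y g)"
    unfolding 1[OF X] 1[OF Y]
    using vfields_smooth(2)[OF X vfields_smooth(1)[OF Y f] vfields_smooth(1)[OF Y g]]
      vfields_smooth(2)[OF Y vfields_smooth(1)[OF X f] vfields_smooth(1)[OF X g]] by auto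
  then show "vf_bracket X Y x (f + g) = vf_bracket X Y x f + vf_bracket X Y x g"
    by (simp add: vf_bracket_def)
  \<comment> \<open>The mixed terms \<open>W x g * Z x f + W x f * Z x g\<close> of the second
    derivative are symmetric in \<open>Z\<close> and \<open>W\<close>, hence cancel in the
    commutator.\<close>
  have 2: "(\<lambda>y. Z y (f * g)) = f * (\<lambda>y. Z y g) + g * (\<lambda>y. Z y f)" if "Z \<in> vfields M" for Z
    by (rule ext) (simp add: vfields_smooth(3)[OF that f g])
  have 3: "Z x (f * (\<lambda>y. W y g) + g * (\<lambda>y. W y f))
    = f x * Z x (\<lambda>y. W y g) + W x g * Z x f + (g x * Z x (\<lambda>y. W y f) + W x f * Z x g)"
    if Z: "Z \<in> vfields M" and W: "W \<in> vfields M" for Z W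
    using vfields_smooth(2)[OF Z smooth_funs_mult[OF f vfields_smooth(1)[OF W g]]
        smooth_funs_mult[OF g vfields_smooth(1)[OF W f]]]
      vfields_smooth(3)[OF Z f vfields_smooth(1)[OF W g]] vfields_smooth(3)[OF Z g vfields_smooth(1)[OF W f]]
    by simp
  show "vf_bracket X Y x (f * g) = f x * vf_bracket X Y x g + g x * vf_bracket X Y x f"
    unfolding vf_bracket_def 2[OF X] 2[OF Y] 3[OF X Y] 3[OF Y X] by (simp add: algebra_simps)
next
  fix x r f assume f: "f \<in> smooth_funs M"
  have "X x (\<lambda>y. r * Y y f) = r * X x (\<lambda>y. Y y f)" "Y x (\<lambda>y. r * X y f) = r * Y x (\<lambda>y. X y f)"
    using vfields_smooth(4)[OF X vfields_smooth(1)[OF Y f]]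
      vfields_smooth(4)[OF Y vfields_smooth(1)[OF X f]] by auto
  then show "vf_bracket X Y x (\<lambda>y. r * f y) = r * vf_bracket X Y x f"
    by (simp add: vf_bracket_def vfields_smooth(4)[OF X f] vfields_smooth(4)[OF Y f] algebra_simps)
next
  fix x f assume f: "f \<notin> smooth_funs M"
  then show "vf_bracket X Y x f = 0"
    by (simp add: vf_bracket_def X Y vfields_nonsmooth)
next
  fix f assume f: "f \<in> smooth_funs M"
  show "(\<lambda>x. vf_bracket X Y x f) \<in> smooth_funs M"
    unfolding vf_bracket_apply[OF X Y f]
    by (rule smooth_funs_diff[OF vfields_smooth(1)[OF X vfields_smooth(1)[OF Y f]]
        vfields_smooth(1)[OF Y vfields_smooth(1)[OF X f]]])
qed

lemma vf_bracket_add: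
  assumes X: "X \<in> vfields M" and Y: "Y \<in> vfields M" and Z: "Z \<in> vfields M"
  shows "vf_bracket X (Y + Z) = vf_bracket X Y + vf_bracket X Z"
    "vf_bracket (Y + Z) X = vf_bracket Y X + vf_bracket Z X"
proof -
  have *: "X x (\<lambda>y. Y y f + Z y f) = X x (\<lambda>y. Y y f) + X x (\<lambda>y. Z y f)" for x f
  proof (cases "f \<in> smooth_funs M")
    case True
    then show ?thesis
      using vfields_smooth(2)[OF X vfields_smooth(1)[OF Y True] vfields_smooth(1)[OF Z True]]
      by (simp add: plus_fun_def)
  qed (simp add: vfields_nonsmooth X Y Z)
  show "vf_bracket X (Y + Z) = vf_bracket X Y + vf_bracket X Z"
    "vf_bracket (Y + Z) X = vf_bracket Y X + vf_bracket Z X"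
    by (auto simp: vf_bracket_def * intro!: ext)
qed

lemma vf_bracket_smul:
  assumes X: "X \<in> vfields M" and Y: "Y \<in> vfields M" and f: "f \<in> smooth_funs M"
  shows "vf_bracket X (vf_smul f Y) = vf_smul f (vf_bracket X Y) + vf_smul (\<lambda>x. X x f) Y"
    "vf_bracket (vf_smul f Y) X = vf_smul f (vf_bracket Y X) - vf_smul (\<lambda>x. X x f) Y"
proof -
  have *: "X x (\<lambda>y. f y * Y y g) = f x * X x (\<lambda>y. Y y g) + Y x g * X x f" for x g
  proof (cases "g \<in> smooth_funs M")
    case True
    then show ?thesis
      using vfields_smooth(3)[OF X f vfields_smooth(1)[OF Y True]] by (simp add: times_fun_def)
  qed (simp add: vfields_nonsmooth X Y)
  show "vf_bracket X (vf_smul f Y) = vf_smul f (vf_bracket X Y) + vf_smul (\<lambda>x. X x f) Y"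
    "vf_bracket (vf_smul f Y) X = vf_smul f (vf_bracket Y X) - vf_smul (\<lambda>x. X x f) Y"
    by (auto simp: vf_bracket_def vf_smul_def * algebra_simps intro!: ext)
qed

text \<open>Jacobi's identity as the commutator rule for bracketing with \<open>X\<close> and with
  \<open>Y\<close>, the shape used in \<open>lie_vf_commutator\<close>.\<close>

lemma vf_bracket_jacobi:
  assumes X: "X \<in> vfields M" and Y: "Y \<in> vfields M" and Z: "Z \<in> vfields M"
  shows "vf_bracket X (vf_bracket Y Z) - vf_bracket Y (vf_bracket X Z) = vf_bracket (vf_bracket X Y) Z"
proof -
  have *: "X x (\<lambda>y. Y y (\<lambda>z. Z z f) - Z y (\<lambda>z. Y z f)) =
      X x (\<lambda>y. Y y (\<lambda>z. Z z f)) - X x (\<lambda>y. Z y (\<lambda>z. Y z f))"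
    if X: "X \<in> vfields M" and Y: "Y \<in> vfields M" and Z: "Z \<in> vfields M" for X Y Z x f
  proof (cases "f \<in> smooth_funs M")
    case True
    then show ?thesis
      using vfields_smooth(5)[OF X, of "\<lambda>y. Y y (\<lambda>z. Z z f)" "\<lambda>y. Z y (\<lambda>z. Y z f)"]
      by (simp add: fun_diff_def vfields_smooth(1)[OF Y vfields_smooth(1)[OF Z True]]
          vfields_smooth(1)[OF Z vfields_smooth(1)[OF Y True]])
  qed (simp add: vfields_nonsmooth X Y Z)
  show ?thesis
    by (auto simp: vf_bracket_def * X Y Z intro!: ext)
qed

end

text \<open>The linearity axioms speak of sums and of multiplication by functions. Negation is
  recovered as multiplication by the constant function -1.\<close>

lemma vf_smul_minus_1: "vf_smul (\<lambda>x. -1) X = - X"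
  by (intro ext) (simp add: vf_smul_def)

lemma vf_bracket_self [simp]: "vf_bracket X X = 0"
  by (auto simp: vf_bracket_def intro!: ext)

section \<open>Forms with values in a bundle with connection\<close>

definition lie_vf ::
  "('m vfield \<Rightarrow> ('m \<Rightarrow> 'v::real_vector) \<Rightarrow> 'm \<Rightarrow> 'v) \<Rightarrow> 'm vfield \<Rightarrow> ('m, 'v) vform \<Rightarrow> ('m, 'v) vform" where
  "lie_vf D X \<omega> Xs = D X (\<omega> Xs) - deriv_sum (vf_bracket X) \<omega> Xs"

text \<open>The exterior derivative, by recursion on the arguments through Cartan's formula
  \<open>\<iota>\<^sub>X d = L\<^sub>X - d \<iota>\<^sub>X\<close>; on alternating forms it agrees with the Koszul formula.\<close>

primrec rec_d ::
  "('m vfield \<Rightarrow> ('m \<Rightarrow> 'v::real_vector) \<Rightarrow> 'm \<Rightarrow> 'v) \<Rightarrow> 'm vfield list \<Rightarrow> ('m, 'v) vform \<Rightarrow> 'm \<Rightarrow> 'v" where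
  "rec_d D [] \<omega> = 0"
| "rec_d D (X # Xs) \<omega> = lie_vf D X \<omega> Xs - rec_d D Xs (\<lambda>Zs. \<omega> (X # Zs))"

lemma ext_d_alt: "ext_d D \<omega> Xs = alt_pick_sum (\<lambda>X Ys. D X (\<omega> Ys)) Xs
    + alt_pair_sum (\<lambda>X Y Zs. \<omega> (vf_bracket X Y # Zs)) Xs"
  unfolding ext_d_def
  by (rule ext) (simp add: alt_sum_omit[of "\<lambda>X Ys. D X (\<omega> Ys)"]
      alt_sum_omit_pair[of "\<lambda>X Y Zs. \<omega> (vf_bracket X Y # Zs)"])

lemma ext_d_Nil [simp]: "ext_d D \<omega> [] = 0"
  by (simp add: ext_d_alt)

lemma wedge_d_Nil [simp]: "wedge_d f \<omega> [] = 0"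
  by (auto simp: wedge_d_def)

lemma wedge_d_alt: "wedge_d f \<omega> Xs = alt_pick_sum (\<lambda>X Ys. smul (\<lambda>x. X x f) (\<omega> Ys)) Xs"
  unfolding wedge_d_def
  using alt_sum_omit[of "\<lambda>X Ys. smul (\<lambda>x. X x f) (\<omega> Ys)" Xs] by (intro ext) (simp add: smul_def)

lemma wedge_d_Cons [simp]:
  "wedge_d f \<omega> (X # Xs) = smul (\<lambda>x. X x f) (\<omega> Xs) - wedge_d f (\<lambda>Ys. \<omega> (X # Ys)) Xs"
  by (simp add: wedge_d_alt)

lemma smul_simps:
  "smul f (s + t) = smul f s + smul f t" "smul f (s - t) = smul f s - smul f t"
  "smul f (- s) = - smul f s" "smul f 0 = 0"
  "smul (f + g) s = smul f s + smul g s" "smul (f - g) s = smul f s - smul g s"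
  by (auto simp: smul_def scaleR_right_distrib scaleR_right_diff_distrib scaleR_left_distrib
      scaleR_left_diff_distrib)

lemma smul_commute: "smul f (smul g s) = smul g (smul f s)"
  by (auto simp: smul_def)

lemma smul_minus_1: "smul (\<lambda>x. -1) s = - s"
  by (auto simp: smul_def)

lemma deriv_sum_smul: "deriv_sum T (\<lambda>ys. smul f (F ys)) xs = smul f (deriv_sum T F xs)"
  by (induction xs arbitrary: F) (auto simp: smul_simps)

lemma wedge_d_hom:
  "wedge_d f (\<lambda>Zs. \<omega> Zs - \<eta> Zs) Xs = wedge_d f \<omega> Xs - wedge_d f \<eta> Xs"
  "wedge_d f (\<lambda>Zs. - \<omega> Zs) Xs = - wedge_d f \<omega> Xs"
  "wedge_d f (\<lambda>Zs. smul g (\<omega> Zs)) Xs = smul g (wedge_d f \<omega> Xs)"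
  by (induction Xs arbitrary: \<omega> \<eta>) (auto simp: smul_simps smul_commute)

lemma wedge_d_cong:
  assumes "Xs \<in> tuples (Suc n) S" "\<And>Zs. Zs \<in> tuples n S \<Longrightarrow> \<omega> Zs = \<eta> Zs"
  shows "wedge_d f \<omega> Xs = wedge_d f \<eta> Xs"
  unfolding wedge_d_alt by (rule alt_pick_sum_cong[OF assms(1)]) (use assms(2) in auto)

text \<open>Sections are functions, so an eta-expanded goal would let these rules unfold the operations
  on sections pointwise.\<close>

declare plus_fun_apply [simp del] zero_fun_apply [simp del] minus_apply [simp del]
  uminus_apply [simp del]

section \<open>Bundle-valued forms, described slot by slot\<close>

locale connection_on_bundle =
  fixes M :: "('m::{t2_space,second_countable_topology}, 'e::fin_dim_normed_vector) atlas"
    and V :: "('m, 'v::fin_dim_normed_vector) vbundle"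
    and D :: "'m vfield \<Rightarrow> ('m \<Rightarrow> 'v) \<Rightarrow> 'm \<Rightarrow> 'v"
  assumes man: "smooth_manifold M"
    and vbun: "vector_bundle M V"
    and conn: "linear_connection M V D"
begin

abbreviation CF where "CF \<equiv> smooth_funs M"
abbreviation VF where "VF \<equiv> vfields M"
abbreviation SV where "SV \<equiv> sections M V"

lemmas VF_add = vfields_add[OF man]
  and VF_smul = vfields_smul[OF man]
  and VF_bracket = vfields_bracket[OF man]
  and bracket_add = vf_bracket_add[OF man]
  and bracket_smul = vf_bracket_smul[OF man]
  and bracket_jacobi = vf_bracket_jacobi[OF man]
  and SV_add = sections_add[OF man vbun]
  and SV_smul = sections_smul[OF man vbun]
  and SV_0 = sections_0[OF man vbun]

lemma VF_minus: "X \<in> VF \<Longrightarrow> - X \<in> VF"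
  using VF_smul[OF _ smooth_funs_const[OF man, of "-1"]] by (simp add: vf_smul_minus_1)

lemma SV_minus: "s \<in> SV \<Longrightarrow> - s \<in> SV"
  using SV_smul[OF smooth_funs_const[OF man, of "-1"]] by (simp add: smul_minus_1)

lemma SV_diff: "s \<in> SV \<Longrightarrow> t \<in> SV \<Longrightarrow> s - t \<in> SV"
  using SV_add[of s "- t"] SV_minus by simp

lemma D_SV: "X \<in> VF \<Longrightarrow> s \<in> SV \<Longrightarrow> D X s \<in> SV"
  and D_add_left: "X \<in> VF \<Longrightarrow> Y \<in> VF \<Longrightarrow> s \<in> SV \<Longrightarrow> D (X + Y) s = D X s + D Y s"
  and D_smul_left: "f \<in> CF \<Longrightarrow> X \<in> VF \<Longrightarrow> s \<in> SV \<Longrightarrow> D (vf_smul f X) s = smul f (D X s)"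
  and D_add: "X \<in> VF \<Longrightarrow> s \<in> SV \<Longrightarrow> t \<in> SV \<Longrightarrow> D X (s + t) = D X s + D X t"
  and D_smul: "f \<in> CF \<Longrightarrow> X \<in> VF \<Longrightarrow> s \<in> SV \<Longrightarrow>
    D X (smul f s) = smul f (D X s) + smul (\<lambda>x. X x f) s"
  using conn unfolding linear_connection_def by blast+

lemma D_minus: "X \<in> VF \<Longrightarrow> s \<in> SV \<Longrightarrow> D X (- s) = - D X s"
  using D_smul[OF smooth_funs_const[OF man, of "-1"], of X s]
  by (simp add: smul_minus_1 vfields_const[OF man]) (simp add: smul_def zero_fun_def)

lemma hom_on_D: "X \<in> VF \<Longrightarrow> hom_on SV (D X)"
  unfolding hom_on_def using SV_0 SV_diff D_add[of X _ "- _"] D_minus SV_minus by auto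

text \<open>Alternating multilinear maps by recursion on the degree: linearity is demanded in the
  first slot and vanishing when the first two slots agree, and the contractions take care of the
  rest. Contraction thus lowers the degree by definition, as the inductions on \<open>lie_vf\<close>
  and \<open>rec_d\<close> require; \<open>form_iff\<close> recovers the usual notion.\<close>

primrec form :: "nat \<Rightarrow> ('m, 'v) vform \<Rightarrow> bool" where
  "form 0 \<omega> \<longleftrightarrow> \<omega> [] \<in> SV"
| "form (Suc n) \<omega> \<longleftrightarrow> (\<forall>X\<in>VF. form n (\<lambda>Xs. \<omega> (X # Xs))) \<and>
    (\<forall>X\<in>VF. \<forall>Y\<in>VF. \<forall>Xs\<in>tuples n VF. \<omega> ((X + Y) # Xs) = \<omega> (X # Xs) + \<omega> (Y # Xs)) \<and>
    (\<forall>f\<in>CF. \<forall>X\<in>VF. \<forall>Xs\<in>tuples n VF. \<omega> (vf_smul f X # Xs) = smul f (\<omega> (X # Xs))) \<and>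
    (\<forall>X Xs. X # Xs \<in> tuples n VF \<longrightarrow> \<omega> (X # X # Xs) = 0)"

lemma form_cong:
  "form n \<omega> \<Longrightarrow> (\<And>Xs. Xs \<in> tuples n VF \<Longrightarrow> \<omega> Xs = \<eta> Xs) \<Longrightarrow> form n \<eta>"
proof (induction n arbitrary: \<omega> \<eta>)
  case (Suc n)
  have eq: "\<eta> (X # Xs) = \<omega> (X # Xs)" if "X \<in> VF" "Xs \<in> tuples n VF" for X Xs
    using Suc.prems(2)[of "X # Xs"] that by simp
  have "form n (\<lambda>Xs. \<eta> (X # Xs))" if "X \<in> VF" for X
    by (rule Suc.IH[of "\<lambda>Xs. \<omega> (X # Xs)"]) (use Suc.prems(1) eq that in auto)
  moreover have "\<eta> (X # X # Xs) = 0" if "X # Xs \<in> tuples n VF" for X Xs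
    using eq[of X "X # Xs"] that Suc.prems(1) by (cases n) auto
  ultimately show ?case
    using Suc.prems(1) by (simp add: eq VF_add VF_smul)
qed simp

lemma form_value: "form n \<omega> \<Longrightarrow> Xs \<in> tuples n VF \<Longrightarrow> \<omega> Xs \<in> SV"
proof (induction n arbitrary: \<omega> Xs)
  case (Suc n)
  from Suc.prems(2) obtain Y Ys where "Xs = Y # Ys" "Y \<in> VF" "Ys \<in> tuples n VF"
    by (rule tuples_SucE)
  then show ?case using Suc.IH[of "\<lambda>Xs. \<omega> (Y # Xs)" Ys] Suc.prems(1) by simp
qed simp

lemma form_diff: "form n \<omega> \<Longrightarrow> form n \<eta> \<Longrightarrow> form n (\<lambda>Xs. \<omega> Xs - \<eta> Xs)"
proof (induction n arbitrary: \<omega> \<eta>)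
  case 0 then show ?case by (simp add: SV_diff)
next
  case (Suc n)
  then show ?case by (simp add: smul_simps)
qed

lemma form_0: "form n (\<lambda>Xs. 0)"
  by (induction n) (auto simp: SV_0 smul_simps)

lemma form_smul: "f \<in> CF \<Longrightarrow> form n \<omega> \<Longrightarrow> form n (\<lambda>Xs. smul f (\<omega> Xs))"
proof (induction n arbitrary: \<omega>)
  case 0 then show ?case by (simp add: SV_smul)
next
  case (Suc n)
  then show ?case by (simp add: smul_simps smul_commute[of f])
qed

lemma form_minus: "form n \<omega> \<Longrightarrow> form n (\<lambda>Xs. - \<omega> Xs)"
  using form_diff[OF form_0, of n \<omega>] by simp

text \<open>Polarization: after expanding the vanishing value on the repeated field
  \<open>X + Y\<close>, only the two mixed terms are left.\<close>

lemma form_swap: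
  assumes "form (Suc (Suc n)) \<omega>" "X \<in> VF" "Y \<in> VF" "Xs \<in> tuples n VF"
  shows "\<omega> (Y # X # Xs) = - \<omega> (X # Y # Xs)"
proof -
  have "\<omega> ((X + Y) # (X + Y) # Xs) = 0" "\<omega> (X # X # Xs) = 0" "\<omega> (Y # Y # Xs) = 0"
    using assms VF_add by simp_all
  moreover have "\<omega> ((X + Y) # Z # Xs) = \<omega> (X # Z # Xs) + \<omega> (Y # Z # Xs)"
    "\<omega> (Z # (X + Y) # Xs) = \<omega> (Z # X # Xs) + \<omega> (Z # Y # Xs)" if "Z \<in> VF" for Z
    using assms that by simp_all
  ultimately show ?thesis using assms(2,3) VF_add by (simp add: eq_neg_iff_add_eq_0 add.commute)
qed

lemma form_add_slot:
  assumes "form (Suc n) \<omega>" "X \<in> VF" "Y \<in> VF" "Xs \<in> tuples n VF"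
  shows "\<omega> ((X + Y) # Xs) = \<omega> (X # Xs) + \<omega> (Y # Xs)"
  using assms by simp

lemma form_smul_slot:
  assumes "form (Suc n) \<omega>" "f \<in> CF" "X \<in> VF" "Xs \<in> tuples n VF"
  shows "\<omega> (vf_smul f X # Xs) = smul f (\<omega> (X # Xs))"
  using assms by simp

lemma form_minus_slot:
  assumes "form (Suc n) \<omega>" "X \<in> VF" "Xs \<in> tuples n VF"
  shows "\<omega> ((- X) # Xs) = - \<omega> (X # Xs)"
proof -
  show ?thesis
    using form_smul_slot[OF assms(1) smooth_funs_const[OF man, of "-1"] assms(2,3)]
    unfolding vf_smul_minus_1 smul_minus_1 .
qed

lemma form_contract: "form (Suc n) \<omega> \<Longrightarrow> X \<in> VF \<Longrightarrow> form n (\<lambda>Xs. \<omega> (X # Xs))"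
  by simp

text \<open>The bridge to \<open>sforms\<close>, whose conditions quantify over all positions at
  once.\<close>

lemma form_iff:
  "form n \<omega> \<longleftrightarrow> (\<forall>Xs\<in>tuples n VF. \<omega> Xs \<in> SV) \<and> multilinear CF vf_smul VF n \<omega> \<and> alternating VF n \<omega>"
proof (induction n arbitrary: \<omega>)
  case 0
  then show ?case by (auto simp: multilinear_def alternating_def)
next
  case (Suc n)
  let ?c = "\<lambda>X Xs. \<omega> (X # Xs)"
  show ?case
  proof
    assume F: "form (Suc n) \<omega>"
    have c: "\<forall>Xs\<in>tuples n VF. ?c X Xs \<in> SV" "multilinear CF vf_smul VF n (?c X)"
      "alternating VF n (?c X)" if "X \<in> VF" for X
      using form_contract[OF F that] Suc.IH[of "?c X"] by auto
    have "multilinear CF vf_smul VF (Suc n) \<omega>"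
      unfolding multilinear_def
    proof (intro conjI ballI allI impI)
      fix Xs i y z assume Xs: "Xs \<in> tuples (Suc n) VF" and i: "i < Suc n" and y: "y \<in> VF" and z: "z \<in> VF"
      from Xs obtain Y Ys where Y: "Xs = Y # Ys" "Y \<in> VF" "Ys \<in> tuples n VF" by (rule tuples_SucE)
      show "\<omega> (Xs[i := y + z]) = \<omega> (Xs[i := y]) + \<omega> (Xs[i := z])"
        using form_add_slot[OF F y z Y(3)] c(2)[OF Y(2)] Y i y z
        by (cases i) (auto simp: multilinear_def)
    next
      fix Xs i y f assume Xs: "Xs \<in> tuples (Suc n) VF" and i: "i < Suc n" and y: "y \<in> VF" and f: "f \<in> CF"
      from Xs obtain Y Ys where Y: "Xs = Y # Ys" "Y \<in> VF" "Ys \<in> tuples n VF" by (rule tuples_SucE)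
      show "\<omega> (Xs[i := vf_smul f y]) = smul f (\<omega> (Xs[i := y]))"
        using form_smul_slot[OF F f y Y(3)] c(2)[OF Y(2)] Y i y f
        by (cases i) (auto simp: multilinear_def)
    qed
    moreover have "alternating VF (Suc n) \<omega>"
    proof -
      \<comment> \<open>When the first entry recurs further inside, swapping the first two slots
        moves both occurrences into a contracted form, where alternation is already known.\<close>
      have 0: "\<omega> (Y # Ys) = 0" if "Y \<in> VF" "Ys \<in> tuples n VF" "j < n" "Ys ! j = Y" for Y Ys j
      proof (cases j)
        case 0
        then show ?thesis using F that by (cases Ys) auto
      next
        case (Suc j')
        then obtain m where m: "n = Suc m" using \<open>j < n\<close> by (cases n) auto
        obtain Z Zs where Z: "Ys = Z # Zs" "Z \<in> VF" "Zs \<in> tuples m VF"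
          using \<open>Ys \<in> tuples n VF\<close> m by (auto elim: tuples_SucE)
        have "\<omega> (Y # Z # Zs) = - \<omega> (Z # Y # Zs)"
          by (rule form_swap[OF F[unfolded m] Z(2) \<open>Y \<in> VF\<close> Z(3)])
        also have "\<omega> (Z # Y # Zs) = 0"
          using c(3)[OF Z(2)] m that Z Suc unfolding alternating_def
          by (elim ballE[of _ _ "Y # Zs"] allE[of _ 0] allE[of _ j]) auto
        finally show ?thesis using Z by simp
      qed
      show ?thesis
        unfolding alternating_def
      proof (intro ballI allI impI)
        fix Xs i j assume Xs: "Xs \<in> tuples (Suc n) VF" and ij: "i < Suc n" "j < Suc n" "i \<noteq> j" "Xs ! i = Xs ! j"
        from Xs obtain Y Ys where Y: "Xs = Y # Ys" "Y \<in> VF" "Ys \<in> tuples n VF" by (rule tuples_SucE)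
        show "\<omega> Xs = 0"
          using 0[OF Y(2,3), of "i - 1"] 0[OF Y(2,3), of "j - 1"] c(3)[OF Y(2)] ij Y
          by (cases i; cases j) (auto simp: alternating_def)
      qed
    qed
    ultimately show "(\<forall>Xs\<in>tuples (Suc n) VF. \<omega> Xs \<in> SV) \<and> multilinear CF vf_smul VF (Suc n) \<omega> \<and>
      alternating VF (Suc n) \<omega>"
      using form_value[OF F] by blast
  next
    assume R: "(\<forall>Xs\<in>tuples (Suc n) VF. \<omega> Xs \<in> SV) \<and> multilinear CF vf_smul VF (Suc n) \<omega> \<and>
      alternating VF (Suc n) \<omega>"
    have m1: "\<omega> (Xs[i := y + z]) = \<omega> (Xs[i := y]) + \<omega> (Xs[i := z])"
      if "Xs \<in> tuples (Suc n) VF" "i < Suc n" "y \<in> VF" "z \<in> VF" for Xs i y z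
      using R that unfolding multilinear_def by blast
    have m2: "\<omega> (Xs[i := vf_smul f y]) = smul f (\<omega> (Xs[i := y]))"
      if "Xs \<in> tuples (Suc n) VF" "i < Suc n" "y \<in> VF" "f \<in> CF" for Xs i y f
      using R that unfolding multilinear_def by blast
    have a: "\<omega> Xs = 0"
      if "Xs \<in> tuples (Suc n) VF" "i < Suc n" "j < Suc n" "i \<noteq> j" "Xs ! i = Xs ! j" for Xs i j
      using R that unfolding alternating_def by blast
    have "form n (?c X)" if X: "X \<in> VF" for X
    proof -
      have "multilinear CF vf_smul VF n (?c X)"
        using m1[of "X # _" "Suc _"] m2[of "X # _" "Suc _"] X unfolding multilinear_def by simp
      moreover have "alternating VF n (?c X)"
        using a[of "X # _" "Suc _" "Suc _"] X unfolding alternating_def by simp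
      ultimately show ?thesis
        using R X by (simp add: Suc.IH)
    qed
    then show "form (Suc n) \<omega>"
      using m1[of "_ # _" 0] m2[of "_ # _" 0] a[of "_ # _ # _" 0 1] by (auto elim!: tuples_ConsE)
  qed
qed

text \<open>This is the commutation rule [L_X, i_Y] = i_[X,Y]; every induction on the degree below
  runs through it.\<close>

lemma lie_vf_Cons:
  "lie_vf D X \<omega> (Y # Ys) = lie_vf D X (\<lambda>Zs. \<omega> (Y # Zs)) Ys - \<omega> (vf_bracket X Y # Ys)"
  by (simp add: lie_vf_def)

lemma lie_vf_Nil: "lie_vf D X \<omega> [] = D X (\<omega> [])"
  by (simp add: lie_vf_def)

lemma lie_vf_cong:
  assumes "X \<in> VF" "Xs \<in> tuples n VF" "\<And>Zs. Zs \<in> tuples n VF \<Longrightarrow> \<omega> Zs = \<eta> Zs"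
  shows "lie_vf D X \<omega> Xs = lie_vf D X \<eta> Xs"
  unfolding lie_vf_def
  using deriv_sum_cong[of Xs n VF "vf_bracket X" "vf_bracket X" \<omega> \<eta>] assms VF_bracket by simp

lemma lie_vf_diff:
  assumes "X \<in> VF" "Xs \<in> tuples n VF" "form n \<omega>" "form n \<eta>"
  shows "lie_vf D X (\<lambda>Zs. \<omega> Zs - \<eta> Zs) Xs = lie_vf D X \<omega> Xs - lie_vf D X \<eta> Xs"
  using hom_on_diff(2)[OF hom_on_D] form_value assms by (simp add: lie_vf_def deriv_sum_diff)

lemma lie_vf_0: "X \<in> VF \<Longrightarrow> lie_vf D X (\<lambda>Zs. 0) Xs = 0"
  using hom_on_0[OF hom_on_D] by (simp add: lie_vf_def)

lemma lie_vf_add_slot: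
  assumes "X \<in> VF" "Y \<in> VF" "Xs \<in> tuples n VF" "form n \<omega>"
  shows "lie_vf D (X + Y) \<omega> Xs = lie_vf D X \<omega> Xs + lie_vf D Y \<omega> Xs"
  using assms(3,4)
proof (induction n arbitrary: \<omega> Xs)
  case 0 then show ?case by (simp add: lie_vf_Nil D_add_left assms)
next
  case (Suc n)
  from Suc.prems(1) obtain Z Zs where Z: "Xs = Z # Zs" "Z \<in> VF" "Zs \<in> tuples n VF" by (rule tuples_SucE)
  have "\<omega> (vf_bracket (X + Y) Z # Zs) = \<omega> (vf_bracket X Z # Zs) + \<omega> (vf_bracket Y Z # Zs)"
    using Suc.prems(2) Z assms(1,2) by (simp add: bracket_add VF_bracket)
  then show ?case
    using Suc.IH[OF Z(3) form_contract[OF Suc.prems(2) Z(2)]] by (simp add: lie_vf_Cons Z(1))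
qed

text \<open>The correction term is df wedge i_X of the form. It comes from the slot brackets,
  because [f X, Y] = f [X, Y] - (Y f) X.\<close>

lemma lie_vf_smul_slot:
  assumes "f \<in> CF" "X \<in> VF" "Xs \<in> tuples n VF" "form n \<omega>"
  shows "lie_vf D (vf_smul f X) \<omega> Xs
    = smul f (lie_vf D X \<omega> Xs) + wedge_d f (\<lambda>Zs. \<omega> (X # Zs)) Xs"
  using assms(3,4)
proof (induction n arbitrary: \<omega> Xs)
  case 0 then show ?case by (simp add: lie_vf_Nil D_smul_left assms)
next
  case (Suc n)
  from Suc.prems(1) obtain Y Ys where Y: "Xs = Y # Ys" "Y \<in> VF" "Ys \<in> tuples n VF" by (rule tuples_SucE)
  have Yf: "(\<lambda>x. Y x f) \<in> CF" using vfields_smooth(1)[OF man Y(2) assms(1)] .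
  have "\<omega> (vf_bracket (vf_smul f X) Y # Ys)
      = smul f (\<omega> (vf_bracket X Y # Ys)) - smul (\<lambda>x. Y x f) (\<omega> (X # Ys))"
    using form_add_slot[OF Suc.prems(2), of "vf_smul f (vf_bracket X Y)" "- vf_smul (\<lambda>x. Y x f) X" Ys]
      form_smul_slot[OF Suc.prems(2) assms(1) _ Y(3), of "vf_bracket X Y"]
      form_smul_slot[OF Suc.prems(2) Yf assms(2) Y(3)]
      form_minus_slot[OF Suc.prems(2) VF_smul[OF assms(2) Yf] Y(3)]
    by (simp add: bracket_smul VF_bracket VF_smul VF_minus assms Y Yf)
  \<comment> \<open>The induction hypothesis contracts with \<open>Y\<close> before
    \<open>X\<close>, while unfolding the goal contracts with \<open>X\<close> before
    \<open>Y\<close>. The swap accounts for the sign in the recursion of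
    \<open>wedge_d\<close>.\<close>
  moreover have "wedge_d f (\<lambda>Zs. \<omega> (Y # X # Zs)) Ys = - wedge_d f (\<lambda>Zs. \<omega> (X # Y # Zs)) Ys"
  proof (cases n)
    case (Suc m)
    have "wedge_d f (\<lambda>Zs. \<omega> (Y # X # Zs)) Ys = wedge_d f (\<lambda>Zs. - \<omega> (X # Y # Zs)) Ys"
      by (rule wedge_d_cong[of _ m VF])
        (use Suc Suc.prems(2) Y assms(2) in \<open>auto intro!: form_swap simp del: form.simps\<close>)
    then show ?thesis by (simp add: wedge_d_hom)
  qed (use Y in auto)
  ultimately show ?case
    using Suc.IH[OF Y(3) form_contract[OF Suc.prems(2) Y(2)]]
    by (simp add: lie_vf_Cons Y(1) smul_simps)
qed

lemma lie_vf_smul: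
  assumes "f \<in> CF" "X \<in> VF" "Xs \<in> tuples n VF" "form n \<omega>"
  shows "lie_vf D X (\<lambda>Zs. smul f (\<omega> Zs)) Xs
    = smul f (lie_vf D X \<omega> Xs) + smul (\<lambda>x. X x f) (\<omega> Xs)"
  using form_value[OF assms(4,3)] assms(1,2)
  by (simp add: lie_vf_def deriv_sum_smul D_smul smul_simps)

lemma form_0_slot:
  assumes "form (Suc n) \<omega>" "X \<in> VF" "Xs \<in> tuples n VF"
  shows "\<omega> (0 # Xs) = 0"
  using form_add_slot[OF assms(1,2) VF_minus[OF assms(2)] assms(3)] form_minus_slot[OF assms] by simp

text \<open>Each unwanted term has a partner: the (X f) term from differentiating the scalar cancels
  the one from [X, f Y], and on a repeated field \<open>Y\<close> the two bracket terms are opposite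
  by antisymmetry.\<close>

lemma form_lie_vf:
  assumes "X \<in> VF" "form n \<omega>"
  shows "form n (lie_vf D X \<omega>)"
  using assms(2)
proof (induction n arbitrary: \<omega>)
  case 0 then show ?case by (simp add: lie_vf_Nil D_SV assms)
next
  case (Suc n)
  note c = form_contract[OF Suc.prems]
  have 1: "form n (\<lambda>Ys. lie_vf D X \<omega> (Y # Ys))" if "Y \<in> VF" for Y
    unfolding lie_vf_Cons by (intro form_diff Suc.IH c VF_bracket assms that)
  have 2: "lie_vf D X \<omega> ((Y + Z) # Zs) = lie_vf D X \<omega> (Y # Zs) + lie_vf D X \<omega> (Z # Zs)"
    if "Y \<in> VF" "Z \<in> VF" "Zs \<in> tuples n VF" for Y Z Zs
  proof -
    have "lie_vf D X (\<lambda>Zs. \<omega> ((Y + Z) # Zs)) Zs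
      = lie_vf D X (\<lambda>Ws. \<omega> (Y # Ws) - (\<lambda>Ws. - \<omega> (Z # Ws)) Ws) Zs"
      by (rule lie_vf_cong[OF assms(1) that(3)]) (use Suc.prems that in auto)
    also have "\<dots> = lie_vf D X (\<lambda>Ws. \<omega> (Y # Ws)) Zs - lie_vf D X (\<lambda>Ws. - \<omega> (Z # Ws)) Zs"
      by (intro lie_vf_diff[OF assms(1) that(3)] form_minus c that)
    also have "lie_vf D X (\<lambda>Ws. - \<omega> (Z # Ws)) Zs = - lie_vf D X (\<lambda>Ws. \<omega> (Z # Ws)) Zs"
      using lie_vf_diff[OF assms(1) that(3) form_0 c[OF that(2)]] lie_vf_0[OF assms(1), of Zs] by simp
    finally show ?thesis
      using form_add_slot[OF Suc.prems, of "vf_bracket X Y" "vf_bracket X Z" Zs] that assms(1)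
      by (simp add: lie_vf_Cons bracket_add VF_bracket)
  qed
  have 3: "lie_vf D X \<omega> (vf_smul f Y # Zs) = smul f (lie_vf D X \<omega> (Y # Zs))"
    if "f \<in> CF" "Y \<in> VF" "Zs \<in> tuples n VF" for f Y Zs
  proof -
    have Xf: "(\<lambda>x. X x f) \<in> CF" using vfields_smooth(1)[OF man assms(1) that(1)] .
    have "lie_vf D X (\<lambda>Zs. \<omega> (vf_smul f Y # Zs)) Zs = lie_vf D X (\<lambda>Ws. smul f (\<omega> (Y # Ws))) Zs"
      by (rule lie_vf_cong[OF assms(1) that(3)]) (use Suc.prems that in auto)
    moreover have "\<omega> (vf_bracket X (vf_smul f Y) # Zs)
      = smul f (\<omega> (vf_bracket X Y # Zs)) + smul (\<lambda>x. X x f) (\<omega> (Y # Zs))"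
      using form_add_slot[OF Suc.prems, of "vf_smul f (vf_bracket X Y)" "vf_smul (\<lambda>x. X x f) Y" Zs]
        form_smul_slot[OF Suc.prems that(1) _ that(3), of "vf_bracket X Y"]
        form_smul_slot[OF Suc.prems Xf that(2,3)]
      by (simp add: bracket_smul VF_bracket VF_smul assms that Xf)
    ultimately show ?thesis
      by (simp add: lie_vf_Cons lie_vf_smul[OF that(1) assms(1) that(3) c[OF that(2)]] smul_simps)
  qed
  have 4: "lie_vf D X \<omega> (Y # Y # Zs) = 0" if "Y # Zs \<in> tuples n VF" for Y Zs
  proof -
    from that obtain m where m: "n = Suc m" "Y \<in> VF" "Zs \<in> tuples m VF" by (rule tuples_ConsE)
    have "lie_vf D X (\<lambda>Zs. \<omega> (Y # Y # Zs)) Zs = lie_vf D X (\<lambda>Zs. 0) Zs"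
      by (rule lie_vf_cong[OF assms(1) m(3)]) (use Suc.prems m in auto)
    then show ?thesis
      using form_swap[of m \<omega> Y "vf_bracket X Y" Zs] Suc.prems m assms(1)
      by (simp add: lie_vf_Cons lie_vf_0 VF_bracket)
  qed
  show ?case using 1 2 3 4 by simp
qed

section \<open>The recursive exterior derivative\<close>

lemma rec_d_cong:
  assumes "Xs \<in> tuples n VF" "\<And>Zs m. n = Suc m \<Longrightarrow> Zs \<in> tuples m VF \<Longrightarrow> \<omega> Zs = \<eta> Zs"
  shows "rec_d D Xs \<omega> = rec_d D Xs \<eta>"
  using assms
proof (induction n arbitrary: \<omega> \<eta> Xs)
  case (Suc n)
  from Suc.prems(1) obtain Y Ys where Y: "Xs = Y # Ys" "Y \<in> VF" "Ys \<in> tuples n VF" by (rule tuples_SucE)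
  have "rec_d D Ys (\<lambda>Zs. \<omega> (Y # Zs)) = rec_d D Ys (\<lambda>Zs. \<eta> (Y # Zs))"
    by (rule Suc.IH[OF Y(3)]) (use Suc.prems(2) Y in auto)
  then show ?case
    using lie_vf_cong[OF Y(2,3), of \<omega> \<eta>] Suc.prems(2) Y by simp
qed simp

lemma rec_d_diff:
  assumes "Xs \<in> tuples (Suc n) VF" "form n \<omega>" "form n \<eta>"
  shows "rec_d D Xs (\<lambda>Zs. \<omega> Zs - \<eta> Zs) = rec_d D Xs \<omega> - rec_d D Xs \<eta>"
  using assms
proof (induction n arbitrary: \<omega> \<eta> Xs)
  case 0
  then obtain Y where "Xs = [Y]" "Y \<in> VF" by (auto elim: tuples_SucE)
  then show ?case using 0 lie_vf_diff[of Y "[]" 0 \<omega> \<eta>] by simp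
next
  case (Suc n)
  from Suc.prems(1) obtain Y Ys where Y: "Xs = Y # Ys" "Y \<in> VF" "Ys \<in> tuples (Suc n) VF"
    by (rule tuples_SucE)
  have "rec_d D Ys (\<lambda>Zs. \<omega> (Y # Zs) - \<eta> (Y # Zs))
    = rec_d D Ys (\<lambda>Zs. \<omega> (Y # Zs)) - rec_d D Ys (\<lambda>Zs. \<eta> (Y # Zs))"
    by (intro Suc.IH form_contract[OF _ Y(2)] Suc.prems Y)
  then show ?case
    using lie_vf_diff[OF Y(2,3) Suc.prems(2,3)] by (simp add: Y(1))
qed

lemma hom_on_rec_d:
  assumes "Xs \<in> tuples (Suc n) VF"
  shows "hom_on {\<omega>. form n \<omega>} (rec_d D Xs)"
  using form_0[of n] form_diff[of n] rec_d_diff[OF assms]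
  \<comment> \<open>The type instances unfold zero and difference of forms, but not those of the
    sections that are their values.\<close>
  unfolding hom_on_def zero_fun_def[where 'b = "'m \<Rightarrow> 'v"] fun_diff_def[where 'b = "'m \<Rightarrow> 'v"] by blast

lemma rec_d_0: "Xs \<in> tuples n VF \<Longrightarrow> rec_d D Xs (\<lambda>Zs. 0) = 0"
  using hom_on_0(2)[OF hom_on_rec_d, of Xs] by (cases n) (auto simp: zero_fun_def[where 'b = "'m \<Rightarrow> 'v"])

lemma rec_d_minus:
  assumes "Xs \<in> tuples (Suc n) VF" "form n \<omega>"
  shows "rec_d D Xs (\<lambda>Zs. - \<omega> Zs) = - rec_d D Xs \<omega>"
  using rec_d_diff[OF assms(1) form_0 assms(2)] rec_d_0[OF assms(1)] by simp

lemma rec_d_add: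
  assumes "Xs \<in> tuples (Suc n) VF" "form n \<omega>" "form n \<eta>"
  shows "rec_d D Xs (\<lambda>Zs. \<omega> Zs + \<eta> Zs) = rec_d D Xs \<omega> + rec_d D Xs \<eta>"
  using rec_d_diff[OF assms(1,2) form_minus[OF assms(3)]] rec_d_minus[OF assms(1,3)] by simp

lemma rec_d_smul:
  assumes "f \<in> CF" "Xs \<in> tuples (Suc n) VF" "form n \<omega>"
  shows "rec_d D Xs (\<lambda>Zs. smul f (\<omega> Zs)) = smul f (rec_d D Xs \<omega>) + wedge_d f \<omega> Xs"
  using assms(2,3)
proof (induction n arbitrary: \<omega> Xs)
  case 0
  then obtain Y where "Xs = [Y]" "Y \<in> VF" by (auto elim: tuples_SucE)
  then show ?case using 0 lie_vf_smul[OF assms(1), of Y "[]" 0 \<omega>] by simp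
next
  case (Suc n)
  from Suc.prems(1) obtain Y Ys where Y: "Xs = Y # Ys" "Y \<in> VF" "Ys \<in> tuples (Suc n) VF"
    by (rule tuples_SucE)
  have "rec_d D Ys (\<lambda>Zs. smul f (\<omega> (Y # Zs)))
    = smul f (rec_d D Ys (\<lambda>Zs. \<omega> (Y # Zs))) + wedge_d f (\<lambda>Zs. \<omega> (Y # Zs)) Ys"
    by (intro Suc.IH form_contract[OF _ Y(2)] Suc.prems Y)
  then show ?case
    using lie_vf_smul[OF assms(1) Y(2,3) Suc.prems(2)] by (simp add: Y(1) smul_simps)
qed

text \<open>In the first slot, L_(f X) and d(f i_X) both contribute df wedge i_X, and the two
  cancel. On a repeated field the recursion unfolds twice: the two Lie derivatives cancel and what
  remains contains [X, X] or a repeated contraction.\<close>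

lemma form_rec_d: "form n \<omega> \<Longrightarrow> form (Suc n) (\<lambda>Xs. rec_d D Xs \<omega>)"
proof (induction n arbitrary: \<omega>)
  case 0
  have "lie_vf D (X + Y) \<omega> [] = lie_vf D X \<omega> [] + lie_vf D Y \<omega> []" if "X \<in> VF" "Y \<in> VF" for X Y
    using lie_vf_add_slot[OF that _ 0] by simp
  then show ?case
    using 0 by (auto simp: lie_vf_Nil D_SV D_add_left D_smul_left)
next
  case (Suc n)
  note c = form_contract[OF Suc.prems]
  have 1: "form (Suc n) (\<lambda>Xs. rec_d D (X # Xs) \<omega>)" if "X \<in> VF" for X
    unfolding rec_d.simps by (intro form_diff form_lie_vf Suc c that)
  have 2: "rec_d D ((X + Y) # Xs) \<omega> = rec_d D (X # Xs) \<omega> + rec_d D (Y # Xs) \<omega>"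
    if "X \<in> VF" "Y \<in> VF" "Xs \<in> tuples (Suc n) VF" for X Y Xs
  proof -
    have "rec_d D Xs (\<lambda>Zs. \<omega> ((X + Y) # Zs)) = rec_d D Xs (\<lambda>Zs. \<omega> (X # Zs) + \<omega> (Y # Zs))"
      by (rule rec_d_cong[OF that(3)]) (use that Suc.prems in auto)
    then show ?thesis
      using rec_d_add[OF that(3) c[OF that(1)] c[OF that(2)]] lie_vf_add_slot[OF that Suc.prems] by simp
  qed
  have 3: "rec_d D (vf_smul f X # Xs) \<omega> = smul f (rec_d D (X # Xs) \<omega>)"
    if "f \<in> CF" "X \<in> VF" "Xs \<in> tuples (Suc n) VF" for f X Xs
  proof -
    have "rec_d D Xs (\<lambda>Zs. \<omega> (vf_smul f X # Zs)) = rec_d D Xs (\<lambda>Zs. smul f (\<omega> (X # Zs)))"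
      by (rule rec_d_cong[OF that(3)]) (use that Suc.prems in auto)
    then show ?thesis
      using rec_d_smul[OF that(1,3) c[OF that(2)]] lie_vf_smul_slot[OF that Suc.prems]
      by (simp add: smul_simps)
  qed
  have 4: "rec_d D (X # X # Xs) \<omega> = 0" if "X # Xs \<in> tuples (Suc n) VF" for X Xs
  proof -
    have X: "X \<in> VF" "Xs \<in> tuples n VF" using that by auto
    have "rec_d D Xs (\<lambda>Zs. \<omega> (X # X # Zs)) = rec_d D Xs (\<lambda>Zs. 0)"
      by (rule rec_d_cong[OF X(2)]) (use X Suc.prems in auto)
    then show ?thesis
      using form_0_slot[OF Suc.prems X] rec_d_0[OF X(2)] by (simp add: lie_vf_Cons)
  qed
  show ?case
    using 1 2 3 4 unfolding form.simps(2)[of "Suc n"] by blast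
qed

text \<open>Moving \<open>T Y\<close> from the first slot back to the position of \<open>Y\<close>
  costs exactly the sign that position carries in the alternating sum.\<close>

lemma alt_pick_sum_form:
  assumes "Xs \<in> tuples n VF" "form n \<omega>" "\<And>X. X \<in> VF \<Longrightarrow> T X \<in> VF"
  shows "alt_pick_sum (\<lambda>Y Ys. \<omega> (T Y # Ys)) Xs = deriv_sum T \<omega> Xs"
  using assms(1,2)
proof (induction n arbitrary: \<omega> Xs)
  case (Suc n)
  from Suc.prems(1) obtain Y Ys where Y: "Xs = Y # Ys" "Y \<in> VF" "Ys \<in> tuples n VF" by (rule tuples_SucE)
  have "alt_pick_sum (\<lambda>Z Zs. \<omega> (T Z # Y # Zs)) Ys = alt_pick_sum (\<lambda>Z Zs. - \<omega> (Y # T Z # Zs)) Ys"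
    by (rule alt_pick_sum_cong[OF Y(3)])
      (use Suc.prems(2) Y assms(3) in \<open>auto intro!: form_swap simp del: form.simps\<close>)
  then show ?case
    using Suc.IH[OF Y(3) form_contract[OF Suc.prems(2) Y(2)]] by (simp add: Y(1) alt_pick_sum_minus)
qed simp

text \<open>Cartan's formula for the Koszul expression. The pairs containing \<open>X\<close> sum to
  the bracket terms of L_X; in the other pairs \<open>X\<close> has to be moved past the bracket,
  which yields the minus sign.\<close>

lemma ext_d_Cons:
  assumes "X \<in> VF" "Xs \<in> tuples n VF" "form n \<omega>"
  shows "ext_d D \<omega> (X # Xs) = lie_vf D X \<omega> Xs - ext_d D (\<lambda>Zs. \<omega> (X # Zs)) Xs"
proof -
  have "alt_pair_sum (\<lambda>Y Z Zs. \<omega> (vf_bracket Y Z # X # Zs)) Xs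
    = alt_pair_sum (\<lambda>Y Z Zs. - \<omega> (X # vf_bracket Y Z # Zs)) Xs"
    by (rule alt_pair_sum_cong[OF assms(2)])
      (use assms VF_bracket in \<open>auto intro!: form_swap simp del: form.simps\<close>)
  then show ?thesis
    using alt_pick_sum_form[OF assms(2,3), of "vf_bracket X"] VF_bracket[OF assms(1)]
    by (simp add: ext_d_alt lie_vf_def alt_pair_sum_minus)
qed

lemma ext_d_eq_rec_d:
  assumes "Xs \<in> tuples (Suc n) VF" "form n \<omega>"
  shows "ext_d D \<omega> Xs = rec_d D Xs \<omega>"
  using assms
proof (induction n arbitrary: \<omega> Xs)
  case 0
  then obtain Y where "Xs = [Y]" "Y \<in> VF" by (auto elim: tuples_SucE)
  then show ?case using 0 ext_d_Cons[of Y "[]" 0 \<omega>] by (simp add: ext_d_alt)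
next
  case (Suc n)
  from Suc.prems(1) obtain Y Ys where Y: "Xs = Y # Ys" "Y \<in> VF" "Ys \<in> tuples (Suc n) VF"
    by (rule tuples_SucE)
  show ?case
    using ext_d_Cons[OF Y(2,3) Suc.prems(2)] Suc.IH[OF Y(3) form_contract[OF Suc.prems(2) Y(2)]]
    by (simp add: Y(1))
qed

lemma ext_d_cong:
  assumes "Xs \<in> tuples n VF" "\<And>Zs m. n = Suc m \<Longrightarrow> Zs \<in> tuples m VF \<Longrightarrow> \<omega> Zs = \<eta> Zs"
  shows "ext_d D \<omega> Xs = ext_d D \<eta> Xs"
proof -
  have "alt_pick_sum (\<lambda>X Ys. D X (\<omega> Ys)) Xs = alt_pick_sum (\<lambda>X Ys. D X (\<eta> Ys)) Xs"
    by (rule alt_pick_sum_cong[OF assms(1)]) (use assms(2) in auto)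
  moreover have "alt_pair_sum (\<lambda>X Y Zs. \<omega> (vf_bracket X Y # Zs)) Xs
    = alt_pair_sum (\<lambda>X Y Zs. \<eta> (vf_bracket X Y # Zs)) Xs"
    by (rule alt_pair_sum_cong[OF assms(1)]) (use assms(2) VF_bracket in auto)
  ultimately show ?thesis by (simp add: ext_d_alt)
qed

text \<open>On sections the defect is precisely the curvature. In higher degree the additional
  bracket terms match by Jacobi's identity.\<close>

lemma lie_vf_commutator:
  assumes "X \<in> VF" "Y \<in> VF" "\<And>s. s \<in> SV \<Longrightarrow> curvature D Y X s = 0"
    and "Xs \<in> tuples n VF" "form n \<omega>"
  shows "lie_vf D Y (lie_vf D X \<omega>) Xs - lie_vf D X (lie_vf D Y \<omega>) Xs = lie_vf D (vf_bracket Y X) \<omega> Xs"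
  using assms(4,5)
proof (induction n arbitrary: \<omega> Xs)
  case 0
  then show ?case using assms(3)[of "\<omega> []"] by (simp add: lie_vf_Nil curvature_def)
next
  case (Suc n)
  note c = form_contract[OF Suc.prems(2)]
  from Suc.prems(1) obtain Z Zs where Z: "Xs = Z # Zs" "Z \<in> VF" "Zs \<in> tuples n VF" by (rule tuples_SucE)
  have 1: "lie_vf D Y (lie_vf D X \<omega>) Xs = lie_vf D Y (lie_vf D X (\<lambda>Zs. \<omega> (Z # Zs))) Zs
    - lie_vf D Y (\<lambda>Zs. \<omega> (vf_bracket X Z # Zs)) Zs
    - lie_vf D X (\<lambda>Zs. \<omega> (vf_bracket Y Z # Zs)) Zs + \<omega> (vf_bracket X (vf_bracket Y Z) # Zs)"
    if "X \<in> VF" "Y \<in> VF" for X Y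
    using lie_vf_diff[OF that(2) Z(3) form_lie_vf[OF that(1) c[OF Z(2)]] c[OF VF_bracket[OF that(1) Z(2)]]]
    by (simp add: Z(1) lie_vf_Cons)
  have "\<omega> (vf_bracket X (vf_bracket Y Z) # Zs) + \<omega> (vf_bracket (vf_bracket Y X) Z # Zs)
    = \<omega> (vf_bracket Y (vf_bracket X Z) # Zs)"
    using form_add_slot[OF Suc.prems(2) _ _ Z(3), of "vf_bracket X (vf_bracket Y Z)" "vf_bracket (vf_bracket Y X) Z"]
      bracket_jacobi[OF assms(2,1) Z(2)] assms(1,2) Z(2) VF_bracket
    by (simp add: algebra_simps)
  then show ?case
    using Suc.IH[OF Z(3) c[OF Z(2)]] by (simp add: 1 assms(1,2)) (simp add: Z(1) lie_vf_Cons algebra_simps)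
qed

text \<open>In general \<open>[L\<^sub>Y, d] = (\<iota>\<^sub>Y R) \<and> _\<close>.\<close>

lemma lie_vf_rec_d:
  assumes "Y \<in> VF" "\<And>X s. X \<in> VF \<Longrightarrow> s \<in> SV \<Longrightarrow> curvature D Y X s = 0"
    and "Xs \<in> tuples (Suc n) VF" "form n \<omega>"
  shows "lie_vf D Y (\<lambda>Zs. rec_d D Zs \<omega>) Xs = rec_d D Xs (lie_vf D Y \<omega>)"
  using assms(3,4)
proof (induction n arbitrary: \<omega> Xs)
  case 0
  then obtain X where X: "Xs = [X]" "X \<in> VF" by (auto elim: tuples_SucE)
  then show ?case
    using lie_vf_commutator[OF X(2) assms(1) assms(2)[OF X(2)] _ 0(2), of "[]"]
    by (simp add: lie_vf_Cons lie_vf_Nil) (simp add: algebra_simps)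
next
  case (Suc n)
  note c = form_contract[OF Suc.prems(2)]
  from Suc.prems(1) obtain X Ys where X: "Xs = X # Ys" "X \<in> VF" "Ys \<in> tuples (Suc n) VF"
    by (rule tuples_SucE)
  have "lie_vf D Y (\<lambda>Zs. rec_d D Zs \<omega>) Xs
    = lie_vf D Y (\<lambda>Zs. lie_vf D X \<omega> Zs - rec_d D Zs (\<lambda>Ws. \<omega> (X # Ws))) Ys
      - lie_vf D (vf_bracket Y X) \<omega> Ys + rec_d D Ys (\<lambda>Zs. \<omega> (vf_bracket Y X # Zs))"
    by (simp add: X(1) lie_vf_Cons)
  also have "lie_vf D Y (\<lambda>Zs. lie_vf D X \<omega> Zs - rec_d D Zs (\<lambda>Ws. \<omega> (X # Ws))) Ys
    = lie_vf D Y (lie_vf D X \<omega>) Ys - lie_vf D Y (\<lambda>Zs. rec_d D Zs (\<lambda>Ws. \<omega> (X # Ws))) Ys"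
    by (intro lie_vf_diff[OF assms(1) X(3)] form_lie_vf[OF X(2)] form_rec_d c[OF X(2)] Suc.prems)
  also have "lie_vf D Y (\<lambda>Zs. rec_d D Zs (\<lambda>Ws. \<omega> (X # Ws))) Ys
    = rec_d D Ys (lie_vf D Y (\<lambda>Ws. \<omega> (X # Ws)))"
    by (rule Suc.IH[OF X(3) c[OF X(2)]])
  also have "\<dots> = rec_d D Ys (\<lambda>Zs. lie_vf D Y \<omega> (X # Zs)) + rec_d D Ys (\<lambda>Zs. \<omega> (vf_bracket Y X # Zs))"
    using rec_d_diff[OF X(3) form_lie_vf[OF assms(1) c[OF X(2)]] c[OF VF_bracket[OF assms(1) X(2)]]]
    by (simp add: lie_vf_Cons)
  also have "lie_vf D Y (lie_vf D X \<omega>) Ys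
    = lie_vf D (vf_bracket Y X) \<omega> Ys + lie_vf D X (lie_vf D Y \<omega>) Ys"
    using lie_vf_commutator[OF X(2) assms(1) assms(2)[OF X(2)] X(3) Suc.prems(2)]
    by (simp add: algebra_simps)
  finally show ?case by (simp add: X(1))
qed

section \<open>Products with the differential of a function\<close>

lemma form_wedge_d:
  assumes f: "f \<in> CF"
  shows "form n \<omega> \<Longrightarrow> form (Suc n) (wedge_d f \<omega>)"
proof (induction n arbitrary: \<omega>)
  case 0
  have "smul (\<lambda>x. (X + Y) x f) s = smul (\<lambda>x. X x f) s + smul (\<lambda>x. Y x f) s"
    "smul (\<lambda>x. vf_smul g X x f) s = smul g (smul (\<lambda>x. X x f) s)" for X Y g and s :: "'m \<Rightarrow> 'v"
    by (auto simp: smul_def vf_smul_def plus_fun_def scaleR_left_distrib)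
  then show ?case
    using 0 vfields_smooth(1)[OF man _ f] by (auto simp: SV_smul)
next
  case (Suc n)
  note c = form_contract[OF Suc.prems]
  have 1: "form (Suc n) (\<lambda>Xs. wedge_d f \<omega> (X # Xs))" if "X \<in> VF" for X
    unfolding wedge_d_Cons by (intro form_diff form_smul vfields_smooth(1)[OF man that f] Suc c that)
  have 2: "wedge_d f \<omega> ((X + Y) # Xs) = wedge_d f \<omega> (X # Xs) + wedge_d f \<omega> (Y # Xs)"
    if "X \<in> VF" "Y \<in> VF" "Xs \<in> tuples (Suc n) VF" for X Y Xs
  proof -
    have "wedge_d f (\<lambda>Zs. \<omega> ((X + Y) # Zs)) Xs = wedge_d f (\<lambda>Zs. \<omega> (X # Zs) - (- \<omega> (Y # Zs))) Xs"
      by (rule wedge_d_cong[OF that(3)]) (use that Suc.prems in auto)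
    also have "\<dots> = wedge_d f (\<lambda>Zs. \<omega> (X # Zs)) Xs + wedge_d f (\<lambda>Zs. \<omega> (Y # Zs)) Xs"
      by (simp only: wedge_d_hom) simp
    finally show ?thesis
      by (simp add: smul_def plus_fun_def scaleR_left_distrib) (simp add: fun_eq_iff minus_apply algebra_simps)
  qed
  have 3: "wedge_d f \<omega> (vf_smul g X # Xs) = smul g (wedge_d f \<omega> (X # Xs))"
    if "g \<in> CF" "X \<in> VF" "Xs \<in> tuples (Suc n) VF" for g X Xs
  proof -
    have "wedge_d f (\<lambda>Zs. \<omega> (vf_smul g X # Zs)) Xs = wedge_d f (\<lambda>Zs. smul g (\<omega> (X # Zs))) Xs"
      by (rule wedge_d_cong[OF that(3)]) (use that Suc.prems in auto)
    then show ?thesis by (simp add: wedge_d_hom smul_simps) (simp add: smul_def vf_smul_def)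
  qed
  have 4: "wedge_d f \<omega> (X # X # Xs) = 0" if "X # Xs \<in> tuples (Suc n) VF" for X Xs
  proof -
    have X: "X \<in> VF" "Xs \<in> tuples n VF" using that by auto
    \<comment> \<open>The zero form is written as a multiple by the zero function, so that
      \<open>wedge_d_hom\<close> can pull the factor out.\<close>
    have "wedge_d f (\<lambda>Zs. \<omega> (X # X # Zs)) Xs = wedge_d f (\<lambda>Zs. smul (\<lambda>x. 0) (\<omega> (X # X # Zs))) Xs"
    proof (cases n)
      case (Suc m)
      show ?thesis
        by (rule wedge_d_cong[of _ m VF]) (use Suc X Suc.prems in \<open>auto simp: smul_simps\<close>)
    qed (use X in auto)
    then show ?thesis
      by (simp add: wedge_d_hom) (simp add: smul_def zero_fun_def)
  qed
  show ?case
    using 1 2 3 4 unfolding form.simps(2)[of "Suc n"] by blast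
qed

text \<open>The derivation rule together with L_X df = d(X f); the latter is the definition of
  [X, Y] applied to \<open>f\<close>.\<close>

lemma lie_vf_wedge_d:
  assumes f: "f \<in> CF" and X: "X \<in> VF" and "Xs \<in> tuples (Suc n) VF" "form n \<omega>"
  shows "lie_vf D X (wedge_d f \<omega>) Xs = wedge_d (\<lambda>x. X x f) \<omega> Xs + wedge_d f (lie_vf D X \<omega>) Xs"
  using assms(3,4)
proof (induction n arbitrary: \<omega> Xs)
  case 0
  then obtain Y where Y: "Xs = [Y]" "Y \<in> VF" by (auto elim: tuples_SucE)
  then show ?case
    using 0 lie_vf_smul[OF vfields_smooth(1)[OF man Y(2) f] X, of "[]" 0 \<omega>]
    by (simp add: lie_vf_Cons lie_vf_Nil)
      (simp add: smul_def vf_bracket_def fun_eq_iff plus_fun_apply minus_apply algebra_simps)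
next
  case (Suc n)
  note c = form_contract[OF Suc.prems(2)]
  from Suc.prems(1) obtain Y Ys where Y: "Xs = Y # Ys" "Y \<in> VF" "Ys \<in> tuples (Suc n) VF"
    by (rule tuples_SucE)
  have Yf: "(\<lambda>x. Y x f) \<in> CF" by (rule vfields_smooth(1)[OF man Y(2) f])
  have "lie_vf D X (wedge_d f \<omega>) Xs
    = lie_vf D X (\<lambda>Zs. smul (\<lambda>x. Y x f) (\<omega> Zs)) Ys - lie_vf D X (wedge_d f (\<lambda>Zs. \<omega> (Y # Zs))) Ys
      - wedge_d f \<omega> (vf_bracket X Y # Ys)"
    using lie_vf_diff[OF X Y(3) form_smul[OF Yf Suc.prems(2)] form_wedge_d[OF f c[OF Y(2)]]]
    by (simp only: Y(1) lie_vf_Cons wedge_d_Cons)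
  also have "lie_vf D X (wedge_d f (\<lambda>Zs. \<omega> (Y # Zs))) Ys
    = wedge_d (\<lambda>x. X x f) (\<lambda>Zs. \<omega> (Y # Zs)) Ys + wedge_d f (lie_vf D X (\<lambda>Zs. \<omega> (Y # Zs))) Ys"
    by (rule Suc.IH[OF Y(3) c[OF Y(2)]])
  also have "lie_vf D X (\<lambda>Zs. smul (\<lambda>x. Y x f) (\<omega> Zs)) Ys
    = smul (\<lambda>x. Y x f) (lie_vf D X \<omega> Ys) + smul (\<lambda>x. X x (\<lambda>y. Y y f)) (\<omega> Ys)"
    by (rule lie_vf_smul[OF Yf X Y(3) Suc.prems(2)])
  finally show ?case
    by (simp add: Y(1) lie_vf_Cons wedge_d_hom)
      (simp add: smul_def vf_bracket_def fun_eq_iff plus_fun_apply minus_apply algebra_simps)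
qed

lemma rec_d_wedge_d:
  assumes f: "f \<in> CF" and "Xs \<in> tuples (Suc (Suc n)) VF" "form n \<omega>"
  shows "rec_d D Xs (wedge_d f \<omega>) = - wedge_d f (\<lambda>Zs. rec_d D Zs \<omega>) Xs"
  using assms(2,3)
proof (induction n arbitrary: \<omega> Xs)
  case 0
  from 0(1) obtain X Ys where X: "Xs = X # Ys" "X \<in> VF" "Ys \<in> tuples 1 VF"
    by (auto elim: tuples_SucE)
  then obtain Y where Y: "Ys = [Y]" "Y \<in> VF" by (auto elim: tuples_SucE)
  show ?case
    using lie_vf_wedge_d[OF f X(2) _ 0(2), of Ys] lie_vf_smul[OF vfields_smooth(1)[OF man X(2) f] Y(2) _ 0(2), of "[]"]
    by (simp add: X(1) Y lie_vf_Nil smul_simps)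
next
  case (Suc n)
  note c = form_contract[OF Suc.prems(2)]
  from Suc.prems(1) obtain X Ys where X: "Xs = X # Ys" "X \<in> VF" "Ys \<in> tuples (Suc (Suc n)) VF"
    by (rule tuples_SucE)
  have Xf: "(\<lambda>x. X x f) \<in> CF" by (rule vfields_smooth(1)[OF man X(2) f])
  have "rec_d D Xs (wedge_d f \<omega>) = lie_vf D X (wedge_d f \<omega>) Ys
    - (rec_d D Ys (\<lambda>Zs. smul (\<lambda>x. X x f) (\<omega> Zs)) - rec_d D Ys (wedge_d f (\<lambda>Zs. \<omega> (X # Zs))))"
    using rec_d_diff[OF X(3) form_smul[OF Xf Suc.prems(2)] form_wedge_d[OF f c[OF X(2)]]]
    by (simp only: X(1) rec_d.simps wedge_d_Cons)
  then show ?case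
    using lie_vf_wedge_d[OF f X(2,3) Suc.prems(2)] rec_d_smul[OF Xf X(3) Suc.prems(2)]
      Suc.IH[OF X(3) c[OF X(2)]]
    by (simp add: X(1) wedge_d_hom)
qed

end

section \<open>The two differentials on Weil cochains\<close>

text \<open>The factor (-1)^k without scalars, so that every additive map in the sense of
  \<open>hom_on\<close> commutes with it.\<close>

definition sign_pow :: "nat \<Rightarrow> 'b::ab_group_add \<Rightarrow> 'b" where
  "sign_pow k a = (if even k then a else - a)"

lemma sign_pow_simps:
  "sign_pow k (a + b) = sign_pow k a + sign_pow k b"
  "sign_pow k (a - b) = sign_pow k a - sign_pow k b"
  "sign_pow k (- a) = - sign_pow k a"
  "sign_pow k (sign_pow k a) = a"
  "sign_pow k 0 = 0"
  "sign_pow 0 a = a"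
  "sign_pow (Suc k) a = - sign_pow k a"
  by (auto simp: sign_pow_def)

lemma sign_pow_scaleR:
  fixes g :: "'m \<Rightarrow> 'v::real_vector"
  shows "(\<lambda>x. (-1) ^ k *\<^sub>R g x) = sign_pow k g"
  by (auto simp: sign_pow_def uminus_apply)

lemma sign_pow_apply: "sign_pow k f x = sign_pow k (f x)"
  by (simp add: sign_pow_def uminus_apply)

lemma pick_sum_sign_pow: "pick_sum (\<lambda>x ys. sign_pow k (f x ys)) xs = sign_pow k (pick_sum f xs)"
  by (simp add: sign_pow_def pick_sum_minus)

lemma hom_on_sign_pow:
  assumes "hom_on K h" "a \<in> K"
  shows "sign_pow k a \<in> K" "h (sign_pow k a) = sign_pow k (h a)"
  using hom_on_minus[OF assms] assms(2) by (auto simp: sign_pow_def)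

text \<open>The Chevalley-Eilenberg part of \<open>delta\<close>. The family \<open>F\<close> is
  left arbitrary, since the operator is applied to a component of a cochain, to its exterior
  derivative and to sums of insertions.\<close>

definition ce_diff ::
  "('m, 'a) lie_algebroid \<Rightarrow> (('m \<Rightarrow> 'a) \<Rightarrow> ('m \<Rightarrow> 'v) \<Rightarrow> 'm \<Rightarrow> 'v) \<Rightarrow>
   (('m \<Rightarrow> 'a) list \<Rightarrow> ('m, 'a, 'v::real_normed_vector) svform) \<Rightarrow> ('m \<Rightarrow> 'a) list \<Rightarrow> ('m, 'a, 'v) svform" where
  "ce_diff A DA F \<alpha>s \<beta>s Xs =
     alt_pick_sum (\<lambda>a as. lie_A A DA a (F as) \<beta>s Xs) \<alpha>s
     + alt_pair_sum (\<lambda>a b as. F (bracket A a b # as) \<beta>s Xs) \<alpha>s"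

lemma lie_A_alt:
  "lie_A A DA \<alpha> \<gamma> \<beta>s Xs = DA \<alpha> (\<gamma> \<beta>s Xs) - deriv_sum (bracket A \<alpha>) (\<lambda>bs. \<gamma> bs Xs) \<beta>s
    - deriv_sum (vf_bracket (rho A \<alpha>)) (\<gamma> \<beta>s) Xs"
  unfolding lie_A_def
  by (rule ext) (simp add: minus_apply deriv_sum_apply sum_list_update[of "\<lambda>Ys. \<gamma> \<beta>s Ys _"]
      sum_list_update[of "\<lambda>bs. \<gamma> bs Xs _"])

lemma delta_eq:
  assumes "weil_dom M A (p + 1) q k \<alpha>s \<beta>s Xs"
  shows "delta M A DA p q c k \<alpha>s \<beta>s Xs = sign_pow k (ce_diff A DA (c k) \<alpha>s \<beta>s Xs
    - pick_sum (\<lambda>b bs. c (k - 1) \<alpha>s bs (rho A b # Xs)) \<beta>s)"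
proof -
  \<comment> \<open>The last sum of \<open>delta\<close> is indexed up to \<open>k\<close>, while
    \<open>pick_sum\<close> follows the list.\<close>
  have "k = length \<beta>s" using assms by (simp add: weil_dom_def tuples_def)
  then show ?thesis
    using assms
    by (simp only: delta_def if_True sign_pow_scaleR[symmetric])
      (simp add: fun_eq_iff ce_diff_def plus_fun_apply minus_apply pick_sum_apply
        sum_omit[of "\<lambda>b bs. c _ \<alpha>s bs (rho A b # Xs) _"]
        alt_sum_omit[of "\<lambda>a as. lie_A A DA a (c _ as) \<beta>s Xs"]
        alt_sum_omit_pair[of "\<lambda>a b as. c _ (bracket A a b # as) \<beta>s Xs"])
qed

lemma cov_d_eq:
  assumes "weil_dom M A p (q + 1) k \<alpha>s \<beta>s Xs"
  shows "cov_d M A D p q c k \<alpha>s \<beta>s Xs = sign_pow k (ext_d D (c k \<alpha>s \<beta>s) Xs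
    - pick_sum (\<lambda>b bs. c (k - 1) (b # \<alpha>s) bs Xs) \<beta>s)"
proof -
  have "k = length \<beta>s" using assms by (simp add: weil_dom_def tuples_def)
  then show ?thesis
    using assms
    by (simp only: cov_d_def if_True sign_pow_scaleR[symmetric])
      (simp add: fun_eq_iff minus_apply pick_sum_apply sum_omit[of "\<lambda>b bs. c _ (b # \<alpha>s) bs Xs _"])
qed

text \<open>By symmetry the transformed entry may be moved to the front, which turns a derivation
  into a sum over picked entries.\<close>

lemma deriv_sum_symmetric:
  assumes "xs \<in> tuples n S" "\<And>x. x \<in> S \<Longrightarrow> T x \<in> S"
    and "\<And>ys zs. ys \<in> tuples n S \<Longrightarrow> zs \<in> tuples n S \<Longrightarrow> mset ys = mset zs \<Longrightarrow> H ys = H zs"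
  shows "deriv_sum T H xs = pick_sum (\<lambda>y ys. H (T y # ys)) xs"
  using assms(1,3)
proof (induction xs arbitrary: H n)
  case (Cons x xs)
  then obtain m where n: "n = Suc m" "x \<in> S" "xs \<in> tuples m S" by (auto elim: tuples_ConsE)
  have "deriv_sum T (\<lambda>ys. H (x # ys)) xs = pick_sum (\<lambda>y ys. H (x # T y # ys)) xs"
    by (rule Cons.IH[OF n(3)], rule Cons.prems(2)) (simp_all add: n)
  also have "\<dots> = pick_sum (\<lambda>y ys. H (T y # x # ys)) xs"
    by (rule pick_sum_cong[OF n(3)], rule Cons.prems(2)) (simp_all add: n assms(2))
  finally show ?case by simp
qed simp

text \<open>After \<open>deriv_sum_symmetric\<close> the sum runs over ordered pairs of entries.
  Exchanging the two picks preserves it, while antisymmetry of the bracket reverses its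
  sign.\<close>

lemma pick_sum_bracket_eq_0:
  fixes H :: "'x list \<Rightarrow> 'm \<Rightarrow> 'v::real_vector"
  assumes "xs \<in> tuples n S" "\<And>x y. x \<in> S \<Longrightarrow> y \<in> S \<Longrightarrow> B x y \<in> S"
    and "\<And>ys zs m. n = Suc m \<Longrightarrow> ys \<in> tuples m S \<Longrightarrow> zs \<in> tuples m S \<Longrightarrow> mset ys = mset zs \<Longrightarrow> H ys = H zs"
    and "\<And>x y zs m. n = Suc (Suc m) \<Longrightarrow> x \<in> S \<Longrightarrow> y \<in> S \<Longrightarrow> zs \<in> tuples m S \<Longrightarrow>
      H (B y x # zs) = - H (B x y # zs)"
  shows "pick_sum (\<lambda>x ys. deriv_sum (B x) H ys) xs = 0"
proof -
  have "pick_sum (\<lambda>x ys. deriv_sum (B x) H ys) xs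
      = pick_sum (\<lambda>x ys. pick_sum (\<lambda>y zs. H (B x y # zs)) ys) xs" (is "?l = ?r")
  proof (rule pick_sum_cong[OF assms(1)])
    fix x ys m assume m: "n = Suc m" "x \<in> S" "ys \<in> tuples m S"
    show "deriv_sum (B x) H ys = pick_sum (\<lambda>y zs. H (B x y # zs)) ys"
      by (rule deriv_sum_symmetric[OF m(3)]) (fact assms(2)[OF m(2)] assms(3)[OF m(1)])+
  qed
  have "?r = pick_sum (\<lambda>x ys. pick_sum (\<lambda>y zs. H (B y x # zs)) ys) xs"
    by (rule pick_sum_swap)
  also have "\<dots> = pick_sum (\<lambda>x ys. - pick_sum (\<lambda>y zs. H (B x y # zs)) ys) xs"
  proof (rule pick_sum_cong[OF assms(1)])
    fix x ys m assume m: "n = Suc m" "x \<in> S" "ys \<in> tuples m S"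
    show "pick_sum (\<lambda>y zs. H (B y x # zs)) ys = - pick_sum (\<lambda>y zs. H (B x y # zs)) ys"
      unfolding pick_sum_minus[symmetric]
      by (rule pick_sum_cong[OF m(3)], rule assms(4)) (simp_all add: m)
  qed
  also have "\<dots> = - ?r" by (rule pick_sum_minus)
  finally have r: "?r = - ?r" .
  \<comment> \<open>A real vector space has no 2-torsion.\<close>
  have "y = 0" if "y = - y" for y :: 'v
  proof -
    have "y + y = 0" using that by (metis right_minus)
    then have "2 *\<^sub>R y = 0" by (simp only: scaleR_2)
    then show ?thesis by simp
  qed
  with fun_cong[OF r] have "?r = 0"
    unfolding uminus_apply by (auto simp: zero_fun_def intro!: ext)
  with \<open>?l = ?r\<close> show ?thesis by simp
qed

section \<open>Representations and the Chevalley-Eilenberg part\<close>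

locale algebroid_rep = connection_on_bundle M V D
  for M :: "('m::{t2_space,second_countable_topology}, 'e::fin_dim_normed_vector) atlas"
    and V :: "('m, 'v::fin_dim_normed_vector) vbundle" and D +
  fixes A :: "('m, 'a::fin_dim_normed_vector) lie_algebroid"
    and DA :: "('m \<Rightarrow> 'a) \<Rightarrow> ('m \<Rightarrow> 'v) \<Rightarrow> 'm \<Rightarrow> 'v"
  assumes alg: "is_lie_algebroid M A"
    and flat: "flat_A_connection M A V DA"
begin

abbreviation SA where "SA \<equiv> asections M A"

lemma abun: "vector_bundle M (vbdl A)"
  and rho_VF: "\<alpha> \<in> SA \<Longrightarrow> rho A \<alpha> \<in> VF"
  and bracket_SA: "\<alpha> \<in> SA \<Longrightarrow> \<beta> \<in> SA \<Longrightarrow> bracket A \<alpha> \<beta> \<in> SA"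
  and bracket_antisym: "\<alpha> \<in> SA \<Longrightarrow> \<beta> \<in> SA \<Longrightarrow> bracket A \<alpha> \<beta> = - bracket A \<beta> \<alpha>"
  using alg unfolding is_lie_algebroid_def by blast+

lemma DA_add: "\<alpha> \<in> SA \<Longrightarrow> s \<in> SV \<Longrightarrow> t \<in> SV \<Longrightarrow> DA \<alpha> (s + t) = DA \<alpha> s + DA \<alpha> t"
  using flat unfolding flat_A_connection_def by blast+

lemma hom_on_DA:
  assumes "\<alpha> \<in> SA"
  shows "hom_on SV (DA \<alpha>)"
  unfolding hom_on_def
proof (intro conjI ballI SV_0)
  fix s t assume s: "s \<in> SV" and t: "t \<in> SV"
  then show "s - t \<in> SV" by (rule SV_diff)
  then show "DA \<alpha> (s - t) = DA \<alpha> s - DA \<alpha> t"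
    using DA_add[OF assms _ t, of "s - t"] by (simp add: algebra_simps)
qed

lemma lie_A_cong:
  assumes "\<beta>s \<in> tuples k SA" "Xs \<in> tuples n VF" "\<alpha> \<in> SA"
    and "\<And>bs Zs. bs \<in> tuples k SA \<Longrightarrow> Zs \<in> tuples n VF \<Longrightarrow> \<gamma> bs Zs = \<eta> bs Zs"
  shows "lie_A A DA \<alpha> \<gamma> \<beta>s Xs = lie_A A DA \<alpha> \<eta> \<beta>s Xs"
proof -
  have "deriv_sum (bracket A \<alpha>) (\<lambda>bs. \<gamma> bs Xs) \<beta>s = deriv_sum (bracket A \<alpha>) (\<lambda>bs. \<eta> bs Xs) \<beta>s"
    by (rule deriv_sum_cong[OF assms(1)]) (use assms bracket_SA in auto)
  moreover have "deriv_sum (vf_bracket (rho A \<alpha>)) (\<gamma> \<beta>s) Xs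
    = deriv_sum (vf_bracket (rho A \<alpha>)) (\<eta> \<beta>s) Xs"
    by (rule deriv_sum_cong[OF assms(2)]) (use assms VF_bracket rho_VF in auto)
  ultimately show ?thesis using assms by (simp add: lie_A_alt)
qed

text \<open>\<open>F\<close> meets only lists one entry shorter than \<alpha>s: one entry is
  omitted, or two are merged into a bracket. For empty \<alpha>s, that is in component k = p + 1,
  nothing is demanded.\<close>

lemma ce_diff_cong:
  assumes "\<alpha>s \<in> tuples l SA" "\<beta>s \<in> tuples k SA" "Xs \<in> tuples n VF"
    and "\<And>m as bs Zs. l = Suc m \<Longrightarrow> as \<in> tuples m SA \<Longrightarrow> bs \<in> tuples k SA \<Longrightarrow> Zs \<in> tuples n VF \<Longrightarrow>
      F as bs Zs = F' as bs Zs"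
  shows "ce_diff A DA F \<alpha>s \<beta>s Xs = ce_diff A DA F' \<alpha>s \<beta>s Xs"
proof -
  have "alt_pick_sum (\<lambda>a as. lie_A A DA a (F as) \<beta>s Xs) \<alpha>s
    = alt_pick_sum (\<lambda>a as. lie_A A DA a (F' as) \<beta>s Xs) \<alpha>s"
    by (rule alt_pick_sum_cong[OF assms(1)], rule lie_A_cong[OF assms(2,3)]) (use assms(4) in auto)
  moreover have "alt_pair_sum (\<lambda>a b as. F (bracket A a b # as) \<beta>s Xs) \<alpha>s
    = alt_pair_sum (\<lambda>a b as. F' (bracket A a b # as) \<beta>s Xs) \<alpha>s"
    by (rule alt_pair_sum_cong[OF assms(1)]) (use assms bracket_SA in auto)
  ultimately show ?thesis by (simp add: ce_diff_def)
qed

lemma lie_A_diff: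
  assumes "\<alpha> \<in> SA" "\<gamma> \<beta>s Xs \<in> SV" "\<eta> \<beta>s Xs \<in> SV"
  shows "lie_A A DA \<alpha> (\<lambda>bs Zs. \<gamma> bs Zs - \<eta> bs Zs) \<beta>s Xs = lie_A A DA \<alpha> \<gamma> \<beta>s Xs - lie_A A DA \<alpha> \<eta> \<beta>s Xs"
  using hom_on_diff(2)[OF hom_on_DA] assms by (simp add: lie_A_alt deriv_sum_diff)

text \<open>Only the term with \<open>DA\<close> needs its argument to be a section; the bracket
  terms are additive for arbitrary maps. Hence the conditions concern only the given \<beta>s and
  \<open>Xs\<close>.\<close>

lemma ce_diff_diff:
  assumes "\<alpha>s \<in> tuples l SA"
    and "\<And>m as. l = Suc m \<Longrightarrow> as \<in> tuples m SA \<Longrightarrow> F as \<beta>s Xs \<in> SV \<and> F' as \<beta>s Xs \<in> SV"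
  shows "ce_diff A DA (\<lambda>as bs Zs. F as bs Zs - F' as bs Zs) \<alpha>s \<beta>s Xs
    = ce_diff A DA F \<alpha>s \<beta>s Xs - ce_diff A DA F' \<alpha>s \<beta>s Xs"
proof -
  have "alt_pick_sum (\<lambda>a as. lie_A A DA a (\<lambda>bs Zs. F as bs Zs - F' as bs Zs) \<beta>s Xs) \<alpha>s
    = alt_pick_sum (\<lambda>a as. lie_A A DA a (F as) \<beta>s Xs - lie_A A DA a (F' as) \<beta>s Xs) \<alpha>s"
    by (rule alt_pick_sum_cong[OF assms(1)], rule lie_A_diff) (use assms(2) in auto)
  then show ?thesis
    by (simp add: ce_diff_def alt_pick_sum_diff alt_pair_sum_diff)
qed

lemma ce_diff_0:
  assumes "\<alpha>s \<in> tuples l SA"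
  shows "ce_diff A DA (\<lambda>as bs Zs. 0) \<alpha>s \<beta>s Xs = 0"
  using ce_diff_diff[OF assms, of "\<lambda>_ _ _. 0" \<beta>s Xs "\<lambda>_ _ _. 0"] SV_0 by simp

lemma ce_diff_sign_pow:
  assumes "\<alpha>s \<in> tuples l SA"
    and "\<And>m as. l = Suc m \<Longrightarrow> as \<in> tuples m SA \<Longrightarrow> F as \<beta>s Xs \<in> SV"
  shows "ce_diff A DA (\<lambda>as bs Zs. sign_pow k (F as bs Zs)) \<alpha>s \<beta>s Xs = sign_pow k (ce_diff A DA F \<alpha>s \<beta>s Xs)"
  using ce_diff_diff[OF assms(1), of "\<lambda>_ _ _. 0" \<beta>s Xs F] SV_0 assms(2) ce_diff_0[OF assms(1)]
  by (simp add: sign_pow_def)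

text \<open>On the left L^A_a also acts on the entry that is picked, whereas \<open>lie_A\<close> of
  \<open>G b\<close> keeps \<open>b\<close> fixed. The second sum on the right is this
  difference.\<close>

lemma lie_A_pick_sum:
  assumes "a \<in> SA" "\<beta>s \<in> tuples k SA" "Xs \<in> tuples n VF"
    and "\<And>b bs m. k = Suc m \<Longrightarrow> b \<in> SA \<Longrightarrow> bs \<in> tuples m SA \<Longrightarrow> G b bs Xs \<in> SV"
  shows "lie_A A DA a (\<lambda>bs Zs. pick_sum (\<lambda>b bs. G b bs Zs) bs) \<beta>s Xs
    = pick_sum (\<lambda>b bs. lie_A A DA a (G b) bs Xs) \<beta>s - pick_sum (\<lambda>b bs. G (bracket A a b) bs Xs) \<beta>s"
proof -
  have "DA a (pick_sum (\<lambda>b bs. G b bs Xs) \<beta>s) = pick_sum (\<lambda>b bs. DA a (G b bs Xs)) \<beta>s"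
    by (rule hom_on_pick_sum(2)[OF hom_on_DA[OF assms(1)] assms(2)]) (use assms(4) in auto)
  moreover have "deriv_sum (vf_bracket (rho A a)) (\<lambda>Zs. pick_sum (\<lambda>b bs. G b bs Zs) \<beta>s) Xs
    = pick_sum (\<lambda>b bs. deriv_sum (vf_bracket (rho A a)) (G b bs) Xs) \<beta>s"
    by (rule deriv_sum_pick_sum_param)
  moreover have "deriv_sum (bracket A a) (\<lambda>bs. pick_sum (\<lambda>b bs. G b bs Xs) bs) \<beta>s
    = pick_sum (\<lambda>b bs. G (bracket A a b) bs Xs) \<beta>s
      + pick_sum (\<lambda>b bs. deriv_sum (bracket A a) (\<lambda>bs. G b bs Xs) bs) \<beta>s"
    using deriv_sum_pick_sum[of "bracket A a" "\<lambda>b bs. G b bs Xs" \<beta>s] by (simp add: eta_contract_eq)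
  ultimately show ?thesis
    by (simp add: lie_A_alt pick_sum_diff)
qed

text \<open>Cartan's formula i_b d + d i_b = L_b for the Chevalley-Eilenberg differential, with
  \<open>b\<close> inserted as first alternating argument and summed over the symmetric ones. L^A_b
  differs from \<open>lie_vf\<close> along rho(b) by brackets of \<open>b\<close> with the other
  symmetric arguments, and these cancel in the sum.\<close>

lemma ce_diff_pick_sum:
  assumes DA: "\<And>a s. a \<in> SA \<Longrightarrow> s \<in> SV \<Longrightarrow> DA a s = D (rho A a) s"
    and \<alpha>s: "\<alpha>s \<in> tuples l SA" and \<beta>s: "\<beta>s \<in> tuples k SA" and Xs: "Xs \<in> tuples n VF"
    and val: "\<And>as bs k'. k = Suc k' \<Longrightarrow> as \<in> tuples l SA \<Longrightarrow> bs \<in> tuples k' SA \<Longrightarrow> G as bs Xs \<in> SV"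
    and swap: "\<And>a b as bs k' l'. k = Suc k' \<Longrightarrow> l = Suc (Suc l') \<Longrightarrow> a \<in> SA \<Longrightarrow> b \<in> SA \<Longrightarrow>
      as \<in> tuples l' SA \<Longrightarrow> bs \<in> tuples k' SA \<Longrightarrow> G (b # a # as) bs Xs = - G (a # b # as) bs Xs"
    and minus: "\<And>a as bs k' l'. k = Suc k' \<Longrightarrow> l = Suc l' \<Longrightarrow> a \<in> SA \<Longrightarrow>
      as \<in> tuples l' SA \<Longrightarrow> bs \<in> tuples k' SA \<Longrightarrow> G (- a # as) bs Xs = - G (a # as) bs Xs"
    and sym: "\<And>bs bs' k'. k = Suc k' \<Longrightarrow> bs \<in> tuples k' SA \<Longrightarrow> bs' \<in> tuples k' SA \<Longrightarrow> mset bs = mset bs' \<Longrightarrow>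
      G \<alpha>s bs Xs = G \<alpha>s bs' Xs"
    and minus': "\<And>b bs k'. k = Suc (Suc k') \<Longrightarrow> b \<in> SA \<Longrightarrow> bs \<in> tuples k' SA \<Longrightarrow>
      G \<alpha>s (- b # bs) Xs = - G \<alpha>s (b # bs) Xs"
  shows "pick_sum (\<lambda>b bs. ce_diff A DA G (b # \<alpha>s) bs Xs) \<beta>s
      + ce_diff A DA (\<lambda>as bs Zs. pick_sum (\<lambda>b bs. G (b # as) bs Zs) bs) \<alpha>s \<beta>s Xs
    = pick_sum (\<lambda>b bs. lie_vf D (rho A b) (G \<alpha>s bs) Xs) \<beta>s"
proof -
  \<comment> \<open>Expansion along the leading argument \<open>b\<close>: the terms that
    differentiate along or bracket with \<open>b\<close> come first; the rest is the differential in
    \<alpha>s with the opposite sign.\<close>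
  have A: "ce_diff A DA G (b # \<alpha>s) bs Xs = lie_vf D (rho A b) (G \<alpha>s bs) Xs
      - deriv_sum (bracket A b) (\<lambda>bs. G \<alpha>s bs Xs) bs
      - alt_pick_sum (\<lambda>a as. lie_A A DA a (G (b # as)) bs Xs) \<alpha>s
      - alt_pick_sum (\<lambda>a as. G (bracket A b a # as) bs Xs) \<alpha>s
      + alt_pair_sum (\<lambda>a a' as. - G (b # bracket A a a' # as) bs Xs) \<alpha>s"
    if k': "k = Suc k'" "b \<in> SA" "bs \<in> tuples k' SA" for b bs k'
  proof -
    have "lie_A A DA b (G \<alpha>s) bs Xs = lie_vf D (rho A b) (G \<alpha>s bs) Xs
      - deriv_sum (bracket A b) (\<lambda>bs. G \<alpha>s bs Xs) bs"
      using DA[OF k'(2) val[OF k'(1) \<alpha>s k'(3)]] by (simp add: lie_A_alt lie_vf_def)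
    moreover have "alt_pair_sum (\<lambda>a a' as. G (bracket A a a' # b # as) bs Xs) \<alpha>s
      = alt_pair_sum (\<lambda>a a' as. - G (b # bracket A a a' # as) bs Xs) \<alpha>s"
      by (rule alt_pair_sum_cong[OF \<alpha>s], rule swap[OF k'(1) _ _ _ _ k'(3)]) (simp_all add: k' bracket_SA)
    ultimately show ?thesis by (simp add: ce_diff_def)
  qed
  have "pick_sum (\<lambda>b bs. ce_diff A DA G (b # \<alpha>s) bs Xs) \<beta>s
    = pick_sum (\<lambda>b bs. lie_vf D (rho A b) (G \<alpha>s bs) Xs
      - deriv_sum (bracket A b) (\<lambda>bs. G \<alpha>s bs Xs) bs
      - alt_pick_sum (\<lambda>a as. lie_A A DA a (G (b # as)) bs Xs) \<alpha>s
      - alt_pick_sum (\<lambda>a as. G (bracket A b a # as) bs Xs) \<alpha>s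
      + alt_pair_sum (\<lambda>a a' as. - G (b # bracket A a a' # as) bs Xs) \<alpha>s) \<beta>s"
    by (rule pick_sum_cong[OF \<beta>s], rule A)
  also have "\<dots> = pick_sum (\<lambda>b bs. lie_vf D (rho A b) (G \<alpha>s bs) Xs) \<beta>s
      - pick_sum (\<lambda>b bs. deriv_sum (bracket A b) (\<lambda>bs. G \<alpha>s bs Xs) bs) \<beta>s
      - alt_pick_sum (\<lambda>a as. pick_sum (\<lambda>b bs. lie_A A DA a (G (b # as)) bs Xs) \<beta>s) \<alpha>s
      - alt_pick_sum (\<lambda>a as. pick_sum (\<lambda>b bs. G (bracket A b a # as) bs Xs) \<beta>s) \<alpha>s
      - alt_pair_sum (\<lambda>a a' as. pick_sum (\<lambda>b bs. G (b # bracket A a a' # as) bs Xs) \<beta>s) \<alpha>s"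
    by (simp add: pick_sum_diff pick_sum_add pick_sum_alt_pick_sum pick_sum_alt_pair_sum pick_sum_minus
        alt_pair_sum_minus)
  \<comment> \<open>A bracket of two symmetric arguments: antisymmetric in the pair, inserted into a
    symmetric map.\<close>
  also have "pick_sum (\<lambda>b bs. deriv_sum (bracket A b) (\<lambda>bs. G \<alpha>s bs Xs) bs) \<beta>s = 0"
  proof (rule pick_sum_bracket_eq_0[OF \<beta>s])
    fix x y zs m assume m: "k = Suc (Suc m)" "x \<in> SA" "y \<in> SA" "zs \<in> tuples m SA"
    show "G \<alpha>s (bracket A y x # zs) Xs = - G \<alpha>s (bracket A x y # zs) Xs"
      unfolding bracket_antisym[OF m(3,2)] by (rule minus'[OF m(1) bracket_SA[OF m(2,3)] m(4)])
  qed (fact bracket_SA sym)+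
  finally have L: "pick_sum (\<lambda>b bs. ce_diff A DA G (b # \<alpha>s) bs Xs) \<beta>s
    = pick_sum (\<lambda>b bs. lie_vf D (rho A b) (G \<alpha>s bs) Xs) \<beta>s
      - alt_pick_sum (\<lambda>a as. pick_sum (\<lambda>b bs. lie_A A DA a (G (b # as)) bs Xs) \<beta>s) \<alpha>s
      - alt_pick_sum (\<lambda>a as. pick_sum (\<lambda>b bs. G (bracket A b a # as) bs Xs) \<beta>s) \<alpha>s
      - alt_pair_sum (\<lambda>a a' as. pick_sum (\<lambda>b bs. G (b # bracket A a a' # as) bs Xs) \<beta>s) \<alpha>s"
    by simp
  have "alt_pick_sum (\<lambda>a as. lie_A A DA a (\<lambda>bs Zs. pick_sum (\<lambda>b bs. G (b # as) bs Zs) bs) \<beta>s Xs) \<alpha>s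
    = alt_pick_sum (\<lambda>a as. pick_sum (\<lambda>b bs. lie_A A DA a (G (b # as)) bs Xs) \<beta>s
      + pick_sum (\<lambda>b bs. G (bracket A b a # as) bs Xs) \<beta>s) \<alpha>s"
  proof (rule alt_pick_sum_cong[OF \<alpha>s])
    fix a as m assume m: "l = Suc m" "a \<in> SA" "as \<in> tuples m SA"
    have "lie_A A DA a (\<lambda>bs Zs. pick_sum (\<lambda>b bs. G (b # as) bs Zs) bs) \<beta>s Xs
      = pick_sum (\<lambda>b bs. lie_A A DA a (G (b # as)) bs Xs) \<beta>s
        - pick_sum (\<lambda>b bs. G (bracket A a b # as) bs Xs) \<beta>s"
      by (rule lie_A_pick_sum[OF m(2) \<beta>s Xs], rule val) (simp_all add: m)
    \<comment> \<open>Turning [a, b] into [b, a] aligns this term with the one in \<open>L\<close>,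
      against which it cancels.\<close>
    also have "pick_sum (\<lambda>b bs. G (bracket A a b # as) bs Xs) \<beta>s
      = pick_sum (\<lambda>b bs. - G (bracket A b a # as) bs Xs) \<beta>s"
    proof (rule pick_sum_cong[OF \<beta>s])
      fix b bs k' assume k': "k = Suc k'" "b \<in> SA" "bs \<in> tuples k' SA"
      show "G (bracket A a b # as) bs Xs = - G (bracket A b a # as) bs Xs"
        unfolding bracket_antisym[OF m(2) k'(2)]
        by (rule minus[OF k'(1) m(1) bracket_SA[OF k'(2) m(2)] m(3) k'(3)])
    qed
    finally show "lie_A A DA a (\<lambda>bs Zs. pick_sum (\<lambda>b bs. G (b # as) bs Zs) bs) \<beta>s Xs
      = pick_sum (\<lambda>b bs. lie_A A DA a (G (b # as)) bs Xs) \<beta>s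
      + pick_sum (\<lambda>b bs. G (bracket A b a # as) bs Xs) \<beta>s"
      by (simp add: pick_sum_minus)
  qed
  then show ?thesis
    unfolding L by (simp add: ce_diff_def alt_pick_sum_add)
qed

lemma lie_A_eq_lie_vf:
  assumes "DA a (\<gamma> \<beta>s Xs) = D (rho A a) (\<gamma> \<beta>s Xs)"
  shows "lie_A A DA a \<gamma> \<beta>s Xs
    = lie_vf D (rho A a) (\<gamma> \<beta>s) Xs - deriv_sum (bracket A a) (\<lambda>bs. \<gamma> bs Xs) \<beta>s"
  using assms by (simp add: lie_A_alt lie_vf_def)

section \<open>Consequences of A-invariance\<close>

context
  assumes inv: "A_invariant M A V DA D"
begin

lemma DA_eq: "a \<in> SA \<Longrightarrow> s \<in> SV \<Longrightarrow> DA a s = D (rho A a) s"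
  and curv: "a \<in> SA \<Longrightarrow> X \<in> VF \<Longrightarrow> s \<in> SV \<Longrightarrow> curvature D (rho A a) X s = 0"
  using inv unfolding A_invariant_def by blast+

text \<open>Derivations in the symmetric arguments do not touch the vector fields, so d passes
  through them by additivity; what remains is that d commutes with L along rho(a).\<close>

lemma form_ce_diff:
  assumes \<alpha>s: "\<alpha>s \<in> tuples l SA" and \<beta>s: "\<beta>s \<in> tuples k SA"
    and form: "\<And>as bs l'. l = Suc l' \<Longrightarrow> as \<in> tuples l' SA \<Longrightarrow> bs \<in> tuples k SA \<Longrightarrow> form n (F as bs)"
  shows "form n (ce_diff A DA F \<alpha>s \<beta>s)"
    and "Xs \<in> tuples (Suc n) VF \<Longrightarrow> rec_d D Xs (ce_diff A DA F \<alpha>s \<beta>s)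
      = ce_diff A DA (\<lambda>as bs Zs. rec_d D Zs (F as bs)) \<alpha>s \<beta>s Xs"
proof -
  \<comment> \<open>\<open>lie_A\<close> is stated value by value, while d acts on whole forms. This
    is L^A_a of \<open>F as\<close> as a form in \<open>Xs\<close>, with \<open>lie_vf\<close> in
    place of \<open>DA\<close>; the two agree on tuples of vector fields.\<close>
  define \<Omega> where "\<Omega> a as = lie_vf D (rho A a) (F as \<beta>s) - deriv_sum (bracket A a) (F as) \<beta>s" for a as
  define \<Theta> where "\<Theta> = alt_pick_sum \<Omega> \<alpha>s + alt_pair_sum (\<lambda>a b as. F (bracket A a b # as) \<beta>s) \<alpha>s"
  have hom0: "hom_on {\<omega>. form n \<omega>} (\<lambda>\<omega>. \<omega>)"
    using form_0[of n] form_diff[of n]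
    unfolding hom_on_def zero_fun_def[where 'b = "'m \<Rightarrow> 'v"] fun_diff_def[where 'b = "'m \<Rightarrow> 'v"] by blast
  have eq: "\<Theta> Zs = ce_diff A DA F \<alpha>s \<beta>s Zs" if Zs: "Zs \<in> tuples n VF" for Zs
  proof -
    have "alt_pick_sum (\<lambda>a as. \<Omega> a as Zs) \<alpha>s = alt_pick_sum (\<lambda>a as. lie_A A DA a (F as) \<beta>s Zs) \<alpha>s"
    proof (rule alt_pick_sum_cong[OF \<alpha>s])
      fix a as m assume m: "l = Suc m" "a \<in> SA" "as \<in> tuples m SA"
      show "\<Omega> a as Zs = lie_A A DA a (F as) \<beta>s Zs"
        using lie_A_eq_lie_vf[of a "F as" \<beta>s Zs] DA_eq[OF m(2) form_value[OF form[OF m(1,3) \<beta>s] Zs]]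
        by (simp add: \<Omega>_def minus_apply deriv_sum_apply)
    qed
    then show ?thesis
      by (simp add: \<Theta>_def ce_diff_def plus_fun_apply alt_pick_sum_apply alt_pair_sum_apply)
  qed
  have lie: "form n (lie_vf D (rho A a) (F as \<beta>s))"
    if m: "l = Suc m" "a \<in> SA" "as \<in> tuples m SA" for a as m
    by (intro form_lie_vf rho_VF form[OF m(1,3) \<beta>s] m)
  have ds: "form n (deriv_sum (bracket A a) (F as) \<beta>s)"
    if m: "l = Suc m" "a \<in> SA" "as \<in> tuples m SA" for a as m
    using hom_on_deriv_sum(1)[OF hom0 \<beta>s, of "bracket A a" "F as"] bracket_SA[OF m(2)] form[OF m(1,3)]
    by simp
  have \<Omega>: "form n (\<Omega> a as)" if m: "l = Suc m" "a \<in> SA" "as \<in> tuples m SA" for a as m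
    using hom_on_diff(1)[OF hom0, of "lie_vf D (rho A a) (F as \<beta>s)"] lie[OF m] ds[OF m] by (simp add: \<Omega>_def)
  have pair: "form n (F (bracket A a b # as) \<beta>s)"
    if "l = Suc (Suc m)" "a \<in> SA" "b \<in> SA" "as \<in> tuples m SA" for a b as m
    using form[OF that(1) _ \<beta>s, of "bracket A a b # as"] that bracket_SA by simp
  have 1: "alt_pick_sum \<Omega> \<alpha>s \<in> {\<omega>. form n \<omega>}"
    by (rule hom_on_alt_pick_sum(1)[OF hom0 \<alpha>s]) (use \<Omega> in auto)
  have 2: "alt_pair_sum (\<lambda>a b as. F (bracket A a b # as) \<beta>s) \<alpha>s \<in> {\<omega>. form n \<omega>}"
    by (rule hom_on_alt_pair_sum(1)[OF hom0 \<alpha>s]) (use pair in auto)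
  have "form n \<Theta>"
    using hom_on_add(1)[OF hom0 1 2] by (simp add: \<Theta>_def)
  then show "form n (ce_diff A DA F \<alpha>s \<beta>s)"
    by (rule form_cong) (rule eq)
  assume Xs: "Xs \<in> tuples (Suc n) VF"
  note h = hom_on_rec_d[OF Xs]
  have "rec_d D Xs (ce_diff A DA F \<alpha>s \<beta>s) = rec_d D Xs \<Theta>"
    by (rule rec_d_cong[OF Xs]) (simp add: eq)
  also have "\<dots> = rec_d D Xs (alt_pick_sum \<Omega> \<alpha>s)
      + rec_d D Xs (alt_pair_sum (\<lambda>a b as. F (bracket A a b # as) \<beta>s) \<alpha>s)"
    unfolding \<Theta>_def by (rule hom_on_add(2)[OF h 1 2])
  also have "rec_d D Xs (alt_pair_sum (\<lambda>a b as. F (bracket A a b # as) \<beta>s) \<alpha>s)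
      = alt_pair_sum (\<lambda>a b as. rec_d D Xs (F (bracket A a b # as) \<beta>s)) \<alpha>s"
    by (rule hom_on_alt_pair_sum(2)[OF h \<alpha>s]) (use pair in auto)
  also have "rec_d D Xs (alt_pick_sum \<Omega> \<alpha>s) = alt_pick_sum (\<lambda>a as. rec_d D Xs (\<Omega> a as)) \<alpha>s"
    by (rule hom_on_alt_pick_sum(2)[OF h \<alpha>s]) (use \<Omega> in auto)
  also have "\<dots> = alt_pick_sum (\<lambda>a as. lie_A A DA a (\<lambda>bs Zs. rec_d D Zs (F as bs)) \<beta>s Xs) \<alpha>s"
  proof (rule alt_pick_sum_cong[OF \<alpha>s])
    fix a as m assume m: "l = Suc m" "a \<in> SA" "as \<in> tuples m SA"
    have "rec_d D Xs (\<Omega> a as) = rec_d D Xs (lie_vf D (rho A a) (F as \<beta>s))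
        - rec_d D Xs (deriv_sum (bracket A a) (F as) \<beta>s)"
      unfolding \<Omega>_def by (rule hom_on_diff(2)[OF h]) (simp_all add: lie[OF m] ds[OF m])
    also have "rec_d D Xs (deriv_sum (bracket A a) (F as) \<beta>s)
        = deriv_sum (bracket A a) (\<lambda>bs. rec_d D Xs (F as bs)) \<beta>s"
      by (rule hom_on_deriv_sum(2)[OF h \<beta>s]) (simp_all add: bracket_SA m form[OF m(1,3)])
    also have "rec_d D Xs (lie_vf D (rho A a) (F as \<beta>s))
        = lie_vf D (rho A a) (\<lambda>Zs. rec_d D Zs (F as \<beta>s)) Xs"
      \<comment> \<open>Here the curvature condition enters.\<close>
      by (rule lie_vf_rec_d[symmetric, OF rho_VF[OF m(2)] curv[OF m(2)] Xs form[OF m(1,3) \<beta>s]])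
    finally show "rec_d D Xs (\<Omega> a as) = lie_A A DA a (\<lambda>bs Zs. rec_d D Zs (F as bs)) \<beta>s Xs"
      using lie_A_eq_lie_vf[of a "\<lambda>bs Zs. rec_d D Zs (F as bs)" \<beta>s Xs]
        DA_eq[OF m(2) form_value[OF form_rec_d[OF form[OF m(1,3) \<beta>s]] Xs]] by simp
  qed
  finally show "rec_d D Xs (ce_diff A DA F \<alpha>s \<beta>s)
      = ce_diff A DA (\<lambda>as bs Zs. rec_d D Zs (F as bs)) \<alpha>s \<beta>s Xs"
    by (simp only: ce_diff_def[of A DA "\<lambda>as bs Zs. rec_d D Zs (F as bs)"])
qed

end

section \<open>Weil cochains: degrees and symmetries\<close>

lemma weil_form:
  assumes "c \<in> weil M A V p q" "k \<le> p" "as \<in> tuples (p - k) SA" "bs \<in> tuples k SA"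
  shows "form (q - k) (c k as bs)"
proof (cases "k \<le> q")
  case True
  then have "c k as \<in> sforms M A V (q - k) k"
    using assms unfolding weil_def by blast
  then show ?thesis
    using assms(4) unfolding sforms_def form_iff by blast
next
  \<comment> \<open>Now \<open>q - k\<close> is truncated to 0; the component vanishes, and the zero
    map is a form of degree 0.\<close>
  case False
  then have "c k as bs Xs = 0" for Xs
    using assms(1) unfolding weil_def weil_dom_def by blast
  then show ?thesis using form_0[of "q - k"] by (metis form_cong)
qed

lemma weil_alpha:
  assumes "c \<in> weil M A V p q"
  shows "p - k = Suc m \<Longrightarrow> a \<in> SA \<Longrightarrow> as \<in> tuples m SA \<Longrightarrow> c k (- a # as) bs Xs = - c k (a # as) bs Xs"
    and "p - k = Suc (Suc m) \<Longrightarrow> a \<in> SA \<Longrightarrow> b \<in> SA \<Longrightarrow> as \<in> tuples m SA \<Longrightarrow>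
      c k (b # a # as) bs Xs = - c k (a # b # as) bs Xs"
proof -
  have ml: "multilinear (range (\<lambda>r x. r)) smul SA (p - k) (\<lambda>as. c k as bs Xs)"
    and alt: "alternating SA (p - k) (\<lambda>as. c k as bs Xs)" for bs Xs
    using assms unfolding weil_def by blast+
  have add: "c k (as[i := y + z]) bs Xs = c k (as[i := y]) bs Xs + c k (as[i := z]) bs Xs"
    if "as \<in> tuples (p - k) SA" "i < p - k" "y \<in> SA" "z \<in> SA" for as i y z
    using ml that unfolding multilinear_def by blast
  have scale: "c k (as[i := smul f y]) bs Xs = smul f (c k (as[i := y]) bs Xs)"
    if "as \<in> tuples (p - k) SA" "i < p - k" "y \<in> SA" "f \<in> range (\<lambda>r x. r)" for as i y f
    using ml that unfolding multilinear_def by blast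
  show "c k (- a # as) bs Xs = - c k (a # as) bs Xs"
    if "p - k = Suc m" "a \<in> SA" "as \<in> tuples m SA"
  proof -
    \<comment> \<open>In the alternating arguments a cochain is linear only over the reals, so the
      scalar -1 has to be recognized as a constant function.\<close>
    have "(\<lambda>x. -1) \<in> range (\<lambda>(r::real) (x::'m). r)" by blast
    then show ?thesis
      using scale[of "a # as" 0 a "\<lambda>x. -1"] that by (simp add: smul_minus_1)
  qed
  show "c k (b # a # as) bs Xs = - c k (a # b # as) bs Xs"
    if m: "p - k = Suc (Suc m)" "a \<in> SA" "b \<in> SA" "as \<in> tuples m SA"
  proof -
    have ab: "a + b \<in> SA" using sections_add[OF man abun m(2,3)] .
    have z: "c k (x # x # as) bs Xs = 0" if "x \<in> SA" for x
      using alt[of bs Xs] m that unfolding alternating_def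
      by (elim ballE[of _ _ "x # x # as"] allE[of _ 0] allE[of _ "Suc 0"]) auto
    have "c k ((a + b) # (a + b) # as) bs Xs = c k (a # (a + b) # as) bs Xs + c k (b # (a + b) # as) bs Xs"
      using add[of "a # (a + b) # as" 0 a b] m ab by simp
    moreover have "c k (x # (a + b) # as) bs Xs = c k (x # a # as) bs Xs + c k (x # b # as) bs Xs"
      if "x \<in> SA" for x
      using add[of "x # a # as" 1 a b] m that by simp
    ultimately have "c k (a # b # as) bs Xs + c k (b # a # as) bs Xs = 0"
      using z m ab by simp
    then show ?thesis by (simp add: eq_neg_iff_add_eq_0 add.commute)
  qed
qed

lemma weil_beta:
  assumes c: "c \<in> weil M A V p q" and k: "k \<le> p" "k \<le> q"
    and as: "as \<in> tuples (p - k) SA" and Xs: "Xs \<in> tuples (q - k) VF"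
  shows "bs \<in> tuples k SA \<Longrightarrow> bs' \<in> tuples k SA \<Longrightarrow> mset bs = mset bs' \<Longrightarrow> c k as bs Xs = c k as bs' Xs"
    and "k = Suc k' \<Longrightarrow> b \<in> SA \<Longrightarrow> bs \<in> tuples k' SA \<Longrightarrow> c k as (- b # bs) Xs = - c k as (b # bs) Xs"
proof -
  have "c k as \<in> sforms M A V (q - k) k"
    using c k as unfolding weil_def by blast
  then have ml: "multilinear (smooth_funs M) smul SA k (\<lambda>bs. c k as bs Xs)"
    and sy: "symmetric SA k (\<lambda>bs. c k as bs Xs)"
    using Xs unfolding sforms_def by blast+
  show "c k as bs Xs = c k as bs' Xs"
    if "bs \<in> tuples k SA" "bs' \<in> tuples k SA" "mset bs = mset bs'"
    using sy that unfolding symmetric_def by blast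
  have scale: "c k as (bs[i := smul f y]) Xs = smul f (c k as (bs[i := y]) Xs)"
    if "bs \<in> tuples k SA" "i < k" "y \<in> SA" "f \<in> CF" for bs i y f
    using ml that unfolding multilinear_def by blast
  show "c k as (- b # bs) Xs = - c k as (b # bs) Xs"
    if b: "k = Suc k'" "b \<in> SA" "bs \<in> tuples k' SA"
  proof -
    show ?thesis
      using scale[of "b # bs" 0 b "\<lambda>x. -1"] b smooth_funs_const[OF man, of "-1"]
      by (simp add: smul_minus_1)
  qed
qed

text \<open>Truncated degrees included: for k > q there are no vector fields and both derivatives
  are 0.\<close>

lemma ext_d_eq_rec_d':
  assumes "Xs \<in> tuples (q + 1 - k) VF" "form (q - k) \<omega>"
  shows "ext_d D \<omega> Xs = rec_d D Xs \<omega>"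
proof (cases Xs)
  case (Cons X Ys)
  then have "q + 1 - k = Suc (q - k)" using assms(1) by (cases "q + 1 - k") auto
  then show ?thesis using ext_d_eq_rec_d assms by metis
qed simp

lemma rec_d_SV:
  assumes "Xs \<in> tuples (q + 1 - k) VF" "form (q - k) \<omega>"
  shows "rec_d D Xs \<omega> \<in> SV"
proof (cases Xs)
  case (Cons X Ys)
  then have "q + 1 - k = Suc (q - k)" using assms(1) by (cases "q + 1 - k") auto
  then show ?thesis using form_value[OF form_rec_d[OF assms(2)]] assms(1) by metis
qed (simp add: SV_0)

section \<open>The two composites of the differentials\<close>

lemma hom_on_id: "hom_on SV (\<lambda>s. s)"
  by (simp add: hom_on_def SV_0 SV_diff)

lemma ext_d_delta:
  assumes inv: "A_invariant M A V DA D" and c: "c \<in> weil M A V p q"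
    and dom: "weil_dom M A (p + 1) (q + 1) k \<alpha>s \<beta>s Xs"
  shows "ext_d D (delta M A DA p q c k \<alpha>s \<beta>s) Xs
    = sign_pow k (ce_diff A DA (\<lambda>as bs Zs. rec_d D Zs (c k as bs)) \<alpha>s \<beta>s Xs
      - pick_sum (\<lambda>b bs. rec_d D Xs (\<lambda>Zs. c (k - 1) \<alpha>s bs (rho A b # Zs))) \<beta>s)"
proof -
  have kp: "k \<le> p + 1" and kq: "k \<le> q + 1" and \<alpha>s: "\<alpha>s \<in> tuples (p + 1 - k) SA"
    and \<beta>s: "\<beta>s \<in> tuples k SA" and Xs: "Xs \<in> tuples (q + 1 - k) VF"
    using dom by (auto simp: weil_dom_def)
  show ?thesis
  proof (cases Xs)
    \<comment> \<open>This is k = q + 1, where both sides vanish.\<close>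
    case Nil
    have "ce_diff A DA (\<lambda>as bs Zs. rec_d D Zs (c k as bs)) \<alpha>s \<beta>s Xs
      = ce_diff A DA (\<lambda>as bs Zs. 0) \<alpha>s \<beta>s Xs"
      by (rule ce_diff_cong[OF \<alpha>s \<beta>s Xs]) (use Xs Nil in auto)
    then show ?thesis
      using Nil ce_diff_0[OF \<alpha>s] by (simp add: sign_pow_simps)
  next
    case (Cons X Ys)
    define n where "n = q - k"
    have n: "q + 1 - k = Suc n" "k \<le> q" using Xs Cons kq by (cases "q + 1 - k"; auto simp: n_def)+
    define \<omega> where "\<omega> = ce_diff A DA (c k) \<alpha>s \<beta>s"
    define \<eta> where "\<eta> b bs = (\<lambda>Zs. c (k - 1) \<alpha>s bs (rho A b # Zs))" for b bs
    note Xs' = Xs[unfolded n(1)]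
    note h = hom_on_rec_d[OF Xs']
    have form_c: "form n (c k as bs)"
      if "p + 1 - k = Suc l'" "as \<in> tuples l' SA" "bs \<in> tuples k SA" for as bs l'
    proof -
      from that(1) have "l' = p - k" "k \<le> p" by auto
      with weil_form[OF c, of k as bs] that show ?thesis by (simp add: n_def)
    qed
    have \<omega>: "form n \<omega>" "rec_d D Xs \<omega> = ce_diff A DA (\<lambda>as bs Zs. rec_d D Zs (c k as bs)) \<alpha>s \<beta>s Xs"
      using form_ce_diff[OF inv \<alpha>s \<beta>s form_c] Xs' by (auto simp: \<omega>_def)
    have \<eta>: "\<eta> b bs \<in> {\<omega>. form n \<omega>}" if "k = Suc m" "b \<in> SA" "bs \<in> tuples m SA" for b bs m
    proof -
      from that(1) n kp have "q - m = Suc n" "p - m = p + 1 - k" "m \<le> p" by auto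
      with weil_form[OF c _ _ that(3), of \<alpha>s] \<alpha>s have "form (Suc n) (c m \<alpha>s bs)" by metis
      from form_contract[OF this rho_VF[OF that(2)]] show ?thesis by (simp add: \<eta>_def that(1))
    qed
    have P: "pick_sum \<eta> \<beta>s \<in> {\<omega>. form n \<omega>}" "rec_d D Xs (pick_sum \<eta> \<beta>s) = pick_sum (\<lambda>b bs. rec_d D Xs (\<eta> b bs)) \<beta>s"
      by (rule hom_on_pick_sum[OF h \<beta>s], erule (2) \<eta>)+
    have "ext_d D (delta M A DA p q c k \<alpha>s \<beta>s) Xs = ext_d D (sign_pow k (\<omega> - pick_sum \<eta> \<beta>s)) Xs"
    \<comment> \<open>\<open>delta_eq\<close> holds only inside \<open>weil_dom\<close>, so
      \<open>delta\<close> is replaced under \<open>ext_d\<close> on tuples only. This yields a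
      combination of genuine forms, on which \<open>rec_d\<close> is additive.\<close>
    proof (rule ext_d_cong[OF Xs'])
      fix Zs m assume "Suc n = Suc m" "Zs \<in> tuples m VF"
      then have "weil_dom M A (p + 1) q k \<alpha>s \<beta>s Zs"
        using kp n(2) \<alpha>s \<beta>s by (simp add: weil_dom_def n_def)
      then show "delta M A DA p q c k \<alpha>s \<beta>s Zs = sign_pow k (\<omega> - pick_sum \<eta> \<beta>s) Zs"
        by (simp only: delta_eq sign_pow_apply minus_apply pick_sum_apply \<omega>_def \<eta>_def)
    qed
    also have "\<dots> = rec_d D Xs (sign_pow k (\<omega> - pick_sum \<eta> \<beta>s))"
      using hom_on_sign_pow(1)[OF h hom_on_diff(1)[OF h _ P(1)], of \<omega> k] \<omega>(1)
      by (intro ext_d_eq_rec_d[OF Xs']) simp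
    also have "\<dots> = sign_pow k (rec_d D Xs \<omega> - pick_sum (\<lambda>b bs. rec_d D Xs (\<eta> b bs)) \<beta>s)"
      using hom_on_sign_pow(2)[OF h hom_on_diff(1)[OF h _ P(1)], of \<omega> k] hom_on_diff(2)[OF h _ P(1), of \<omega>] \<omega>(1) P(2)
      by simp
    finally show ?thesis by (simp add: \<omega>(2) \<eta>_def)
  qed
qed

text \<open>The Chevalley-Eilenberg part keeps the index \<open>k\<close>, so the sign of component
  \<open>k\<close> factors out. Splitting the difference requires both parts to be sections, because
  of the term with \<open>DA\<close>.\<close>

lemma ce_diff_cov_d:
  assumes c: "c \<in> weil M A V p q" and dom: "weil_dom M A (p + 1) (q + 1) k \<alpha>s \<beta>s Xs"
  shows "ce_diff A DA (cov_d M A D p q c k) \<alpha>s \<beta>s Xs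
    = sign_pow k (ce_diff A DA (\<lambda>as bs Zs. rec_d D Zs (c k as bs)) \<alpha>s \<beta>s Xs
      - ce_diff A DA (\<lambda>as bs Zs. pick_sum (\<lambda>b bs. c (k - 1) (b # as) bs Zs) bs) \<alpha>s \<beta>s Xs)"
proof -
  have kp: "k \<le> p + 1" and kq: "k \<le> q + 1" and \<alpha>s: "\<alpha>s \<in> tuples (p + 1 - k) SA"
    and \<beta>s: "\<beta>s \<in> tuples k SA" and Xs: "Xs \<in> tuples (q + 1 - k) VF"
    using dom by (auto simp: weil_dom_def)
  have 1: "ce_diff A DA (cov_d M A D p q c k) \<alpha>s \<beta>s Xs = ce_diff A DA (\<lambda>as bs Zs. sign_pow k
      (rec_d D Zs (c k as bs) - pick_sum (\<lambda>b bs. c (k - 1) (b # as) bs Zs) bs)) \<alpha>s \<beta>s Xs"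
  proof (rule ce_diff_cong[OF \<alpha>s \<beta>s Xs])
    fix m as bs Zs
    assume m: "p + 1 - k = Suc m" "as \<in> tuples m SA" "bs \<in> tuples k SA" "Zs \<in> tuples (q + 1 - k) VF"
    then have k: "k \<le> p" and "m = p - k" by auto
    with m(2) have as: "as \<in> tuples (p - k) SA" by simp
    have "weil_dom M A p (q + 1) k as bs Zs"
      using m k as kq by (simp add: weil_dom_def)
    then show "cov_d M A D p q c k as bs Zs = sign_pow k
        (rec_d D Zs (c k as bs) - pick_sum (\<lambda>b bs. c (k - 1) (b # as) bs Zs) bs)"
      by (simp only: cov_d_eq ext_d_eq_rec_d'[OF m(4) weil_form[OF c k as m(3)]])
  qed
  have 2: "ce_diff A DA (\<lambda>as bs Zs. sign_pow k
        (rec_d D Zs (c k as bs) - pick_sum (\<lambda>b bs. c (k - 1) (b # as) bs Zs) bs)) \<alpha>s \<beta>s Xs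
      = sign_pow k (ce_diff A DA (\<lambda>as bs Zs. rec_d D Zs (c k as bs)
      - pick_sum (\<lambda>b bs. c (k - 1) (b # as) bs Zs) bs) \<alpha>s \<beta>s Xs)"
    and 3: "ce_diff A DA (\<lambda>as bs Zs. rec_d D Zs (c k as bs)
      - pick_sum (\<lambda>b bs. c (k - 1) (b # as) bs Zs) bs) \<alpha>s \<beta>s Xs
    = ce_diff A DA (\<lambda>as bs Zs. rec_d D Zs (c k as bs)) \<alpha>s \<beta>s Xs
      - ce_diff A DA (\<lambda>as bs Zs. pick_sum (\<lambda>b bs. c (k - 1) (b # as) bs Zs) bs) \<alpha>s \<beta>s Xs"
  proof -
    have val: "rec_d D Xs (c k as \<beta>s) \<in> SV" "pick_sum (\<lambda>b bs. c (k - 1) (b # as) bs Xs) \<beta>s \<in> SV"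
      if m: "p + 1 - k = Suc m" "as \<in> tuples m SA" for m as
    proof -
      have k: "k \<le> p" and "m = p - k" using m(1) by auto
      with m(2) have as: "as \<in> tuples (p - k) SA" by simp
      show "rec_d D Xs (c k as \<beta>s) \<in> SV" by (rule rec_d_SV[OF Xs weil_form[OF c k as \<beta>s]])
      show "pick_sum (\<lambda>b bs. c (k - 1) (b # as) bs Xs) \<beta>s \<in> SV"
      proof (rule hom_on_pick_sum(1)[OF hom_on_id \<beta>s])
        fix b bs k' assume k': "k = Suc k'" "b \<in> SA" "bs \<in> tuples k' SA"
        have "form (q - k') (c k' (b # as) bs)"
          by (rule weil_form[OF c]) (use k k' m kq in \<open>auto simp: Suc_diff_le\<close>)
        then show "c (k - 1) (b # as) bs Xs \<in> SV"
          using form_value Xs k' by auto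
      qed
    qed
    then show "ce_diff A DA (\<lambda>as bs Zs. sign_pow k
        (rec_d D Zs (c k as bs) - pick_sum (\<lambda>b bs. c (k - 1) (b # as) bs Zs) bs)) \<alpha>s \<beta>s Xs
      = sign_pow k (ce_diff A DA (\<lambda>as bs Zs. rec_d D Zs (c k as bs)
      - pick_sum (\<lambda>b bs. c (k - 1) (b # as) bs Zs) bs) \<alpha>s \<beta>s Xs)"
      by (intro ce_diff_sign_pow[OF \<alpha>s] SV_diff)
    show "ce_diff A DA (\<lambda>as bs Zs. rec_d D Zs (c k as bs)
      - pick_sum (\<lambda>b bs. c (k - 1) (b # as) bs Zs) bs) \<alpha>s \<beta>s Xs
    = ce_diff A DA (\<lambda>as bs Zs. rec_d D Zs (c k as bs)) \<alpha>s \<beta>s Xs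
      - ce_diff A DA (\<lambda>as bs Zs. pick_sum (\<lambda>b bs. c (k - 1) (b # as) bs Zs) bs) \<alpha>s \<beta>s Xs"
      by (intro ce_diff_diff[OF \<alpha>s] conjI val)
  qed
  show ?thesis unfolding 1 2 3 ..
qed

lemma cov_d_delta_commute:
  assumes inv: "A_invariant M A V DA D" and c: "c \<in> weil M A V p q"
  shows "cov_d M A D (p + 1) q (delta M A DA p q c) = delta M A DA p (q + 1) (cov_d M A D p q c)"
proof -
  have "cov_d M A D (p + 1) q (delta M A DA p q c) k \<alpha>s \<beta>s Xs
    = delta M A DA p (q + 1) (cov_d M A D p q c) k \<alpha>s \<beta>s Xs" for k \<alpha>s \<beta>s Xs
  proof (cases "weil_dom M A (p + 1) (q + 1) k \<alpha>s \<beta>s Xs")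
    case False
    then show ?thesis by (simp add: cov_d_def delta_def)
  next
    case True
    have kp: "k \<le> p + 1" and kq: "k \<le> q + 1" and \<alpha>s: "\<alpha>s \<in> tuples (p + 1 - k) SA"
      and \<beta>s: "\<beta>s \<in> tuples k SA" and Xs: "Xs \<in> tuples (q + 1 - k) VF"
      using True by (auto simp: weil_dom_def)
    \<comment> \<open>One composite expands to E - R + C - PP and the other to E - S + L - R - PP,
      so that C + S = L is what remains. For k = 0 the list \<beta>s is empty and no term with the
      truncated \<open>k - 1\<close> occurs; in the same way the inner sum of \<open>PP\<close> is
      empty for k = 1.\<close>
    let ?G = "c (k - 1)" and ?H = "c (k - 1 - 1)"
    define E where "E = ce_diff A DA (\<lambda>as bs Zs. rec_d D Zs (c k as bs)) \<alpha>s \<beta>s Xs"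
    define S where "S = ce_diff A DA (\<lambda>as bs Zs. pick_sum (\<lambda>b bs. ?G (b # as) bs Zs) bs) \<alpha>s \<beta>s Xs"
    define R where "R = pick_sum (\<lambda>b bs. rec_d D Xs (\<lambda>Zs. ?G \<alpha>s bs (rho A b # Zs))) \<beta>s"
    define C where "C = pick_sum (\<lambda>b bs. ce_diff A DA ?G (b # \<alpha>s) bs Xs) \<beta>s"
    define L where "L = pick_sum (\<lambda>b bs. lie_vf D (rho A b) (?G \<alpha>s bs) Xs) \<beta>s"
    define PP where "PP = pick_sum (\<lambda>b bs. pick_sum (\<lambda>b' bs'. ?H (b # \<alpha>s) bs' (rho A b' # Xs)) bs) \<beta>s"
    have k': "m \<le> p" "m \<le> q" "p - m = p + 1 - k" "q - m = q + 1 - k" if "k = Suc m" for m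
      using that kp kq by auto
    have T: "C + S = L"
      unfolding C_def S_def L_def
    proof (rule ce_diff_pick_sum[OF DA_eq[OF inv] \<alpha>s \<beta>s Xs])
      fix as bs m assume m: "k = Suc m" and *: "as \<in> tuples (p + 1 - k) SA" "bs \<in> tuples m SA"
      then show "?G as bs Xs \<in> SV"
        using form_value[OF weil_form[OF c k'(1)[OF m]], of as bs Xs] m Xs by simp
    next
      fix a b as bs m l
      assume m: "k = Suc m" and "p + 1 - k = Suc (Suc l)" "a \<in> SA" "b \<in> SA" "as \<in> tuples l SA" "bs \<in> tuples m SA"
      then show "?G (b # a # as) bs Xs = - ?G (a # b # as) bs Xs"
        using weil_alpha(2)[OF c, of m l a b as bs Xs] m by simp
    next
      fix a as bs m l
      assume m: "k = Suc m" and "p + 1 - k = Suc l" "a \<in> SA" "as \<in> tuples l SA" "bs \<in> tuples m SA"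
      then show "?G (- a # as) bs Xs = - ?G (a # as) bs Xs"
        using weil_alpha(1)[OF c, of m l a as bs Xs] m by simp
    next
      fix bs bs' m
      assume m: "k = Suc m" and "bs \<in> tuples m SA" "bs' \<in> tuples m SA" "mset bs = mset bs'"
      then show "?G \<alpha>s bs Xs = ?G \<alpha>s bs' Xs"
        using weil_beta(1)[OF c k'(1,2)[OF m], where bs = bs and bs' = bs'] m \<alpha>s Xs by simp
    next
      fix b bs l
      assume m: "k = Suc (Suc l)" and "b \<in> SA" "bs \<in> tuples l SA"
      then show "?G \<alpha>s (- b # bs) Xs = - ?G \<alpha>s (b # bs) Xs"
        using weil_beta(2)[OF c k'(1,2)[OF m], where b = b and bs = bs] m \<alpha>s Xs by simp
    qed
    \<comment> \<open>Component \<open>k - 1\<close> carries the sign opposite to that of component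
      \<open>k\<close>, whence the minus.\<close>
    have "pick_sum (\<lambda>b bs. delta M A DA p q c (k - 1) (b # \<alpha>s) bs Xs) \<beta>s
      = pick_sum (\<lambda>b bs. - sign_pow k (ce_diff A DA ?G (b # \<alpha>s) bs Xs
        - pick_sum (\<lambda>b' bs'. ?H (b # \<alpha>s) bs' (rho A b' # Xs)) bs)) \<beta>s"
    proof (rule pick_sum_cong[OF \<beta>s])
      fix b bs m assume m: "k = Suc m" "b \<in> SA" "bs \<in> tuples m SA"
      have "weil_dom M A (p + 1) q m (b # \<alpha>s) bs Xs"
        using k'(1,2)[OF m(1)] m \<alpha>s Xs by (simp add: weil_dom_def Suc_diff_le)
      then show "delta M A DA p q c (k - 1) (b # \<alpha>s) bs Xs = - sign_pow k (ce_diff A DA ?G (b # \<alpha>s) bs Xs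
        - pick_sum (\<lambda>b' bs'. ?H (b # \<alpha>s) bs' (rho A b' # Xs)) bs)"
        using delta_eq[of M A p q m "b # \<alpha>s" bs Xs DA c] m(1) by (simp add: sign_pow_simps)
    qed
    then have 1: "cov_d M A D (p + 1) q (delta M A DA p q c) k \<alpha>s \<beta>s Xs = E - R + (C - PP)"
      using cov_d_eq[OF True, of D "delta M A DA p q c"] ext_d_delta[OF inv c True]
      by (simp add: pick_sum_minus pick_sum_sign_pow pick_sum_diff sign_pow_simps
          E_def R_def C_def PP_def)
    have "pick_sum (\<lambda>b bs. cov_d M A D p q c (k - 1) \<alpha>s bs (rho A b # Xs)) \<beta>s
      = pick_sum (\<lambda>b bs. - sign_pow k (lie_vf D (rho A b) (?G \<alpha>s bs) Xs
        - rec_d D Xs (\<lambda>Zs. ?G \<alpha>s bs (rho A b # Zs))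
        - pick_sum (\<lambda>b' bs'. ?H (b' # \<alpha>s) bs' (rho A b # Xs)) bs)) \<beta>s"
    proof (rule pick_sum_cong[OF \<beta>s])
      fix b bs m assume m: "k = Suc m" "b \<in> SA" "bs \<in> tuples m SA"
      have dom: "weil_dom M A p (q + 1) m \<alpha>s bs (rho A b # Xs)"
        using k'(1,2)[OF m(1)] m \<alpha>s Xs rho_VF by (simp add: weil_dom_def Suc_diff_le)
      then have "ext_d D (c m \<alpha>s bs) (rho A b # Xs) = rec_d D (rho A b # Xs) (c m \<alpha>s bs)"
        using weil_form[OF c k'(1)[OF m(1)] _ m(3), of \<alpha>s]
        by (intro ext_d_eq_rec_d'[of _ q m]) (auto simp: weil_dom_def)
      then show "cov_d M A D p q c (k - 1) \<alpha>s bs (rho A b # Xs)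
        = - sign_pow k (lie_vf D (rho A b) (?G \<alpha>s bs) Xs
        - rec_d D Xs (\<lambda>Zs. ?G \<alpha>s bs (rho A b # Zs))
        - pick_sum (\<lambda>b' bs'. ?H (b' # \<alpha>s) bs' (rho A b # Xs)) bs)"
        using cov_d_eq[OF dom, of D c] m(1) by (simp add: sign_pow_simps)
    qed
    \<comment> \<open>One composite picks first the argument to insert and then the one to contract
      with; the other picks them in the opposite order.\<close>
    moreover have "pick_sum (\<lambda>b bs. pick_sum (\<lambda>b' bs'. ?H (b' # \<alpha>s) bs' (rho A b # Xs)) bs) \<beta>s = PP"
      unfolding PP_def by (rule pick_sum_swap)
    ultimately have 2: "delta M A DA p (q + 1) (cov_d M A D p q c) k \<alpha>s \<beta>s Xs = E - S + (L - R - PP)"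
      using delta_eq[OF True, of DA "cov_d M A D p q c"] ce_diff_cov_d[OF c True]
      by (simp add: pick_sum_minus pick_sum_sign_pow pick_sum_diff sign_pow_simps
          E_def R_def S_def L_def)
    show ?thesis
      unfolding 1 2 T[symmetric] by (simp add: algebra_simps)
  qed
  then show ?thesis by (intro ext) simp
qed

section \<open>The converse: testing on sections\<close>

lemma invariant_of_commute:
  assumes comm: "\<And>c. c \<in> weil M A V 0 0 \<Longrightarrow>
    cov_d M A D 1 0 (delta M A DA 0 0 c) = delta M A DA 0 1 (cov_d M A D 0 0 c)"
  shows "A_invariant M A V DA D"
proof -
  have "DA \<alpha> s = D (rho A \<alpha>) s \<and> DA \<alpha> (D X s) - D (vf_bracket (rho A \<alpha>) X) s = D X (DA \<alpha> s)"
    if \<alpha>: "\<alpha> \<in> SA" and s: "s \<in> SV" and X: "X \<in> VF" for \<alpha> s X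
  proof -
    \<comment> \<open>The section \<open>s\<close> as a cochain of bidegree (0, 0), extended by 0 as
      \<open>weil\<close> demands.\<close>
    define c :: "('m, 'a, 'v) wcochain"
      where "c k \<alpha>s \<beta>s Xs = (if k = 0 \<and> \<alpha>s = [] \<and> \<beta>s = [] \<and> Xs = [] then s else 0)" for k \<alpha>s \<beta>s Xs
    have "c \<in> weil M A V 0 0"
      by (auto simp: c_def weil_def weil_dom_def sforms_def multilinear_def alternating_def symmetric_def s)
    note eq = comm[OF this]
    have cov: "cov_d M A D 0 0 c 0 [] [] [Y] = D Y s" if "Y \<in> VF" for Y
      using that by (subst cov_d_eq) (simp_all add: weil_dom_def ext_d_alt c_def sign_pow_simps)
    have del: "delta M A DA 0 0 c 0 [\<alpha>] [] [] = DA \<alpha> s"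
      using \<alpha> by (subst delta_eq) (simp_all add: weil_dom_def ce_diff_def lie_A_alt c_def sign_pow_simps)
    \<comment> \<open>In component 1 there are no alternating arguments and no vector fields. Only
      the insertion of \<alpha> on one side and the contraction with rho(\<alpha>) on the other
      survive, with equal signs.\<close>
    have "DA \<alpha> s = cov_d M A D 1 0 (delta M A DA 0 0 c) 1 [] [\<alpha>] []"
      using \<alpha> del cov_d_eq[of M A 1 0 1 "[]" "[\<alpha>]" "[]" D "delta M A DA 0 0 c"]
      by (simp add: weil_dom_def sign_pow_def)
    also have "\<dots> = D (rho A \<alpha>) s"
      unfolding eq using \<alpha> cov[OF rho_VF[OF \<alpha>]] delta_eq[of M A 0 1 1 "[]" "[\<alpha>]" "[]" DA "cov_d M A D 0 0 c"]
      by (simp add: weil_dom_def sign_pow_def ce_diff_def)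
    finally have 1: "DA \<alpha> s = D (rho A \<alpha>) s" .
    \<comment> \<open>In component 0 the other side is L^A along \<alpha> of the one-form sending
      \<open>X\<close> to \<open>D X s\<close>, whence the bracket term.\<close>
    have "D X (DA \<alpha> s) = cov_d M A D 1 0 (delta M A DA 0 0 c) 0 [\<alpha>] [] [X]"
      using \<alpha> X del cov_d_eq[of M A 1 0 0 "[\<alpha>]" "[]" "[X]" D "delta M A DA 0 0 c"]
      by (simp add: weil_dom_def sign_pow_def ext_d_alt)
    also have "\<dots> = DA \<alpha> (D X s) - D (vf_bracket (rho A \<alpha>) X) s"
      unfolding eq
      using \<alpha> X cov[OF X] cov[OF VF_bracket[OF rho_VF[OF \<alpha>] X]]
        delta_eq[of M A 0 1 0 "[\<alpha>]" "[]" "[X]" DA "cov_d M A D 0 0 c"]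
      by (simp add: weil_dom_def sign_pow_def ce_diff_def lie_A_alt)
    finally show ?thesis using 1 by simp
  qed
  note * = this
  show ?thesis
    unfolding A_invariant_def curvature_def
  proof (intro ballI conjI)
    fix \<alpha> s X assume \<alpha>: "\<alpha> \<in> SA" and s: "s \<in> SV"
    show "DA \<alpha> s = D (rho A \<alpha>) s"
      \<comment> \<open>The first identity does not involve \<open>X\<close>; rho(\<alpha>) serves
        as a vector field to instantiate it.\<close>
      using *[OF \<alpha> s rho_VF[OF \<alpha>]] by blast
    assume X: "X \<in> VF"
    \<comment> \<open>The first identity is applied to the section \<open>D X s\<close> as well as
      to \<open>s\<close>; this turns the second identity into vanishing curvature.\<close>
    have "D (rho A \<alpha>) (D X s) = DA \<alpha> (D X s)" "D (rho A \<alpha>) s = DA \<alpha> s"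
      using *[OF \<alpha> D_SV[OF X s] X] *[OF \<alpha> s X] by auto
    then show "D (rho A \<alpha>) (D X s) - D X (D (rho A \<alpha>) s) - D (vf_bracket (rho A \<alpha>) X) s = 0"
      using *[OF \<alpha> s X] by (simp add: diff_eq_eq)
  qed
qed

section \<open>The case p = 1 and IM forms\<close>

lemma cov_d_1:
  assumes "\<alpha> \<in> SA"
  shows "Xs \<in> tuples (q + 1) VF \<Longrightarrow> cov_d M A D 1 q c 0 [\<alpha>] [] Xs = ext_d D (c 0 [\<alpha>] []) Xs"
    and "Xs \<in> tuples q VF \<Longrightarrow> cov_d M A D 1 q c 1 [] [\<alpha>] Xs = c 0 [\<alpha>] [] Xs - ext_d D (c 1 [] [\<alpha>]) Xs"
  using assms by (simp_all add: cov_d_eq weil_dom_def sign_pow_def)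

text \<open>For q = 0 the truncated \<open>q - 1\<close> is 0 as well, and only the value on the
  empty list matters, which is 0. The same device covers the two lemmas that follow.\<close>

lemma form_rec_d':
  assumes "form (q - 1) \<omega>"
  shows "form q (\<lambda>Xs. rec_d D Xs \<omega>)"
  using form_rec_d[of "q - 1" \<omega>] assms by (cases q) (auto simp: SV_0)

lemma form_wedge_d':
  assumes "f \<in> CF" "form (q - 1) \<omega>"
  shows "form q (wedge_d f \<omega>)"
  using form_wedge_d[OF assms(1), of "q - 1" \<omega>] assms by (cases q) (auto simp: SV_0)

lemma rec_d_wedge_d':
  assumes "f \<in> CF" "Xs \<in> tuples (Suc q) VF" "form (q - 1) \<omega>"
  shows "rec_d D Xs (wedge_d f \<omega>) = - wedge_d f (\<lambda>Zs. rec_d D Zs \<omega>) Xs"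
proof (cases q)
  case 0
  then obtain X where "Xs = [X]" "X \<in> VF" using assms(2) by (auto elim: tuples_SucE)
  then show ?thesis
    using hom_on_0(2)[OF hom_on_D] by (simp add: lie_vf_Nil smul_simps)
qed (use rec_d_wedge_d[OF assms(1), of Xs "q - 1" \<omega>] assms in auto)

text \<open>An IM form is a Weil cochain killed by \<open>delta\<close>, so besides commutation the
  derivative must be shown to lie in the Weil complex again. The substance is the Leibniz identity
  and function-linearity in the symmetric argument.\<close>

lemma cov_d_weil_1:
  assumes c: "c \<in> weil M A V 1 q"
  shows "cov_d M A D 1 q c \<in> weil M A V 1 (q + 1)"
proof -
  let ?e = "cov_d M A D 1 q c"
  have f0: "form q (c 0 [a] [])" if "a \<in> SA" for a
    using weil_form[OF c, of 0 "[a]" "[]"] that by simp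
  have f1: "form (q - 1) (c 1 [] [b])" if "b \<in> SA" for b
    using weil_form[OF c, of 1 "[]" "[b]"] that by simp
  have e0: "?e 0 [a] [] Xs = rec_d D Xs (c 0 [a] [])" if "a \<in> SA" "Xs \<in> tuples (Suc q) VF" for a Xs
    using cov_d_1(1)[OF that(1), of Xs q c] ext_d_eq_rec_d[OF that(2) f0[OF that(1)]] that(2) by simp
  have e1: "?e 1 [] [b] Xs = c 0 [b] [] Xs - rec_d D Xs (c 1 [] [b])" if "b \<in> SA" "Xs \<in> tuples q VF" for b Xs
    using cov_d_1(2)[OF that, of c] ext_d_eq_rec_d'[of Xs q 1, OF _ f1[OF that(1)]] that(2) by simp
  have out: "?e k \<alpha>s \<beta>s Xs = 0" if "\<not> weil_dom M A 1 (q + 1) k \<alpha>s \<beta>s Xs" for k \<alpha>s \<beta>s Xs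
    using that by (simp add: cov_d_def)
  have ml0: "multilinear (range (\<lambda>r x. r)) smul SA (Suc 0) (\<lambda>as. c 0 as [] Xs)" for Xs
  proof -
    have "multilinear (range (\<lambda>r x. r)) smul SA (1 - 0) (\<lambda>as. c 0 as [] Xs)"
      using c unfolding weil_def by blast
    then show ?thesis by simp
  qed
  have add0: "c 0 [y + z] [] Xs = c 0 [y] [] Xs + c 0 [z] [] Xs" if "y \<in> SA" "z \<in> SA" for y z Xs
  proof -
    show ?thesis
      by (rule multilinear_1[OF ml0]) (use that in auto)
  qed
  have scale0: "c 0 [smul (\<lambda>x. r) y] [] Xs = smul (\<lambda>x. r) (c 0 [y] [] Xs)" if "y \<in> SA" for y r Xs
  proof -
    show ?thesis
      by (rule multilinear_1[OF ml0]) (use that in auto)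
  qed
  have leibniz: "c 0 [smul f y] [] Xs = smul f (c 0 [y] [] Xs) + wedge_d f (c 1 [] [y]) Xs"
    if "f \<in> CF" "y \<in> SA" "Xs \<in> tuples q VF" for f y Xs
  proof -
    have "weil_dom M A 1 q 0 [y] [] Xs" using that by (simp add: weil_dom_def)
    moreover have "weil_dom M A 1 q 0 [y] [] Xs \<Longrightarrow> c 0 [smul f y] [] Xs
        = smul f (c 0 [y] [] Xs) + wedge_d f (c (Suc 0) [] [y]) Xs"
      using c that(1) unfolding weil_def by blast
    ultimately show ?thesis by simp
  qed
  have ml1: "multilinear CF smul SA (Suc 0) (\<lambda>bs. c 1 [] bs Xs)" if "q = Suc m" "Xs \<in> tuples m VF" for Xs m
  proof -
    have "[] \<in> tuples (1 - 1) SA" "(1::nat) \<le> q" using that(1) by auto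
    then have "c 1 [] \<in> sforms M A V (q - 1) 1"
      using c unfolding weil_def by blast
    moreover have "Xs \<in> tuples (q - 1) VF" using that by simp
    ultimately show ?thesis unfolding sforms_def One_nat_def by blast
  qed
  have add1: "c 1 [] [y + z] Xs = c 1 [] [y] Xs + c 1 [] [z] Xs"
    if "y \<in> SA" "z \<in> SA" "q = Suc m" "Xs \<in> tuples m VF" for y z Xs m
    by (rule multilinear_1[OF ml1[OF that(3,4)]]) (use that(1,2) in auto)
  have scale1: "c 1 [] [smul f y] Xs = smul f (c 1 [] [y] Xs)"
    if "f \<in> CF" "y \<in> SA" "q = Suc m" "Xs \<in> tuples m VF" for f y Xs m
    by (rule multilinear_1[OF ml1[OF that(3,4)]]) (use that(1,2) in auto)
  have e_add0: "?e 0 [y + z] [] Xs = ?e 0 [y] [] Xs + ?e 0 [z] [] Xs"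
    if "y \<in> SA" "z \<in> SA" "Xs \<in> tuples (Suc q) VF" for y z Xs
    using rec_d_cong[OF that(3), of "c 0 [y + z] []" "\<lambda>Zs. c 0 [y] [] Zs + c 0 [z] [] Zs"]
      rec_d_add[OF that(3) f0[OF that(1)] f0[OF that(2)]] add0[OF that(1,2)]
      sections_add[OF man abun that(1,2)] that
    by (simp add: e0[unfolded One_nat_def])
  \<comment> \<open>d(f c_0 + df wedge c_1) = f d c_0 + df wedge (c_0 - d c_1), and the last bracket
    is component 1 of the derivative.\<close>
  have e_smul0: "?e 0 [smul f y] [] Xs = smul f (?e 0 [y] [] Xs) + wedge_d f (?e 1 [] [y]) Xs"
    if f: "f \<in> CF" and y: "y \<in> SA" and Xs: "Xs \<in> tuples (Suc q) VF" for f y Xs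
  proof -
    have fy: "smul f y \<in> SA" by (rule sections_smul[OF man abun f y])
    have "rec_d D Xs (c 0 [smul f y] []) = rec_d D Xs (\<lambda>Zs. smul f (c 0 [y] [] Zs) + wedge_d f (c 1 [] [y]) Zs)"
      by (rule rec_d_cong[OF Xs]) (use leibniz[OF f y] in auto)
    also have "\<dots> = smul f (rec_d D Xs (c 0 [y] []))
        + (wedge_d f (c 0 [y] []) Xs - wedge_d f (\<lambda>Zs. rec_d D Zs (c 1 [] [y])) Xs)"
      using rec_d_add[OF Xs form_smul[OF f f0[OF y]] form_wedge_d'[OF f f1[OF y]]]
        rec_d_smul[OF f Xs f0[OF y]] rec_d_wedge_d'[OF f Xs f1[OF y]] by simp
    also have "wedge_d f (c 0 [y] []) Xs - wedge_d f (\<lambda>Zs. rec_d D Zs (c 1 [] [y])) Xs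
      = wedge_d f (?e 1 [] [y]) Xs"
      unfolding wedge_d_hom(1)[symmetric] by (rule wedge_d_cong[OF Xs, symmetric]) (rule e1[OF y])
    finally show ?thesis
      by (simp only: e0[OF fy Xs] e0[OF y Xs])
  qed
  have e_scale0: "?e 0 [smul (\<lambda>x. r) y] [] Xs = smul (\<lambda>x. r) (?e 0 [y] [] Xs)"
    if y: "y \<in> SA" and Xs: "Xs \<in> tuples (Suc q) VF" for r y Xs
  proof -
    \<comment> \<open>Real homogeneity is the Leibniz identity for a constant function, whose
      differential vanishes.\<close>
    have "wedge_d (\<lambda>x. r) \<omega> Xs = alt_pick_sum (\<lambda>X Ys. 0) Xs" for \<omega> :: "('m, 'v) vform"
      unfolding wedge_d_alt
      by (rule alt_pick_sum_cong[OF Xs]) (simp add: vfields_const[OF man], simp add: smul_def zero_fun_def)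
    then show ?thesis
      using e_smul0[OF smooth_funs_const[OF man] y Xs] by simp
  qed
  have e_add1: "?e 1 [] [y + z] Xs = ?e 1 [] [y] Xs + ?e 1 [] [z] Xs"
    if y: "y \<in> SA" and z: "z \<in> SA" and Xs: "Xs \<in> tuples q VF" for y z Xs
  proof -
    have "rec_d D Xs (c 1 [] [y + z]) = rec_d D Xs (c 1 [] [y]) + rec_d D Xs (c 1 [] [z])"
    proof (cases q)
      case (Suc m)
      have "rec_d D Xs (c 1 [] [y + z]) = rec_d D Xs (\<lambda>Zs. c 1 [] [y] Zs + c 1 [] [z] Zs)"
        by (rule rec_d_cong[OF Xs]) (rule add1[OF y z])
      then show ?thesis
        using rec_d_add[of Xs m "c 1 [] [y]" "c 1 [] [z]"] f1[OF y] f1[OF z] Xs Suc by simp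
    qed (use Xs in simp)
    then show ?thesis
      unfolding e1[OF y Xs] e1[OF z Xs] e1[OF sections_add[OF man abun y z] Xs] add0[OF y z] by simp
  qed
  \<comment> \<open>Both c_0(f y) and d(f c_1(y)) produce df wedge c_1(y), and component 1 is their
    difference.\<close>
  have e_smul1: "?e 1 [] [smul f y] Xs = smul f (?e 1 [] [y] Xs)"
    if f: "f \<in> CF" and y: "y \<in> SA" and Xs: "Xs \<in> tuples q VF" for f y Xs
  proof -
    have "rec_d D Xs (c 1 [] [smul f y]) = smul f (rec_d D Xs (c 1 [] [y])) + wedge_d f (c 1 [] [y]) Xs"
    proof (cases q)
      case (Suc m)
      have "rec_d D Xs (c 1 [] [smul f y]) = rec_d D Xs (\<lambda>Zs. smul f (c 1 [] [y] Zs))"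
        by (rule rec_d_cong[OF Xs]) (rule scale1[OF f y])
      then show ?thesis
        using rec_d_smul[OF f, of Xs m "c 1 [] [y]"] f1[OF y] Xs Suc by simp
    qed (use Xs in \<open>simp add: smul_simps\<close>)
    then show ?thesis
      unfolding e1[OF y Xs] e1[OF sections_smul[OF man abun f y] Xs] leibniz[OF f y Xs]
      by (simp add: smul_simps)
  qed
  have form0: "form (Suc q) (?e 0 [a] [])" if "a \<in> SA" for a
    by (rule form_cong[OF form_rec_d[OF f0[OF that]]]) (simp only: e0 that)
  have form1: "form q (?e 1 [] [b])" if "b \<in> SA" for b
    by (rule form_cong[OF form_diff[OF f0[OF that] form_rec_d'[OF f1[OF that]]]]) (simp only: e1 that)
  have "?e 0 \<alpha>s \<in> sforms M A V (q + 1) 0" if "\<alpha>s \<in> tuples 1 SA" for \<alpha>s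
  proof -
    from that obtain a where "\<alpha>s = [a]" "a \<in> SA" by (auto simp: tuples_1_iff)
    then show ?thesis
      using form0[of a, unfolded form_iff] out[of 0 "[a]"]
      by (auto simp: sforms_def multilinear_def[of CF smul] symmetric_def weil_dom_def)
  qed
  moreover have "?e 1 [] \<in> sforms M A V q 1"
  proof -
    have "multilinear CF smul SA 1 (\<lambda>\<beta>s. ?e 1 [] \<beta>s Xs)" if "Xs \<in> tuples q VF" for Xs
      using e_add1[OF _ _ that] e_smul1[OF _ _ that] by (auto simp: multilinear_def tuples_1_iff)
    moreover have "symmetric SA 1 (\<lambda>\<beta>s. ?e 1 [] \<beta>s Xs)" for Xs
      by (auto simp: symmetric_def tuples_1_iff)
    moreover have "(\<forall>Xs\<in>tuples q VF. ?e 1 [] \<beta>s Xs \<in> SV) \<and> multilinear CF vf_smul VF q (?e 1 [] \<beta>s)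
      \<and> alternating VF q (?e 1 [] \<beta>s)" if "\<beta>s \<in> tuples 1 SA" for \<beta>s
      using form1[unfolded form_iff] that by (auto simp: tuples_1_iff)
    ultimately show ?thesis
      using out[of 1 "[]"] by (auto simp: sforms_def weil_dom_def)
  qed
  ultimately have 1: "?e k \<alpha>s \<in> sforms M A V (q + 1 - k) k" if "k \<le> 1" "\<alpha>s \<in> tuples (1 - k) SA" for k \<alpha>s
    using that by (cases k) auto
  have 2: "multilinear (range (\<lambda>r x. r)) smul SA (1 - k) (\<lambda>\<alpha>s. ?e k \<alpha>s \<beta>s Xs)" for k \<beta>s Xs
  proof (cases "k = 0 \<and> \<beta>s = [] \<and> Xs \<in> tuples (Suc q) VF")
    case True
    then show ?thesis
      using e_add0 e_scale0 by (auto simp: multilinear_def tuples_1_iff)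
  next
    \<comment> \<open>Multilinearity is demanded for all \<open>k\<close>, \<beta>s and
      \<open>Xs\<close>: for k = 0 outside the domain all values are 0, and for larger
      \<open>k\<close> no alternating slot is left.\<close>
    case False
    show ?thesis
    proof (cases k)
      case 0
      then have "?e k \<alpha>s \<beta>s Xs = 0" for \<alpha>s using False by (intro out) (auto simp: weil_dom_def)
      then show ?thesis by (simp add: multilinear_def smul_simps)
    qed (simp add: multilinear_def)
  qed
  have 3: "alternating SA (1 - k) (\<lambda>\<alpha>s. ?e k \<alpha>s \<beta>s Xs)" for k \<beta>s Xs
    by (auto simp: alternating_def)
  have 4: "?e k (smul f \<alpha> # \<alpha>s) \<beta>s Xs = smul f (?e k (\<alpha> # \<alpha>s) \<beta>s Xs) + wedge_d f (?e (Suc k) \<alpha>s (\<alpha> # \<beta>s)) Xs"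
    if "f \<in> CF" "weil_dom M A 1 (q + 1) k (\<alpha> # \<alpha>s) \<beta>s Xs" for k f \<alpha> \<alpha>s \<beta>s Xs
  proof -
    from that(2) have "k = 0" by (cases k) (auto simp: weil_dom_def)
    with that(2) have "k = 0" "\<alpha>s = []" "\<beta>s = []" "\<alpha> \<in> SA" "Xs \<in> tuples (Suc q) VF"
      by (simp_all add: weil_dom_def)
    then show ?thesis using e_smul0[OF that(1)] by simp
  qed
  show ?thesis
    unfolding weil_def using 1 2 3 4 out by blast
qed

lemma cov_d_IM_forms:
  assumes inv: "A_invariant M A V DA D" and c: "c \<in> IM_forms M A V DA q"
  shows "cov_d M A D 1 q c \<in> IM_forms M A V DA (q + 1)"
proof -
  have w: "c \<in> weil M A V 1 q" and d: "delta M A DA 1 q c = 0"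
    using c by (auto simp: IM_forms_def)
  \<comment> \<open>Commutation rewrites \<open>delta\<close> of the derivative as
    \<open>cov_d\<close> of \<open>delta c\<close>, which is the zero cochain of bidegree (2, q); it
    remains that \<open>cov_d\<close> maps zero to zero.\<close>
  have "cov_d M A D 2 q 0 k \<alpha>s \<beta>s Xs = 0" for k \<alpha>s \<beta>s Xs
  proof (cases "weil_dom M A 2 (q + 1) k \<alpha>s \<beta>s Xs")
    case True
    then have Xs: "Xs \<in> tuples (q + 1 - k) VF" by (simp add: weil_dom_def)
    have "(\<lambda>Zs. 0) = (0 :: ('m, 'v) vform)"
      by (simp add: zero_fun_def[where 'b = "'m \<Rightarrow> 'v"])
    then have "ext_d D 0 Xs = 0"
      using ext_d_eq_rec_d'[OF Xs form_0] rec_d_0[OF Xs] by metis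
    then show ?thesis
      unfolding cov_d_eq[OF True] by (simp add: zero_fun_apply sign_pow_simps)
  qed (simp add: cov_d_def)
  then have "cov_d M A D 2 q 0 = 0"
    by (intro ext) (simp add: zero_fun_apply)
  then have "delta M A DA 1 (q + 1) (cov_d M A D 1 q c) = 0"
    using cov_d_delta_commute[OF inv w] d by (simp add: numeral_2_eq_2)
  then show ?thesis
    using cov_d_weil_1[OF w] by (simp add: IM_forms_def)
qed

end

theorem theorem2p11:
  fixes M :: "('m::{t2_space,second_countable_topology}, 'e::fin_dim_normed_vector) atlas"
    and A :: "('m, 'a::fin_dim_normed_vector) lie_algebroid"
    and V :: "('m, 'v::fin_dim_normed_vector) vbundle"
    and DA :: "('m \<Rightarrow> 'a) \<Rightarrow> ('m \<Rightarrow> 'v) \<Rightarrow> 'm \<Rightarrow> 'v"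
    and D :: "'m vfield \<Rightarrow> ('m \<Rightarrow> 'v) \<Rightarrow> 'm \<Rightarrow> 'v"
  assumes "smooth_manifold M"
    and "is_lie_algebroid M A"
    and "representation M A V DA"
    and "linear_connection M V D"
  shows "((\<forall>p q. \<forall>c\<in>weil M A V p q.
             cov_d M A D (p + 1) q (delta M A DA p q c) = delta M A DA p (q + 1) (cov_d M A D p q c))
           \<longleftrightarrow> A_invariant M A V DA D)
         \<and> (A_invariant M A V DA D \<longrightarrow>
           (\<forall>q. \<forall>c\<in>IM_forms M A V DA q. cov_d M A D 1 q c \<in> IM_forms M A V DA (q + 1)))
         \<and> (\<forall>q. \<forall>c\<in>weil M A V 1 q. \<forall>\<alpha>\<in>asections M A.
             (\<forall>Xs\<in>tuples (q + 1) (vfields M).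
                cov_d M A D 1 q c 0 [\<alpha>] [] Xs = ext_d D (c 0 [\<alpha>] []) Xs) \<and>
             (\<forall>Xs\<in>tuples q (vfields M).
                cov_d M A D 1 q c 1 [] [\<alpha>] Xs = c 0 [\<alpha>] [] Xs - ext_d D (c 1 [] [\<alpha>]) Xs))"
proof -
  interpret algebroid_rep M V D A DA
    using assms unfolding representation_def by unfold_locales auto
  show ?thesis
  proof (intro conjI iffI impI allI ballI)
    assume *: "\<forall>p q. \<forall>c\<in>weil M A V p q.
      cov_d M A D (p + 1) q (delta M A DA p q c) = delta M A DA p (q + 1) (cov_d M A D p q c)"
    show "A_invariant M A V DA D"
      by (rule invariant_of_commute) (use *[rule_format, of _ 0 0] in simp)
  qed (simp_all only: cov_d_delta_commute cov_d_IM_forms cov_d_1)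
qed

end
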